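(* Let $p\in(1,\infty)$, $s\in(0,1)$, let $\Omega\subset\mathbb{R}^N$ be a smooth bounded domain with $N>sp$, let $\gamma>0$ and let $f\in L^1(\Omega)$ be non-negative. Let $u$ be the weak solution of $$(-\Delta)_p^s u=\frac{f(x)}{u^\gamma}\ \text{ in }\Omega,\qquad u>0\ \text{ in }\Omega,\qquad u=0\ \text{ in }\mathbb{R}^N\setminus\Omega \qquad (P)$$ under zero Dirichlet boundary condition. Assume that $\Omega$ is symmetric with respect to some hyperplane $T^\nu_\lambda:=\{x\in\mathbb{R}^N: x\cdot\nu=\lambda\}$, with $\lambda\in\mathbb{R}$ and $\nu\in S^{N-1}$. If $f$ is symmetric with respect to $T^\nu_\lambda$, then $u$ is symmetric with respect to $T^\nu_\lambda$ too. In particular, if $\Omega$ is a ball or an annulus centered at the origin and $f$ is radially symmetric, then $u$ is radially symmetric.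
   Context: For measurable $u:\mathbb{R}^N\to\mathbb{R}$ let $[u]_{D^{s,p}(\mathbb{R}^N)}:=\left(\int_{\mathbb{R}^{2N}}\frac{|u(x)-u(y)|^p}{|x-y|^{N+sp}}\,dx\,dy\right)^{1/p}$, $W^{s,p}(\mathbb{R}^N):=\{u\in L^p(\mathbb{R}^N):[u]_{D^{s,p}(\mathbb{R}^N)}<\infty\}$, and $W^{s,p}_0(\Omega):=\{u\in W^{s,p}(\mathbb{R}^N): u=0 \text{ in }\mathbb{R}^N\setminus\Omega\}$. $W^{s,p}_{\rm loc}(\Omega)$ is the set of functions $u$ with $u\in L^p(K)$ and $\int_{K\times K}\frac{|u(x)-u(y)|^p}{|x-y|^{N+sp}}\,dx\,dy<\infty$ for all $K\Subset\Omega$. $(-\Delta)^s_p$ denotes the fractional $p$-Laplacian. Weak solution of $(P)$: a function $u\in W^{s,p}_{\rm loc}(\Omega)\cap L^{p-1}(\Omega)$, with $u>0$ in $\Omega$ and $u=0$ in $\mathbb{R}^N\setminus\Omega$, such that $u^{\max\{\frac{\gamma+p-1}{p},1\}}\in W^{s,p}_0(\Omega)$, $\frac{f}{u^\gamma}\in L^1_{\rm loc}(\Omega)$, and $$\int_{\mathbb{R}^{2N}}\frac{|u(x)-u(y)|^{p-2}(u(x)-u(y))(\varphi(x)-\varphi(y))}{|x-y|^{N+sp}}\,dx\,dy=\int_\Omega\frac{f(x)}{u^\gamma}\varphi\,dx\qquad\text{for every }\varphi\in C^\infty_c(\Omega).$$ Zero Dirichlet boundary condition: $u$ is nonnegative,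 $u=0$ in $\mathbb{R}^N\setminus\Omega$, and $(u-\varepsilon)^+\in W^{s,p}_0(\Omega)$ for every $\varepsilon>0$. Symmetry of functions is understood almost everywhere. *)

theory Defs
  imports "HOL-Analysis.Analysis"
begin

text \<open>
  Sobolev functions are represented by actual functions on the whole space, and pointwise
  requirements on them (sign, vanishing, symmetry) are imposed Lebesgue-almost everywhere.
  The dimension of the space is \<open>DIM('a)\<close>.
\<close>

subsection \<open>Smooth functions, test functions and smooth domains\<close>

primrec Ck :: "nat \<Rightarrow> ('a::euclidean_space \<Rightarrow> real) \<Rightarrow> bool" where
  "Ck 0 f \<longleftrightarrow> continuous_on UNIV f"
| "Ck (Suc k) f \<longleftrightarrow> (\<forall>x. f differentiable (at x)) \<and>
     (\<forall>b\<in>Basis. Ck k (\<lambda>x. frechet_derivative f (at x) b))"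

definition smooth :: "('a::euclidean_space \<Rightarrow> real) \<Rightarrow> bool" where
  "smooth f \<longleftrightarrow> (\<forall>k. Ck k f)"

definition compactly_contained :: "'a::euclidean_space set \<Rightarrow> 'a set \<Rightarrow> bool" where
  "compactly_contained K \<Omega> \<longleftrightarrow> compact (closure K) \<and> closure K \<subseteq> \<Omega>"

definition test_function :: "'a::euclidean_space set \<Rightarrow> ('a \<Rightarrow> real) \<Rightarrow> bool" where
  "test_function \<Omega> \<phi> \<longleftrightarrow> smooth \<phi> \<and> compactly_contained {x. \<phi> x \<noteq> 0} \<Omega>"

text \<open>
  The boundary is locally the graph of a smooth function over the hyperplane orthogonal to some
  unit vector \<open>e\<close>, with the domain on one side. The function \<open>g\<close> is defined on the whole space,
  but only its values on that hyperplane are used.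
\<close>

definition smooth_boundary :: "'a::euclidean_space set \<Rightarrow> bool" where
  "smooth_boundary \<Omega> \<longleftrightarrow>
     (\<forall>x0\<in>frontier \<Omega>. \<exists>r>0. \<exists>e g. norm e = 1 \<and> smooth g \<and>
        \<Omega> \<inter> ball x0 r = {x \<in> ball x0 r. x \<bullet> e > g (x - (x \<bullet> e) *\<^sub>R e)})"

definition smooth_bounded_domain :: "'a::euclidean_space set \<Rightarrow> bool" where
  "smooth_bounded_domain \<Omega> \<longleftrightarrow>
     open \<Omega> \<and> connected \<Omega> \<and> \<Omega> \<noteq> {} \<and> bounded \<Omega> \<and> smooth_boundary \<Omega>"

subsection \<open>Function spaces\<close>

definition Lp_on :: "real \<Rightarrow> 'a::euclidean_space set \<Rightarrow> ('a \<Rightarrow> real) \<Rightarrow> bool" where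
  "Lp_on q A u \<longleftrightarrow> u \<in> borel_measurable (lebesgue_on A) \<and>
     (\<integral>\<^sup>+x\<in>A. ennreal (\<bar>u x\<bar> powr q) \<partial>lebesgue) < \<infinity>"

definition L1_loc :: "'a::euclidean_space set \<Rightarrow> ('a \<Rightarrow> real) \<Rightarrow> bool" where
  "L1_loc \<Omega> g \<longleftrightarrow>
     (\<forall>K\<in>sets lebesgue. compactly_contained K \<Omega> \<longrightarrow> set_integrable lebesgue K g)"

text \<open>
  For \<open>A = UNIV\<close> this is the \<open>p\<close>-th power of the Gagliardo seminorm. On the diagonal, a null set,
  the integrand is 0 by convention.
\<close>

definition gagliardo_energy ::
  "real \<Rightarrow> real \<Rightarrow> 'a::euclidean_space set \<Rightarrow> ('a \<Rightarrow> real) \<Rightarrow> ennreal" where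
  "gagliardo_energy s p A u =
     (\<integral>\<^sup>+z\<in>A \<times> A. ennreal (\<bar>u (fst z) - u (snd z)\<bar> powr p
          / norm (fst z - snd z) powr (real DIM('a) + s * p)) \<partial>lebesgue)"

definition Wsp :: "real \<Rightarrow> real \<Rightarrow> ('a::euclidean_space \<Rightarrow> real) \<Rightarrow> bool" where
  "Wsp s p u \<longleftrightarrow> Lp_on p UNIV u \<and> gagliardo_energy s p UNIV u < \<infinity>"

definition Wsp0 :: "real \<Rightarrow> real \<Rightarrow> 'a::euclidean_space set \<Rightarrow> ('a \<Rightarrow> real) \<Rightarrow> bool" where
  "Wsp0 s p \<Omega> u \<longleftrightarrow> Wsp s p u \<and> (AE x in lebesgue. x \<notin> \<Omega> \<longrightarrow> u x = 0)"

definition Wsp_loc :: "real \<Rightarrow> real \<Rightarrow> 'a::euclidean_space set \<Rightarrow> ('a \<Rightarrow> real) \<Rightarrow> bool" where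
  "Wsp_loc s p \<Omega> u \<longleftrightarrow>
     (\<forall>K\<in>sets lebesgue. compactly_contained K \<Omega> \<longrightarrow>
        Lp_on p K u \<and> gagliardo_energy s p K u < \<infinity>)"

subsection \<open>The singular problem\<close>

text \<open>
  In the weak formulation, \<^const>\<open>has_bochner_integral\<close> also records that the left-hand side is an
  absolutely convergent integral; the Bochner integral of a non-integrable function would be 0.
  The integral on the right converges because of the local integrability of \<open>f / u\<^sup>\<gamma>\<close>.
\<close>

definition weak_solution ::
  "real \<Rightarrow> real \<Rightarrow> real \<Rightarrow> 'a::euclidean_space set \<Rightarrow> ('a \<Rightarrow> real) \<Rightarrow> ('a \<Rightarrow> real) \<Rightarrow> bool" where
  "weak_solution s p \<gamma> \<Omega> f u \<longleftrightarrow>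
     Wsp_loc s p \<Omega> u \<and> Lp_on (p - 1) \<Omega> u \<and>
     (AE x in lebesgue. x \<in> \<Omega> \<longrightarrow> u x > 0) \<and>
     (AE x in lebesgue. x \<notin> \<Omega> \<longrightarrow> u x = 0) \<and>
     Wsp0 s p \<Omega> (\<lambda>x. u x powr max ((\<gamma> + p - 1) / p) 1) \<and>
     L1_loc \<Omega> (\<lambda>x. f x / u x powr \<gamma>) \<and>
     (\<forall>\<phi>. test_function \<Omega> \<phi> \<longrightarrow>
        has_bochner_integral lebesgue
          (\<lambda>z. \<bar>u (fst z) - u (snd z)\<bar> powr (p - 2) * (u (fst z) - u (snd z))
                 * (\<phi> (fst z) - \<phi> (snd z))
               / norm (fst z - snd z) powr (real DIM('a) + s * p))
          (LINT x:\<Omega>|lebesgue. f x / u x powr \<gamma> * \<phi> x))"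

definition zero_dirichlet ::
  "real \<Rightarrow> real \<Rightarrow> 'a::euclidean_space set \<Rightarrow> ('a \<Rightarrow> real) \<Rightarrow> bool" where
  "zero_dirichlet s p \<Omega> u \<longleftrightarrow>
     (AE x in lebesgue. u x \<ge> 0) \<and>
     (AE x in lebesgue. x \<notin> \<Omega> \<longrightarrow> u x = 0) \<and>
     (\<forall>\<epsilon>>0. Wsp0 s p \<Omega> (\<lambda>x. max (u x - \<epsilon>) 0))"

subsection \<open>Symmetry\<close>

text \<open>Reflection across the hyperplane \<open>{x. x \<bullet> \<nu> = l}\<close>, for a unit vector \<open>\<nu>\<close>.\<close>

definition reflect :: "'a::euclidean_space \<Rightarrow> real \<Rightarrow> 'a \<Rightarrow> 'a" where
  "reflect \<nu> l x = x + (2 * (l - x \<bullet> \<nu>)) *\<^sub>R \<nu>"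

definition symmetric_set :: "'a::euclidean_space \<Rightarrow> real \<Rightarrow> 'a set \<Rightarrow> bool" where
  "symmetric_set \<nu> l A \<longleftrightarrow> reflect \<nu> l ` A = A"

definition symmetric_fun_on ::
  "'a::euclidean_space \<Rightarrow> real \<Rightarrow> 'a set \<Rightarrow> ('a \<Rightarrow> real) \<Rightarrow> bool" where
  "symmetric_fun_on \<nu> l A f \<longleftrightarrow>
     (AE x in lebesgue. x \<in> A \<longrightarrow> f (reflect \<nu> l x) = f x)"

definition radial_fun_on :: "'a::euclidean_space set \<Rightarrow> ('a \<Rightarrow> real) \<Rightarrow> bool" where
  "radial_fun_on A f \<longleftrightarrow> (\<exists>h. AE x in lebesgue. x \<in> A \<longrightarrow> f x = h (norm x))"

definition is_ball_or_annulus :: "'a::euclidean_space set \<Rightarrow> bool" where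
  "is_ball_or_annulus \<Omega> \<longleftrightarrow>
     (\<exists>R>0. \<Omega> = ball 0 R) \<or>
     (\<exists>r R. 0 < r \<and> r < R \<and> \<Omega> = {x. r < norm x \<and> norm x < R})"

end

theory Submission
  imports Defs
begin

text \<open>
  The symmetry of the solution is a consequence of uniqueness: the reflection of \<open>u\<close> solves the
  same problem. Uniqueness is a comparison principle. If \<open>u\<close>, \<open>v\<close> are solutions, \<open>\<epsilon> > 0\<close> and
  \<open>w = (u - \<epsilon>)\<^sup>+\<close>, choose bounded functions \<open>0 \<le> \<eta> \<le> w\<close> with compact support in \<open>\<Omega>\<close> that converge
  to \<open>w\<close> in the Sobolev norm; this is where the smoothness of the boundary enters. The function
  \<open>(\<eta> - v)\<^sup>+\<close> is admissible in both equations although \<open>v\<close> need not have finite energy up to the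
  boundary. The right-hand sides are ordered where it is positive, since \<open>t \<mapsto> t powr (- \<gamma>)\<close> is
  decreasing, and truncation turns \<open>u\<close> into the subsolution \<open>w\<close>. The equation of \<open>v\<close> bounds
  the energy of \<open>(\<eta> - v)\<^sup>+\<close> by that of \<open>\<eta>\<close>, so one may pass to the limit and conclude by strict
  monotonicity that \<open>(w - v)\<^sup>+\<close> is constant, hence 0 because it vanishes outside \<open>\<Omega>\<close>.
\<close>

subsection \<open>Elementary inequalities and continuity of translations\<close>

text \<open>The obstacle is missing energy. When \<open>\<gamma>\<close> > 1 only a power of a
  solution is known to lie in the Sobolev space; the solution itself has local energy only, so the
  difference of two solutions is no test function. The global energy that remains is that of the
  truncations (u - \<epsilon>)^+, granted by the Dirichlet condition. Multiplying (w - v)^+ by a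
  cut-off would leave error terms in v at the boundary. Approximating w first and subtracting v
  afterwards avoids them, because v \<ge> 0 keeps (\<eta> - v)^+ inside the support of \<eta>. The
  order \<eta> \<le> w places that support in the region where u > \<epsilon> and u > v, which both
  the truncation and the ordering of the right-hand sides require.

  Test functions have to be bounded: the right-hand side is only locally integrable, and away from
  the diagonal the left-hand side is an L^1 function times the test function. The equation is
  therefore carried over from smooth test functions by averaging over translations, under which
  these terms and the energy near the diagonal are all continuous.\<close>

lemma powr_add_le:
  fixes a b p :: real
  assumes "0 < p"
  shows "\<bar>a + b\<bar> powr p \<le> 2 powr p * (\<bar>a\<bar> powr p + \<bar>b\<bar> powr p)"
proof -
  have "\<bar>a + b\<bar> powr p \<le> (2 * max \<bar>a\<bar> \<bar>b\<bar>) powr p"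
    using assms by (intro powr_mono2) auto
  also have "\<dots> = 2 powr p * max \<bar>a\<bar> \<bar>b\<bar> powr p"
    by (simp add: powr_mult)
  also have "\<dots> \<le> 2 powr p * (\<bar>a\<bar> powr p + \<bar>b\<bar> powr p)"
    by (intro mult_left_mono) (auto simp: max_def)
  finally show ?thesis .
qed

lemma powr_minus_one_mult: "0 \<le> x \<Longrightarrow> x powr (p - 1) * x = x powr p" for x p :: real
  by (cases "x = 0") (auto simp: powr_diff)

text \<open>The crude form of Young's inequality, in which the larger of the two numbers replaces
  the smaller one; all its uses leave the constants free.\<close>

lemma powr_mult_le_add:
  fixes x y p :: real
  assumes "1 < p" "0 \<le> x" "0 \<le> y"
  shows "x powr (p - 1) * y \<le> x powr p + y powr p"
proof (cases "x \<le> y")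
  case True
  have "x powr (p - 1) * y \<le> y powr (p - 1) * y"
    using assms True by (intro mult_mono powr_mono2) auto
  also have "\<dots> = y powr p" using assms by (intro powr_minus_one_mult)
  finally show ?thesis by (smt (verit) powr_ge_zero)
next
  case False
  have "x powr (p - 1) * y \<le> x powr (p - 1) * x"
    using assms False by (intro mult_mono powr_mono2) auto
  also have "\<dots> = x powr p" using assms by (intro powr_minus_one_mult)
  finally show ?thesis by (smt (verit) powr_ge_zero)
qed

text \<open>Follows by scaling: \<open>powr_mult_le_add\<close> is applied to x and (c / e) * y, and
  the result is multiplied by e.\<close>

lemma powr_mult_le_eps:
  fixes p c e :: real
  assumes "1 < p" "0 < e" "0 < c"
  shows "\<exists>C>0. \<forall>x\<ge>0. \<forall>y\<ge>0. c * (x powr (p - 1) * y) \<le> e * x powr p + C * y powr p"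
proof -
  define t where "t = c / e"
  have t: "t > 0" using assms by (simp add: t_def)
  have "c * (x powr (p - 1) * y) \<le> e * x powr p + (e * t powr p) * y powr p"
    if "x \<ge> 0" "y \<ge> 0" for x y
  proof -
    have "x powr (p - 1) * (t * y) \<le> x powr p + (t * y) powr p"
      using assms that t by (intro powr_mult_le_add) auto
    also have "(t * y) powr p = t powr p * y powr p"
      using t that by (simp add: powr_mult)
    finally have "e * (x powr (p - 1) * (t * y)) \<le> e * (x powr p + t powr p * y powr p)"
      using assms by simp
    moreover have "e * (x powr (p - 1) * (t * y)) = c * (x powr (p - 1) * y)"
      using assms by (simp add: t_def field_simps)
    ultimately show ?thesis by (simp add: distrib_left mult.assoc)
  qed
  then show ?thesis using assms t
    by (intro exI[of _ "e * t powr p"]) auto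
qed

section \<open>Continuity of translations in Lebesgue spaces\<close>

lemma nn_integral_lborel_translation:
  fixes h :: "'a::euclidean_space"
  assumes [measurable]: "f \<in> borel_measurable borel"
  shows "(\<integral>\<^sup>+z. f (z + h) \<partial>lborel) = (\<integral>\<^sup>+z. f z \<partial>lborel)"
proof -
  have "(\<integral>\<^sup>+z. f z \<partial>lborel) = (\<integral>\<^sup>+z. f z \<partial>distr lborel borel ((+) h))"
    by (simp add: lborel_distr_plus)
  also have "\<dots> = (\<integral>\<^sup>+z. f (h + z) \<partial>lborel)"
    by (subst nn_integral_distr) auto
  finally show ?thesis by (simp add: add.commute)
qed

definition L1_translation_continuous :: "('a::euclidean_space \<Rightarrow> real) \<Rightarrow> bool" where
  "L1_translation_continuous g \<longleftrightarrow>
     (\<forall>e>0. \<exists>d>0. \<forall>h. norm h < d \<longrightarrow>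
        (\<integral>\<^sup>+z. ennreal \<bar>g (z + h) - g z\<bar> \<partial>lborel) \<le> ennreal e)"

text \<open>Regularity squeezes A between a compact K and an open U that differ by little measure. A
  translation shorter than the distance of K to the complement of U keeps K inside U, so the
  indicator changes only where U - K is met.\<close>

lemma L1_translation_continuous_indicator:
  fixes A :: "'a::euclidean_space set"
  assumes A[measurable]: "A \<in> sets borel" and fin: "emeasure lborel A < \<infinity>"
  shows "L1_translation_continuous (indicator A)"
  unfolding L1_translation_continuous_def
proof (intro allI impI)
  fix e :: real assume e: "e > 0"
  then have e6: "e / 6 > 0" by simp
  have AL: "A \<in> sets lebesgue" by simp
  obtain U where U: "open U" "A \<subseteq> U" "emeasure lebesgue (U - A) < ennreal (e/6)"
    by (rule sets_lebesgue_outer_open[OF AL e6])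
  obtain C where C: "closed C" "C \<subseteq> A" "emeasure lebesgue (A - C) < ennreal (e/6)"
    by (rule sets_lebesgue_inner_closed[OF AL e6])
  note [measurable] = borel_open[OF U(1)] borel_closed[OF C(1)]
  have U3: "emeasure lborel (U - A) < ennreal (e/6)" and C3: "emeasure lborel (A - C) < ennreal (e/6)"
    using U(3) C(3) by simp_all
  \<comment> \<open>Inner regularity yields a closed set only; intersecting it with a large ball
    makes it compact at the cost of another e / 6.\<close>
  have "(\<lambda>n. emeasure lborel (C - ball 0 (real n))) \<longlonglongrightarrow> emeasure lborel (\<Inter>n. C - ball 0 (real n))"
  proof (rule Lim_emeasure_decseq)
    show "decseq (\<lambda>n. C - ball 0 (real n))"
      by (auto simp: decseq_def)
    show "emeasure lborel (C - ball 0 (real n)) \<noteq> \<infinity>" for n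
    proof -
      have "emeasure lborel (C - ball 0 (real n)) \<le> emeasure lborel A"
        using C by (intro emeasure_mono) auto
      then show ?thesis using fin by (auto simp: top_unique)
    qed
  qed (auto intro: borel_closed C)
  moreover have "(\<Inter>n. C - ball 0 (real n)) = {}"
  proof -
    have False if "\<forall>n. x \<in> C - ball 0 (real n)" for x :: 'a
    proof -
      obtain n where "norm x < real n" using reals_Archimedean2 by blast
      then show False using that by (auto dest: spec[of _ n])
    qed
    then show ?thesis by (auto simp: reals_Archimedean2)
  qed
  ultimately have "(\<lambda>n. emeasure lborel (C - ball 0 (real n))) \<longlonglongrightarrow> 0"
    by (metis emeasure_empty)
  then have "\<forall>\<^sub>F n in sequentially. emeasure lborel (C - ball 0 (real n)) < ennreal (e/6)"
    using e by (intro order_tendstoD) auto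
  then obtain n where n: "emeasure lborel (C - ball 0 (real n)) < ennreal (e/6)"
    by (auto simp: eventually_sequentially)
  define K where "K = C \<inter> cball 0 (real n)"
  have K: "compact K" "K \<subseteq> U" "K \<subseteq> A"
    using C U by (auto simp: K_def intro: closed_Int_compact)
  note [measurable] = borel_compact[OF K(1)]
  have "emeasure lborel (U - K) \<le> emeasure lborel ((U - A) \<union> ((A - C) \<union> (C - ball 0 (real n))))"
    by (intro emeasure_mono) (auto simp: K_def)
  also have "\<dots> \<le> emeasure lborel (U - A) + emeasure lborel ((A - C) \<union> (C - ball 0 (real n)))"
    by (intro emeasure_subadditive) auto
  also have "\<dots> \<le> emeasure lborel (U - A) + (emeasure lborel (A - C) + emeasure lborel (C - ball 0 (real n)))"
    by (intro add_left_mono emeasure_subadditive) auto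
  also have "\<dots> \<le> ennreal (e/6) + (ennreal (e/6) + ennreal (e/6))"
    using U3 C3 n by (intro add_mono) auto
  also have "\<dots> = ennreal (e/2)"
    using e by (simp flip: ennreal_plus)
  finally have UK: "emeasure lborel (U - K) \<le> ennreal (e/2)" .
  obtain d where d: "d > 0" "(\<Union>x\<in>K. ball x d) \<subseteq> U"
    using compact_subset_open_imp_ball_epsilon_subset[OF K(1) U(1) K(2)] by blast
  have "(\<integral>\<^sup>+z. ennreal \<bar>indicator A (z + h) - indicator A z\<bar> \<partial>lborel) \<le> ennreal e"
    if h: "norm h < d" for h
  proof -
    \<comment> \<open>If exactly one of z and z + h lies in A, this point is in U - K, or it is in
      K; in the latter case the other one is in U by the choice of d, and outside K because it is
      outside A.\<close>
    have *: "\<bar>indicator A (z + h) - indicator A z :: real\<bar> \<le> indicator (U - K) (z + h) + indicator (U - K) z" for z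
    proof -
      have 1: "z \<in> U" if "z + h \<in> K"
      proof -
        have "z \<in> ball (z + h) d" using h by (simp add: dist_norm)
        then show ?thesis using that d by blast
      qed
      have 2: "z + h \<in> U" if "z \<in> K"
      proof -
        have "z + h \<in> ball z d" using h by (simp add: dist_norm)
        then show ?thesis using that d by blast
      qed
      show ?thesis using 1 2 K U(2) by (auto simp: indicator_def)
    qed
    have "(\<integral>\<^sup>+z. ennreal \<bar>indicator A (z + h) - indicator A z\<bar> \<partial>lborel)
       \<le> (\<integral>\<^sup>+z. ennreal (indicator (U - K) (z + h) + indicator (U - K) z) \<partial>lborel)"
      by (intro nn_integral_mono ennreal_leI *)
    also have "\<dots> = (\<integral>\<^sup>+z. indicator (U - K) (z + h) + indicator (U - K) z \<partial>lborel)"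
      by (intro nn_integral_cong) (auto simp: indicator_def split: if_splits)
    also have "\<dots> = (\<integral>\<^sup>+z. indicator (U - K) (z + h) \<partial>lborel) + emeasure lborel (U - K)"
      by (subst nn_integral_add) auto
    also have "(\<integral>\<^sup>+z. indicator (U - K) (z + h) \<partial>lborel) = emeasure lborel (U - K)"
      by (subst nn_integral_lborel_translation) auto
    also have "emeasure lborel (U - K) + emeasure lborel (U - K) \<le> ennreal (e/2) + ennreal (e/2)"
      using UK by (intro add_mono)
    also have "\<dots> = ennreal e" using e by (simp flip: ennreal_plus)
    finally show ?thesis .
  qed
  then show "\<exists>d>0. \<forall>h. norm h < d \<longrightarrow> (\<integral>\<^sup>+z. ennreal \<bar>indicator A (z + h) - indicator A z\<bar> \<partial>lborel) \<le> ennreal e"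
    using d(1) by blast
qed

lemma L1_translation_continuous_scale:
  assumes "L1_translation_continuous g" and [measurable]: "g \<in> borel_measurable borel"
  shows "L1_translation_continuous (\<lambda>x. g x * c)"
  unfolding L1_translation_continuous_def
proof (intro allI impI)
  fix e :: real assume e: "e > 0"
  have "e / (\<bar>c\<bar> + 1) > 0" using e by simp
  then obtain d where d: "d > 0" "\<And>h. norm h < d \<Longrightarrow>
     (\<integral>\<^sup>+z. ennreal \<bar>g (z + h) - g z\<bar> \<partial>lborel) \<le> ennreal (e / (\<bar>c\<bar> + 1))"
    using assms(1) unfolding L1_translation_continuous_def by blast
  have "(\<integral>\<^sup>+z. ennreal \<bar>g (z + h) * c - g z * c\<bar> \<partial>lborel) \<le> ennreal e" if "norm h < d" for h
  proof -
    have "(\<integral>\<^sup>+z. ennreal \<bar>g (z + h) * c - g z * c\<bar> \<partial>lborel)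
      = (\<integral>\<^sup>+z. ennreal \<bar>c\<bar> * ennreal \<bar>g (z + h) - g z\<bar> \<partial>lborel)"
      by (intro nn_integral_cong) (simp add: abs_mult mult.commute flip: ennreal_mult' left_diff_distrib right_diff_distrib)
    also have "\<dots> = ennreal \<bar>c\<bar> * (\<integral>\<^sup>+z. ennreal \<bar>g (z + h) - g z\<bar> \<partial>lborel)"
      by (subst nn_integral_cmult) auto
    also have "\<dots> \<le> ennreal \<bar>c\<bar> * ennreal (e / (\<bar>c\<bar> + 1))"
      using d that by (intro mult_left_mono) auto
    also have "\<dots> = ennreal (\<bar>c\<bar> * (e / (\<bar>c\<bar> + 1)))"
      using e by (subst ennreal_mult') auto
    also have "\<dots> \<le> ennreal e"
      using e by (intro ennreal_leI) (auto simp: field_simps)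
    finally show ?thesis .
  qed
  then show "\<exists>d>0. \<forall>h. norm h < d \<longrightarrow> (\<integral>\<^sup>+z. ennreal \<bar>g (z + h) * c - g z * c\<bar> \<partial>lborel) \<le> ennreal e"
    using d(1) by blast
qed

lemma L1_translation_continuous_add:
  assumes "L1_translation_continuous f" and [measurable]: "f \<in> borel_measurable borel"
    and "L1_translation_continuous g" and [measurable]: "g \<in> borel_measurable borel"
  shows "L1_translation_continuous (\<lambda>x. f x + g x)"
  unfolding L1_translation_continuous_def
proof (intro allI impI)
  fix e :: real assume e: "e > 0"
  then have e2: "e / 2 > 0" by simp
  obtain d where d: "d > 0" "\<And>h. norm h < d \<Longrightarrow>
     (\<integral>\<^sup>+z. ennreal \<bar>f (z + h) - f z\<bar> \<partial>lborel) \<le> ennreal (e / 2)"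
    using assms(1) e2 unfolding L1_translation_continuous_def by blast
  obtain d' where d': "d' > 0" "\<And>h. norm h < d' \<Longrightarrow>
     (\<integral>\<^sup>+z. ennreal \<bar>g (z + h) - g z\<bar> \<partial>lborel) \<le> ennreal (e / 2)"
    using assms(3) e2 unfolding L1_translation_continuous_def by blast
  have "(\<integral>\<^sup>+z. ennreal \<bar>f (z + h) + g (z + h) - (f z + g z)\<bar> \<partial>lborel) \<le> ennreal e"
    if "norm h < min d d'" for h
  proof -
    have "(\<integral>\<^sup>+z. ennreal \<bar>f (z + h) + g (z + h) - (f z + g z)\<bar> \<partial>lborel)
      \<le> (\<integral>\<^sup>+z. ennreal \<bar>f (z + h) - f z\<bar> + ennreal \<bar>g (z + h) - g z\<bar> \<partial>lborel)"
      by (intro nn_integral_mono) (simp flip: ennreal_plus)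
    also have "\<dots> = (\<integral>\<^sup>+z. ennreal \<bar>f (z + h) - f z\<bar> \<partial>lborel) + (\<integral>\<^sup>+z. ennreal \<bar>g (z + h) - g z\<bar> \<partial>lborel)"
      by (subst nn_integral_add) auto
    also have "\<dots> \<le> ennreal (e/2) + ennreal (e/2)"
      using that d d' by (intro add_mono) auto
    also have "\<dots> = ennreal e" using e by (simp flip: ennreal_plus)
    finally show ?thesis .
  qed
  then show "\<exists>d>0. \<forall>h. norm h < d \<longrightarrow> (\<integral>\<^sup>+z. ennreal \<bar>f (z + h) + g (z + h) - (f z + g z)\<bar> \<partial>lborel) \<le> ennreal e"
    using d(1) d'(1) by (intro exI[of _ "min d d'"]) auto
qed

text \<open>The limit step of a density argument. A general exponent p > 0 lets it serve twice: with
  p = 1 in the induction over integrable functions, and again for L^p.\<close>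

lemma Lp_translation_continuous_lim:
  fixes g :: "'a::euclidean_space \<Rightarrow> real" and p :: real
  assumes p: "0 < p" and [measurable]: "g \<in> borel_measurable borel" "\<And>i. s i \<in> borel_measurable borel"
    and conv: "(\<lambda>i. \<integral>\<^sup>+z. ennreal (\<bar>g z - s i z\<bar> powr p) \<partial>lborel) \<longlonglongrightarrow> 0"
    and s: "\<And>i e. e > 0 \<Longrightarrow> \<exists>d>0. \<forall>h. norm h < d \<longrightarrow>
        (\<integral>\<^sup>+z. ennreal (\<bar>s (i::nat) (z + h) - s i z\<bar> powr p) \<partial>lborel) \<le> ennreal e"
    and e: "e > 0"
  shows "\<exists>d>0. \<forall>h. norm h < d \<longrightarrow>
        (\<integral>\<^sup>+z. ennreal (\<bar>g (z + h) - g z\<bar> powr p) \<partial>lborel) \<le> ennreal e"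
proof -
  \<comment> \<open>Two applications of \<open>powr_add_le\<close> split the difference into three
    terms, and each is then made at most e / (3 * c).\<close>
  define c where "c = 2 powr p * 2 powr p"
  have c: "c > 0" by (simp add: c_def)
  have "\<forall>\<^sub>F i in sequentially. (\<integral>\<^sup>+z. ennreal (\<bar>g z - s i z\<bar> powr p) \<partial>lborel) < ennreal (e / (3*c))"
    using e c by (intro order_tendstoD[OF conv]) auto
  then obtain i where i: "(\<integral>\<^sup>+z. ennreal (\<bar>g z - s i z\<bar> powr p) \<partial>lborel) < ennreal (e / (3*c))"
    by (auto simp: eventually_sequentially)
  have "e / (3*c) > 0" using e c by simp
  then obtain d where d: "d > 0" "\<And>h. norm h < d \<Longrightarrow>
        (\<integral>\<^sup>+z. ennreal (\<bar>s i (z + h) - s i z\<bar> powr p) \<partial>lborel) \<le> ennreal (e / (3*c))"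
    using s by blast
  have "(\<integral>\<^sup>+z. ennreal (\<bar>g (z + h) - g z\<bar> powr p) \<partial>lborel) \<le> ennreal e"
    if h: "norm h < d" for h
  proof -
    have "\<bar>g (z + h) - g z\<bar> powr p \<le> c * (\<bar>g (z + h) - s i (z + h)\<bar> powr p
       + \<bar>s i (z + h) - s i z\<bar> powr p + \<bar>g z - s i z\<bar> powr p)" for z
    proof -
      have "\<bar>g (z + h) - g z\<bar> powr p
        \<le> 2 powr p * (\<bar>(g (z + h) - s i (z + h)) + (s i (z + h) - s i z)\<bar> powr p + \<bar>s i z - g z\<bar> powr p)"
        using powr_add_le[OF p, of "(g (z + h) - s i (z + h)) + (s i (z + h) - s i z)" "s i z - g z"]
        by simp
      also have "\<dots> \<le> 2 powr p * (2 powr p * (\<bar>g (z + h) - s i (z + h)\<bar> powr p + \<bar>s i (z + h) - s i z\<bar> powr p)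
           + 2 powr p * \<bar>g z - s i z\<bar> powr p)"
      proof (intro mult_left_mono add_mono powr_add_le p)
        have "1 * \<bar>g z - s i z\<bar> powr p \<le> 2 powr p * \<bar>g z - s i z\<bar> powr p"
          using p ge_one_powr_ge_zero[of 2 p] by (intro mult_right_mono) auto
        then show "\<bar>s i z - g z\<bar> powr p \<le> 2 powr p * \<bar>g z - s i z\<bar> powr p"
          by (simp add: abs_minus_commute)
      qed simp
      finally show ?thesis by (simp add: c_def algebra_simps)
    qed
    then have "(\<integral>\<^sup>+z. ennreal (\<bar>g (z + h) - g z\<bar> powr p) \<partial>lborel)
      \<le> (\<integral>\<^sup>+z. ennreal c * (ennreal (\<bar>g (z + h) - s i (z + h)\<bar> powr p)
       + ennreal (\<bar>s i (z + h) - s i z\<bar> powr p) + ennreal (\<bar>g z - s i z\<bar> powr p)) \<partial>lborel)"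
      using c by (intro nn_integral_mono) (simp flip: ennreal_plus ennreal_mult')
    also have "\<dots> = ennreal c * ((\<integral>\<^sup>+z. ennreal (\<bar>g (z + h) - s i (z + h)\<bar> powr p) \<partial>lborel)
       + (\<integral>\<^sup>+z. ennreal (\<bar>s i (z + h) - s i z\<bar> powr p) \<partial>lborel)
       + (\<integral>\<^sup>+z. ennreal (\<bar>g z - s i z\<bar> powr p) \<partial>lborel))"
      by (simp add: nn_integral_cmult nn_integral_add)
    also have "(\<integral>\<^sup>+z. ennreal (\<bar>g (z + h) - s i (z + h)\<bar> powr p) \<partial>lborel)
        = (\<integral>\<^sup>+z. ennreal (\<bar>g z - s i z\<bar> powr p) \<partial>lborel)"
      by (rule nn_integral_lborel_translation[where f = "\<lambda>z. ennreal (\<bar>g z - s i z\<bar> powr p)"]) simp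
    also have "ennreal c * ((\<integral>\<^sup>+z. ennreal (\<bar>g z - s i z\<bar> powr p) \<partial>lborel)
       + (\<integral>\<^sup>+z. ennreal (\<bar>s i (z + h) - s i z\<bar> powr p) \<partial>lborel)
       + (\<integral>\<^sup>+z. ennreal (\<bar>g z - s i z\<bar> powr p) \<partial>lborel))
      \<le> ennreal c * (ennreal (e / (3*c)) + ennreal (e / (3*c)) + ennreal (e / (3*c)))"
      using d(2)[OF h] i by (intro mult_left_mono add_mono) auto
    also have "\<dots> = ennreal e"
      using e c by (simp add: field_simps flip: ennreal_plus ennreal_mult')
    finally show ?thesis .
  qed
  then show ?thesis using d(1) by blast
qed

lemma integrable_L1_translation_continuous:
  fixes g :: "'a::euclidean_space \<Rightarrow> real"
  assumes "integrable lborel g"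
  shows "L1_translation_continuous g"
  using assms
proof (induction rule: integrable_induct)
  case (base A c)
  then show ?case
    using L1_translation_continuous_scale[OF L1_translation_continuous_indicator, of A c] by simp
next
  case (add f g)
  then show ?case by (intro L1_translation_continuous_add) auto
next
  case (lim f s)
  have [measurable]: "f \<in> borel_measurable borel" "\<And>i. s i \<in> borel_measurable borel"
    using lim by auto
  have fin: "(\<integral>\<^sup>+x. ennreal (2 * norm (f x)) \<partial>lborel) < \<infinity>"
  proof -
    have "integrable lborel (\<lambda>x. 2 * norm (f x))" using lim by auto
    then show ?thesis unfolding integrable_iff_bounded by simp
  qed
  have "(\<lambda>i. \<integral>\<^sup>+z. norm (f z - s i z) \<partial>lborel) \<longlonglongrightarrow> 0"
    using lim(2,3) fin
    by (intro nn_integral_dominated_convergence_norm[where w="\<lambda>x. 2 * norm (f x)"]) auto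
  then have "(\<lambda>i. \<integral>\<^sup>+z. ennreal (\<bar>f z - s i z\<bar> powr 1) \<partial>lborel) \<longlonglongrightarrow> 0"
    by simp
  from Lp_translation_continuous_lim[OF _ _ _ this] lim(5)
  show ?case unfolding L1_translation_continuous_def by simp
qed

text \<open>Reduction to L^1. Truncating values at height i and the argument to a ball of radius i
  approximates g in L^p, and for a function bounded by i the p-th power of a difference is at most
  (2 * i) powr (p - 1) times the difference itself.\<close>

lemma Lp_translation_continuous:
  fixes g :: "'a::euclidean_space \<Rightarrow> real"
  assumes p: "1 \<le> p" and [measurable]: "g \<in> borel_measurable borel"
    and fin: "(\<integral>\<^sup>+z. ennreal (\<bar>g z\<bar> powr p) \<partial>lborel) < \<infinity>"
    and e: "e > 0"
  shows "\<exists>d>0. \<forall>h. norm h < d \<longrightarrow>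
        (\<integral>\<^sup>+z. ennreal (\<bar>g (z + h) - g z\<bar> powr p) \<partial>lborel) \<le> ennreal e"
proof (rule Lp_translation_continuous_lim[OF _ _ _ _ _ e])
  define s where "s i z = (if norm z < real i then max (- real i) (min (g z) (real i)) else 0)" for i z
  show [measurable]: "s i \<in> borel_measurable borel" for i
    unfolding s_def by measurable
  have sb: "\<bar>s i z\<bar> \<le> real i" for i z by (auto simp: s_def)
  have gs: "\<bar>g z - s i z\<bar> \<le> \<bar>g z\<bar>" for i z by (auto simp: s_def)
  have "(\<lambda>i. \<integral>\<^sup>+z. ennreal (\<bar>g z - s i z\<bar> powr p) \<partial>lborel) \<longlonglongrightarrow> (\<integral>\<^sup>+z. 0 \<partial>(lborel::'a measure))"
  proof (rule nn_integral_dominated_convergence[where w = "\<lambda>z. ennreal (\<bar>g z\<bar> powr p)"])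
    show "AE x in lborel. ennreal (\<bar>g x - s j x\<bar> powr p) \<le> ennreal (\<bar>g x\<bar> powr p)" for j
      using gs p by (intro AE_I2 ennreal_leI powr_mono2) auto
    have "(\<lambda>i. ennreal (\<bar>g x - s i x\<bar> powr p)) \<longlonglongrightarrow> 0" for x
    proof (rule tendsto_eventually)
      obtain n where n: "norm x < real n" "\<bar>g x\<bar> < real n"
        using reals_Archimedean2[of "max (norm x) \<bar>g x\<bar>"] by auto
      have "ennreal (\<bar>g x - s i x\<bar> powr p) = 0" if "i \<ge> n" for i
      proof -
        have "s i x = g x" using n that by (auto simp: s_def)
        then show ?thesis by simp
      qed
      then show "\<forall>\<^sub>F i in sequentially. ennreal (\<bar>g x - s i x\<bar> powr p) = 0"
        by (auto simp: eventually_sequentially)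
    qed
    then show "AE x in lborel. (\<lambda>i. ennreal (\<bar>g x - s i x\<bar> powr p)) \<longlonglongrightarrow> 0" by simp
  qed (use fin in auto)
  then show "(\<lambda>i. \<integral>\<^sup>+z. ennreal (\<bar>g z - s i z\<bar> powr p) \<partial>lborel) \<longlonglongrightarrow> 0" by simp
  show "\<exists>d>0. \<forall>h. norm h < d \<longrightarrow>
        (\<integral>\<^sup>+z. ennreal (\<bar>s i (z + h) - s i z\<bar> powr p) \<partial>lborel) \<le> ennreal e" if e: "e > 0" for i e
  proof -
    have "integrable lborel (s i)"
    proof (rule integrableI_bounded_set[where A = "ball 0 (real i)" and B = "real i"])
      show "emeasure lborel (ball (0::'a) (real i)) < \<infinity>" by (rule emeasure_lborel_ball_finite)
    qed (use sb in \<open>auto simp: s_def\<close>)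
    then have "L1_translation_continuous (s i)"
      by (rule integrable_L1_translation_continuous)
    moreover define c where "c = (2 * real i) powr (p - 1)"
    have c0: "c \<ge> 0" by (simp add: c_def)
    moreover have "e / (c + 1) > 0" using e c0 by simp
    ultimately obtain d where d: "d > 0" "\<And>h. norm h < d \<Longrightarrow>
        (\<integral>\<^sup>+z. ennreal \<bar>s i (z + h) - s i z\<bar> \<partial>lborel) \<le> ennreal (e / (c + 1))"
      unfolding L1_translation_continuous_def by blast
    have "(\<integral>\<^sup>+z. ennreal (\<bar>s i (z + h) - s i z\<bar> powr p) \<partial>lborel) \<le> ennreal e" if "norm h < d" for h
    proof -
      have "\<bar>s i (z + h) - s i z\<bar> powr p \<le> c * \<bar>s i (z + h) - s i z\<bar>" for z
      proof -
        have "\<bar>s i (z + h) - s i z\<bar> powr p = \<bar>s i (z + h) - s i z\<bar> powr (p - 1) * \<bar>s i (z + h) - s i z\<bar>"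
          by (simp add: powr_minus_one_mult)
        also have "\<dots> \<le> c * \<bar>s i (z + h) - s i z\<bar>"
          unfolding c_def using p sb[of i z] sb[of i "z + h"]
          by (intro mult_mono powr_mono2) auto
        finally show ?thesis .
      qed
      then have "(\<integral>\<^sup>+z. ennreal (\<bar>s i (z + h) - s i z\<bar> powr p) \<partial>lborel)
        \<le> (\<integral>\<^sup>+z. ennreal c * ennreal \<bar>s i (z + h) - s i z\<bar> \<partial>lborel)"
        using c0 by (intro nn_integral_mono) (simp flip: ennreal_mult')
      also have "\<dots> = ennreal c * (\<integral>\<^sup>+z. ennreal \<bar>s i (z + h) - s i z\<bar> \<partial>lborel)"
        by (subst nn_integral_cmult) auto
      also have "\<dots> \<le> ennreal c * ennreal (e / (c + 1))"
        using d that by (intro mult_left_mono) auto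
      also have "\<dots> = ennreal (c * (e / (c + 1)))"
        using c0 by (rule ennreal_mult'[symmetric])
      also have "\<dots> \<le> ennreal e"
        using c0 e by (intro ennreal_leI) (auto simp: field_simps)
      finally show ?thesis .
    qed
    then show ?thesis using d(1) by blast
  qed
qed (use p in auto)

subsection \<open>Kernel integrals and isometry invariance of Lebesgue measure\<close>

text \<open>Dyadic scales take the place of polar coordinates: at norm h of order 2^(-k) or 2^k the
  integrand is bounded by a constant on a ball of that radius. Multiplied by the volumes of the
  balls, these constants form geometric series of ratios \<open>2 powr (a - b)\<close> near 0 and
  \<open>2 powr (- a)\<close> at infinity.\<close>

lemma nn_integral_powr_annuli:
  fixes a b :: real
  assumes a: "0 < a" "a < b"
  shows "(\<integral>\<^sup>+h. ennreal (min 1 (norm (h::'a::euclidean_space)) powr b / norm h powr (real DIM('a) + a)) \<partial>lborel) < \<infinity>"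
proof -
  have b: "0 < b" using a by simp
  define n where "n = real DIM('a)"
  define V where "V = measure lborel (ball (0::'a) 1)"
  have V: "emeasure lborel (ball (0::'a) r) = ennreal (r powr n * V)" if "r > 0" for r
    using content_ball_conv_unit_ball[of r "0::'a"] that emeasure_lborel_ball_finite[of "0::'a" r]
    by (subst emeasure_eq_ennreal_measure) (auto simp: n_def V_def powr_realpow)
  have V0: "V \<ge> 0" by (simp add: V_def)
  define f where "f h = min 1 (norm (h::'a)) powr b / norm h powr (n + a)" for h
  \<comment> \<open>Replacing norm h by the next larger power of 2 costs at most a factor
    \<open>2 powr n\<close> near 0 and \<open>2 powr (n + a)\<close> at infinity; c covers
    both.\<close>
  define c where "c = 2 powr (n + a + b)"
  define g1 where "g1 k h = (c * (2 powr (- real k)) powr (b - a - n)) * indicator (ball (0::'a) (2 powr (- real k))) h" for k h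
  define g2 where "g2 k h = (c * (2 powr real k) powr (- a - n)) * indicator (ball (0::'a) (2 powr real k)) h" for k h
  have g0: "g1 k h \<ge> 0" "g2 k h \<ge> 0" for k h by (auto simp: g1_def g2_def c_def)
  have [measurable]: "g1 k \<in> borel_measurable borel" "g2 k \<in> borel_measurable borel" for k
    unfolding g1_def g2_def by (intro borel_measurable_times borel_measurable_const borel_measurable_indicator; simp)+
  have ex: "(\<exists>k. f h \<le> g1 k h) \<or> (\<exists>k. f h \<le> g2 k h)" for h
  proof (cases "h = 0")
    case True
    then have "f h \<le> g1 0 h" using g0(1)[of 0 h] b by (simp add: f_def)
    then show ?thesis by blast
  next
    case False
    define l where "l = log 2 (norm h)"
    have hl: "norm h = 2 powr l" using False by (simp add: l_def)
    show ?thesis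
    proof (cases "norm h < 1")
      case True
      then have l: "l < 0" using False by (simp add: l_def)
      \<comment> \<open>The strict inequality is the one that puts h into the open ball of radius
        \<open>2 powr (- real k)\<close>.\<close>
      obtain k :: nat where k: "real k < - l" "- l \<le> real k + 1"
      proof -
        define m where "m = \<lceil>- l\<rceil>"
        have m: "real_of_int m - 1 < - l" "- l \<le> real_of_int m" "m \<ge> 1"
          using l unfolding m_def by linarith+
        show ?thesis using that[of "nat (m - 1)"] m by auto
      qed
      have "f h = (2 powr l) powr (b - a - n)"
        using True hl by (simp add: f_def powr_diff [symmetric] min_def algebra_simps flip: powr_diff)
      also have "\<dots> = 2 powr (l * (b - a) + l * (- n))" by (simp add: powr_powr algebra_simps)
      also have "\<dots> \<le> 2 powr ((n + a + b) + (- real k) * (b - a - n))"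
      proof (intro powr_mono)
        have "l * (b - a) \<le> - real k * (b - a)" using k(1) a by (intro mult_right_mono) auto
        moreover have "l * (- n) \<le> (- real k - 1) * (- n)" using k by (intro mult_right_mono_neg) (auto simp: n_def)
        ultimately show "l * (b - a) + l * (- n) \<le> (n + a + b) + (- real k) * (b - a - n)"
          using a b by (simp add: algebra_simps)
      qed simp
      also have "\<dots> = c * (2 powr (- real k)) powr (b - a - n)"
        by (simp only: c_def powr_add powr_powr)
      also have "\<dots> = g1 k h"
      proof -
        have "norm h < 2 powr (- real k)" unfolding hl using k by simp
        then show ?thesis by (simp add: g1_def)
      qed
      finally show ?thesis by blast
    next
      case F: False
      then have l: "l \<ge> 0" using False by (simp add: l_def)
      obtain k :: nat where k: "l < real k" "real k \<le> l + 1"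
      proof -
        define m where "m = \<lfloor>l\<rfloor>"
        have m: "l < real_of_int m + 1" "real_of_int m \<le> l" "m \<ge> 0"
          using l by (auto simp: m_def)
        show ?thesis using that[of "nat (m + 1)"] m by auto
      qed
      have "f h = (2 powr l) powr (- a - n)"
        using F hl by (simp add: f_def min_def powr_minus_divide [symmetric] algebra_simps)
      also have "\<dots> = 2 powr (l * (- a - n))" by (simp add: powr_powr)
      also have "\<dots> \<le> 2 powr ((n + a + b) + real k * (- a - n))"
      proof (intro powr_mono)
        have "l * (- a - n) \<le> (real k - 1) * (- a - n)"
          using k a by (intro mult_right_mono_neg) (auto simp: n_def)
        then show "l * (- a - n) \<le> (n + a + b) + real k * (- a - n)"
          using a b by (simp add: algebra_simps)
      qed simp
      also have "\<dots> = c * (2 powr real k) powr (- a - n)"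
        by (simp only: c_def powr_add powr_powr)
      also have "\<dots> = g2 k h"
      proof -
        have "norm h < 2 powr real k" unfolding hl using k by simp
        then show ?thesis by (simp add: g2_def)
      qed
      finally show ?thesis by blast
    qed
  qed
  have "ennreal (f h) \<le> (\<Sum>k. ennreal (g1 k h) + ennreal (g2 k h))" for h
  proof -
    obtain k where "f h \<le> g1 k h + g2 k h"
      using ex[of h] g0 by (metis add_increasing add_increasing2)
    then have "ennreal (f h) \<le> (\<Sum>k\<in>{k}. ennreal (g1 k h) + ennreal (g2 k h))"
      using g0 by (simp add: ennreal_leI flip: ennreal_plus)
    also have "\<dots> \<le> (\<Sum>k. ennreal (g1 k h) + ennreal (g2 k h))"
      by (intro sum_le_suminf) auto
    finally show ?thesis .
  qed
  then have "(\<integral>\<^sup>+h. ennreal (f h) \<partial>lborel) \<le> (\<integral>\<^sup>+h. (\<Sum>k. ennreal (g1 k h) + ennreal (g2 k h)) \<partial>lborel)"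
    by (intro nn_integral_mono)
  also have "\<dots> = (\<Sum>k. \<integral>\<^sup>+h. ennreal (g1 k h) + ennreal (g2 k h) \<partial>lborel)"
    by (intro nn_integral_suminf) auto
  also have "\<dots> = (\<Sum>k. ennreal (c * V * ((2 powr (a - b)) ^ k + (2 powr (- a)) ^ k)))"
  proof (intro suminf_cong)
    fix k
    have 1: "(\<integral>\<^sup>+h. ennreal (g1 k h) \<partial>lborel) = ennreal (c * V * (2 powr (a - b)) ^ k)"
    proof -
      have "(\<integral>\<^sup>+h. ennreal (g1 k h) \<partial>lborel)
        = (\<integral>\<^sup>+h. ennreal (c * (2 powr (- real k)) powr (b - a - n)) * indicator (ball (0::'a) (2 powr (- real k))) h \<partial>lborel)"
        by (intro nn_integral_cong) (auto simp: g1_def indicator_def)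
      also have "\<dots> = ennreal (c * (2 powr (- real k)) powr (b - a - n)) * ennreal ((2 powr (- real k)) powr n * V)"
        by (subst nn_integral_cmult_indicator) (auto simp: V)
      also have "\<dots> = ennreal (c * V * ((2 powr (- real k)) powr (b - a - n) * (2 powr (- real k)) powr n))"
        using V0 by (simp add: c_def mult_ac flip: ennreal_mult')
      also have "(2 powr (- real k)) powr (b - a - n) * (2 powr (- real k)) powr n = (2 powr (a - b)) powr real k"
        by (simp add: powr_powr algebra_simps flip: powr_add)
      finally show ?thesis by (simp add: powr_realpow)
    qed
    have 2: "(\<integral>\<^sup>+h. ennreal (g2 k h) \<partial>lborel) = ennreal (c * V * (2 powr (- a)) ^ k)"
    proof -
      have "(\<integral>\<^sup>+h. ennreal (g2 k h) \<partial>lborel)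
        = (\<integral>\<^sup>+h. ennreal (c * (2 powr real k) powr (- a - n)) * indicator (ball (0::'a) (2 powr real k)) h \<partial>lborel)"
        by (intro nn_integral_cong) (auto simp: g2_def indicator_def)
      also have "\<dots> = ennreal (c * (2 powr real k) powr (- a - n)) * ennreal ((2 powr real k) powr n * V)"
        by (subst nn_integral_cmult_indicator) (auto simp: V)
      also have "\<dots> = ennreal (c * V * ((2 powr real k) powr (- a - n) * (2 powr real k) powr n))"
        using V0 by (simp add: c_def mult_ac flip: ennreal_mult')
      also have "(2 powr real k) powr (- a - n) * (2 powr real k) powr n = (2 powr (- a)) powr real k"
        by (simp add: powr_powr algebra_simps flip: powr_add)
      finally show ?thesis by (simp add: powr_realpow)
    qed
    show "(\<integral>\<^sup>+h. ennreal (g1 k h) + ennreal (g2 k h) \<partial>lborel) = ennreal (c * V * ((2 powr (a - b)) ^ k + (2 powr (- a)) ^ k))"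
      using V0 by (subst nn_integral_add) (auto simp: 1 2 distrib_left c_def simp flip: ennreal_plus)
  qed
  also have "\<dots> < \<infinity>"
  proof -
    have "2 powr (a - b) < (1::real)" using a powr_less_mono[of "a - b" 0 2] by simp
    moreover have "2 powr (- a) < (1::real)" using a powr_less_mono[of "- a" 0 2] by simp
    ultimately have "summable (\<lambda>k. c * V * ((2 powr (a - b)) ^ k + (2 powr (- a)) ^ k))"
      by (intro summable_mult summable_add summable_geometric) auto
    then show ?thesis
      using V0 by (subst suminf_ennreal2) (auto simp: c_def)
  qed
  finally show ?thesis unfolding f_def n_def .
qed

lemma nn_integral_powr_far:
  assumes "0 < a" "0 < d"
  shows "(\<integral>\<^sup>+h. ennreal (indicator {h. d \<le> norm h} h / norm (h::'a::euclidean_space) powr (real DIM('a) + a)) \<partial>lborel) < \<infinity>"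
proof -
  define m where "m = min 1 d powr (a + 1)"
  have m: "m > 0" using assms by (simp add: m_def)
  have "ennreal (indicator {h. d \<le> norm h} h / norm h powr (real DIM('a) + a))
    \<le> ennreal (1 / m) * ennreal (min 1 (norm h) powr (a + 1) / norm h powr (real DIM('a) + a))" for h :: 'a
  proof -
    have "indicator {h. d \<le> norm h} h \<le> (1 / m) * min 1 (norm h) powr (a + 1)"
    proof (cases "d \<le> norm h")
      case True
      then have "m \<le> min 1 (norm h) powr (a + 1)"
        unfolding m_def using assms by (intro powr_mono2) auto
      then show ?thesis using True m by (simp add: field_simps)
    qed (use m in auto)
    then have "indicator {h. d \<le> norm h} h / norm h powr (real DIM('a) + a)
       \<le> (1 / m) * min 1 (norm h) powr (a + 1) / norm h powr (real DIM('a) + a)"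
      by (intro divide_right_mono) auto
    then show ?thesis using m by (simp flip: ennreal_mult')
  qed
  then have "(\<integral>\<^sup>+h. ennreal (indicator {h. d \<le> norm h} h / norm (h::'a) powr (real DIM('a) + a)) \<partial>lborel)
    \<le> (\<integral>\<^sup>+h. ennreal (1 / m) * ennreal (min 1 (norm (h::'a)) powr (a + 1) / norm h powr (real DIM('a) + a)) \<partial>lborel)"
    by (intro nn_integral_mono)
  also have "\<dots> = ennreal (1 / m) * (\<integral>\<^sup>+h. ennreal (min 1 (norm (h::'a)) powr (a + 1) / norm h powr (real DIM('a) + a)) \<partial>lborel)"
    by (intro nn_integral_cmult) auto
  also have "\<dots> < \<infinity>"
    using nn_integral_powr_annuli[of a "a+1", where 'a='a] assms m
    by (auto simp: ennreal_mult_less_top)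
  finally show ?thesis .
qed

text \<open>
  Both the push-forward of Lebesgue measure and Lebesgue measure itself are translation invariant,
  and they agree on centred balls; Tonelli's theorem applied to the indicator of such a ball
  and of an arbitrary set shows that they agree everywhere.
\<close>

lemma translation_invariant_eq_lborel:
  fixes M :: "'a::euclidean_space measure"
  assumes sets[measurable_cong]: "sets M = sets borel" and sf: "sigma_finite_measure M"
    and inv: "\<And>f h. f \<in> borel_measurable borel \<Longrightarrow> (\<integral>\<^sup>+z. f (z + h) \<partial>M) = (\<integral>\<^sup>+z. f z \<partial>M)"
    and ball: "emeasure M (ball 0 1) = emeasure lborel (ball (0::'a) 1)"
  shows "M = lborel"
proof (rule measure_eqI)
  fix B assume "B \<in> sets M"
  then have B[measurable]: "B \<in> sets borel" by (simp add: sets)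
  interpret M: sigma_finite_measure M by (rule sf)
  interpret pair_sigma_finite lborel M ..
  define A where "A = ball (0::'a) 1"
  have [measurable]: "A \<in> sets borel" by (simp add: A_def)
  \<comment> \<open>As a function of y, x - y is a reflection and not a translation; the symmetry of
    the ball turns it into one.\<close>
  have neg: "(- x \<in> A) = (x \<in> A)" for x by (simp add: A_def)
  have "emeasure M A * emeasure lborel B = (\<integral>\<^sup>+x. indicator A x * emeasure lborel B \<partial>M)"
    by (subst nn_integral_multc) auto
  also have "\<dots> = (\<integral>\<^sup>+x. (\<integral>\<^sup>+y. indicator A x * indicator B y \<partial>lborel) \<partial>M)"
    by (intro nn_integral_cong) (simp add: nn_integral_cmult)
  also have "\<dots> = (\<integral>\<^sup>+x. (\<integral>\<^sup>+y. indicator A x * indicator B (y + x) \<partial>lborel) \<partial>M)"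
    by (rule nn_integral_cong, rule nn_integral_lborel_translation[symmetric]) simp
  also have "\<dots> = (\<integral>\<^sup>+y. (\<integral>\<^sup>+x. indicator A x * indicator B (y + x) \<partial>M) \<partial>lborel)"
    by (rule Fubini') measurable
  also have "\<dots> = (\<integral>\<^sup>+y. (\<integral>\<^sup>+x. indicator A (x - y) * indicator B x \<partial>M) \<partial>lborel)"
  proof (rule nn_integral_cong)
    fix y
    have "(\<integral>\<^sup>+x. indicator A (x - y) * indicator B x \<partial>M)
       = (\<integral>\<^sup>+x. indicator A (x + y - y) * indicator B (x + y) \<partial>M)"
      by (rule inv[symmetric]) simp
    then show "(\<integral>\<^sup>+x. indicator A x * indicator B (y + x) \<partial>M) = (\<integral>\<^sup>+x. indicator A (x - y) * indicator B x \<partial>M)"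
      by (simp add: add.commute)
  qed
  also have "\<dots> = (\<integral>\<^sup>+x. (\<integral>\<^sup>+y. indicator A (x - y) * indicator B x \<partial>lborel) \<partial>M)"
    by (rule Fubini'[symmetric]) measurable
  also have "\<dots> = (\<integral>\<^sup>+x. indicator B x * emeasure lborel A \<partial>M)"
  proof (rule nn_integral_cong)
    fix x
    have "(\<integral>\<^sup>+y. indicator A (x - y) * indicator B x \<partial>lborel) = (\<integral>\<^sup>+y. indicator B x * indicator A (y + (- x)) \<partial>lborel)"
      using neg by (intro nn_integral_cong) (metis (no_types) add.commute indicator_simps(1) indicator_simps(2) minus_diff_eq mult.commute uminus_add_conv_diff)
    also have "\<dots> = indicator B x * (\<integral>\<^sup>+y. indicator A (y + (- x)) \<partial>lborel)"
      by (subst nn_integral_cmult) auto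
    also have "(\<integral>\<^sup>+y. indicator A (y + (- x)) \<partial>lborel) = (\<integral>\<^sup>+y. indicator A y \<partial>lborel)"
      by (rule nn_integral_lborel_translation) simp
    finally show "(\<integral>\<^sup>+y. indicator A (x - y) * indicator B x \<partial>lborel) = indicator B x * emeasure lborel A"
      by simp
  qed
  also have "\<dots> = emeasure M B * emeasure lborel A"
    by (subst nn_integral_multc) auto
  finally have "emeasure lborel A * emeasure lborel B = emeasure lborel A * emeasure M B"
    using ball by (simp add: A_def mult.commute)
  moreover have "emeasure lborel A \<noteq> 0" 
  proof
    assume "emeasure lborel A = 0"
    then have "measure lborel A = 0" by (simp add: measure_def)
    then show False using content_ball_gt_0_iff[of "0::'a" 1] by (simp add: A_def)
  qed
  moreover have "emeasure lborel A \<noteq> \<infinity>"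
    using emeasure_lborel_ball_finite[of "0::'a" 1] by (simp add: A_def)
  ultimately show "emeasure M B = emeasure lborel B"
    by (metis ennreal_mult_cancel_left infinity_ennreal_def)
qed (simp add: sets)

text \<open>The push-forward is translation invariant, because shifting the image by h amounts to
  shifting the argument by a preimage of h under \<open>L\<close>; and the preimage of a centred
  ball is a ball of the same radius. The form covers reflections of the space, their action on
  pairs, and the map z \<mapsto> x - z alike.\<close>

lemma lborel_distr_isometry:
  fixes T L :: "'a::euclidean_space \<Rightarrow> 'a"
  assumes T: "\<And>x h. T (x + h) = T x + L h" and L: "\<And>x. norm (L x) = norm x" "surj L"
  shows "distr lborel borel T = lborel"
proof -
  have dT: "dist (T x) (T y) = dist x y" for x y
    using T[of y "x - y"] L(1)[of "x - y"] by (simp add: dist_norm)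
  have "continuous_on UNIV T"
    by (rule continuous_onI) (auto simp: dT)
  then have [measurable]: "T \<in> borel_measurable borel"
    by (rule borel_measurable_continuous_onI)
  obtain c where c: "T c = 0"
  proof -
    obtain h where "L h = - T 0" using L(2) by (metis surjD)
    then show ?thesis using T[of 0 h] that[of h] by simp
  qed
  have surjT: "\<exists>x. T x = y" for y
  proof -
    obtain h where "L h = y" using L(2) by (metis surjD)
    then show ?thesis using T[of c h] c by auto
  qed
  have ball: "emeasure (distr lborel borel T) (ball 0 r) = emeasure lborel (ball (0::'a) r)" for r
  proof -
    have "T -` ball 0 r = ball c r"
      using dT[of c] by (auto simp: c)
    then have "emeasure (distr lborel borel T) (ball 0 r) = emeasure lborel (ball c r)"
      by (subst emeasure_distr) auto
    also have "\<dots> = emeasure lborel (ball (0::'a) r)"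
    proof -
      have "emeasure lborel (ball c r) = (\<integral>\<^sup>+z. indicator (ball c r) (z + c) \<partial>lborel)"
        by (subst nn_integral_lborel_translation[where f = "indicator (ball c r)"])
          (simp_all add: borel_measurable_indicator)
      also have "\<dots> = (\<integral>\<^sup>+z. indicator (ball (0::'a) r) z \<partial>lborel)"
        by (intro nn_integral_cong) (auto simp: indicator_def dist_norm)
      finally show ?thesis by simp
    qed
    finally show ?thesis .
  qed
  show ?thesis
  proof (rule translation_invariant_eq_lborel)
    show "sigma_finite_measure (distr lborel borel T)"
    proof
      show "\<exists>A. countable A \<and> A \<subseteq> sets (distr lborel borel T) \<and> \<Union> A = space (distr lborel borel T) \<and>
        (\<forall>a\<in>A. emeasure (distr lborel borel T) a \<noteq> \<infinity>)"
      proof (intro exI conjI ballI)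
        show "\<Union> (range (\<lambda>n. ball (0::'a) (real n))) = space (distr lborel borel T)"
          by (auto simp: reals_Archimedean2)
        show "emeasure (distr lborel borel T) a \<noteq> \<infinity>" if "a \<in> range (\<lambda>n. ball (0::'a) (real n))" for a
          using that emeasure_lborel_ball_finite[of "0::'a"] by (auto simp: ball less_top[symmetric])
      qed auto
    qed
    show "(\<integral>\<^sup>+z. f (z + h) \<partial>distr lborel borel T) = (\<integral>\<^sup>+z. f z \<partial>distr lborel borel T)"
      if [measurable]: "f \<in> borel_measurable borel" for f h
    proof -
      obtain h' where h': "L h' = h" using L(2) by (metis surjD)
      have "(\<integral>\<^sup>+z. f (z + h) \<partial>distr lborel borel T) = (\<integral>\<^sup>+z. f (T (z + h')) \<partial>lborel)"
        by (subst nn_integral_distr) (auto simp: T h')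
      also have "\<dots> = (\<integral>\<^sup>+z. f (T z) \<partial>lborel)"
        by (rule nn_integral_lborel_translation[where f = "\<lambda>z. f (T z)"]) simp
      finally show ?thesis by (subst (2) nn_integral_distr) auto
    qed
  qed (use ball in auto)
qed

subsection \<open>Bump functions and mollification\<close>

text \<open>For k = 0 this is the classical function exp (-1 / t). The additional powers of 1 / t
  make the span of the family closed under differentiation.\<close>

definition flat :: "nat \<Rightarrow> real \<Rightarrow> real" where
  "flat k t = (if 0 < t then inverse t ^ k / exp (inverse t) else 0)"

lemma flat_nonneg: "0 \<le> flat k t" and flat_pos: "0 < t \<Longrightarrow> 0 < flat k t"
  and flat_nonpos_arg: "t \<le> 0 \<Longrightarrow> flat k t = 0"
  by (auto simp: flat_def)

lemma flat_has_real_derivative: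
  "(flat k has_real_derivative (flat (k + 2) t - real k * flat (k + 1) t)) (at t)"
proof (cases t "0 :: real" rule: linorder_cases)
  case less
  have "((\<lambda>_. 0 :: real) has_real_derivative 0) (at t)" by simp
  then have "(flat k has_real_derivative 0) (at t)"
    by (rule has_field_derivative_transform_within_open[where S = "{..<0}"]) (use less in \<open>auto simp: flat_def\<close>)
  then show ?thesis using less by (simp add: flat_def)
next
  case greater
  have "((\<lambda>t. inverse t ^ k / exp (inverse t)) has_real_derivative (flat (k + 2) t - real k * flat (k + 1) t)) (at t)"
  proof (cases k)
    case 0
    then show ?thesis using greater
      by (auto intro!: derivative_eq_intros simp: flat_def field_simps power2_eq_square)
  next
    case (Suc j)
    have "((\<lambda>t. inverse t ^ Suc j / exp (inverse t)) has_real_derivative (flat (Suc j + 2) t - real (Suc j) * flat (Suc j + 1) t)) (at t)"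
      using greater by (auto intro!: derivative_eq_intros simp: flat_def field_simps power2_eq_square) (cases j; simp)
    then show ?thesis by (simp add: Suc)
  qed
  then show ?thesis
    by (rule has_field_derivative_transform_within_open[where S = "{0<..}"]) (use greater in \<open>auto simp: flat_def\<close>)
next
  case equal
  \<comment> \<open>The difference quotient at 0. From the right it is a power of 1 / h against exp
    (1 / h), from the left it vanishes.\<close>
  have "((\<lambda>h. flat k h / h) \<longlongrightarrow> 0) (at_right 0)"
  proof (rule Lim_transform_eventually)
    show "((\<lambda>h::real. inverse h ^ Suc k / exp (inverse h)) \<longlongrightarrow> 0) (at_right 0)"
      by (rule filterlim_compose[OF tendsto_power_div_exp_0 filterlim_inverse_at_top_right])
    show "\<forall>\<^sub>F h in at_right 0. inverse h ^ Suc k / exp (inverse h) = flat k h / h"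
      by (auto simp: eventually_at_filter flat_def field_simps intro!: always_eventually)
  qed
  moreover have "((\<lambda>h. flat k h / h) \<longlongrightarrow> 0) (at_left 0)"
    by (rule tendsto_eventually) (auto simp: eventually_at_filter flat_def intro!: always_eventually)
  ultimately have "((\<lambda>h. flat k h / h) \<longlongrightarrow> 0) (at 0)"
    by (rule filterlim_split_at[rotated])
  then show ?thesis
    using equal by (simp add: DERIV_def flat_def)
qed

text \<open>An algebra that contains the bump and is closed under directional derivatives. Induction
  over its rules takes the place of explicit formulas for higher derivatives.\<close>

inductive_set bump_algebra :: "real \<Rightarrow> ('a::euclidean_space \<Rightarrow> real) set" for d where
  const: "(\<lambda>x. c) \<in> bump_algebra d"
| inner: "(\<lambda>x. x \<bullet> b) \<in> bump_algebra d"
| flat: "(\<lambda>x. flat k (d\<^sup>2 - x \<bullet> x)) \<in> bump_algebra d"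
| add: "f \<in> bump_algebra d \<Longrightarrow> g \<in> bump_algebra d \<Longrightarrow> (\<lambda>x. f x + g x) \<in> bump_algebra d"
| mult: "f \<in> bump_algebra d \<Longrightarrow> g \<in> bump_algebra d \<Longrightarrow> (\<lambda>x. f x * g x) \<in> bump_algebra d"

lemma bump_algebra_derivative:
  assumes "f \<in> bump_algebra d"
  shows "\<exists>g. (\<forall>x. (f has_derivative g x) (at x)) \<and> (\<forall>b. (\<lambda>x. g x b) \<in> bump_algebra d)"
  using assms
proof induction
  case (const c)
  show ?case
    by (rule exI[of _ "\<lambda>x h. 0"]) (auto intro: bump_algebra.const)
next
  case (inner b)
  show ?case
    by (rule exI[of _ "\<lambda>x h. h \<bullet> b"]) (auto intro!: bump_algebra.const derivative_eq_intros)
next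
  case (flat k)
  let ?g = "\<lambda>x h. (flat (k + 2) (d\<^sup>2 - x \<bullet> x) + (- real k) * flat (k + 1) (d\<^sup>2 - x \<bullet> x)) * ((-2) * (x \<bullet> h))"
  have "((\<lambda>x. flat k (d\<^sup>2 - x \<bullet> x)) has_derivative ?g x) (at x)" for x :: 'a
  proof -
    have "((\<lambda>x. d\<^sup>2 - x \<bullet> x) has_derivative (\<lambda>h. (-2) * (x \<bullet> h))) (at x)"
      by (auto intro!: derivative_eq_intros simp: inner_commute)
    from has_derivative_compose[OF this flat_has_real_derivative[of k "d\<^sup>2 - x \<bullet> x", unfolded has_field_derivative_def]]
    show ?thesis by simp
  qed
  then show ?case
    by (intro exI[of _ ?g] conjI allI bump_algebra.intros) auto
next
  case (add f g)
  then obtain f' g' where "\<And>x. (f has_derivative f' x) (at x)" "\<And>b. (\<lambda>x. f' x b) \<in> bump_algebra d"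
     "\<And>x. (g has_derivative g' x) (at x)" "\<And>b. (\<lambda>x. g' x b) \<in> bump_algebra d" by blast
  then show ?case
    by (intro exI[of _ "\<lambda>x h. f' x h + g' x h"]) (auto intro!: bump_algebra.add has_derivative_add)
next
  case (mult f g)
  then obtain f' g' where "\<And>x. (f has_derivative f' x) (at x)" "\<And>b. (\<lambda>x. f' x b) \<in> bump_algebra d"
     "\<And>x. (g has_derivative g' x) (at x)" "\<And>b. (\<lambda>x. g' x b) \<in> bump_algebra d" by blast
  with mult.hyps show ?case
    by (intro exI[of _ "\<lambda>x h. f x * g' x h + f' x h * g x"])
      (auto intro!: bump_algebra.add bump_algebra.mult has_derivative_mult)
qed

definition bumps :: "real \<Rightarrow> ('a::euclidean_space \<Rightarrow> real) set" where
  "bumps d = {f \<in> bump_algebra d. \<forall>x. norm x > d \<longrightarrow> f x = 0}"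

lemma bumps_derivative:
  fixes f :: "'a::euclidean_space \<Rightarrow> real"
  assumes "f \<in> bumps d"
  obtains g where "\<And>x. (f has_derivative g x) (at x)" "\<And>b. (\<lambda>x. g x b) \<in> bumps d"
proof -
  obtain g where g: "\<And>x. (f has_derivative g x) (at x)" "\<And>b. (\<lambda>x. g x b) \<in> bump_algebra d"
    using bump_algebra_derivative assms unfolding bumps_def by blast
  have "g x b = 0" if "norm x > d" for x b
  proof -
    have "((\<lambda>_. 0) has_derivative g x) (at x)"
    proof (rule has_derivative_transform_within_open[OF g(1)])
      show "open (- cball (0::'a) d)" by (intro open_Compl closed_cball)
      show "x \<in> - cball 0 d" using that by simp
      show "f y = 0" if "y \<in> - cball 0 d" for y
        using assms that by (auto simp: bumps_def)
    qed
    then have "g x = (\<lambda>_. 0)"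
      by (rule has_derivative_unique) simp
    then show ?thesis by simp
  qed
  then show thesis using g by (intro that[of g]) (auto simp: bumps_def)
qed

lemma bumps_continuous:
  assumes "f \<in> bumps d"
  shows "continuous_on UNIV f"
proof -
  obtain g where "\<And>x. (f has_derivative g x) (at x)" using bumps_derivative[OF assms] by metis
  then have "f differentiable_on UNIV"
    by (auto simp: differentiable_on_def differentiable_def)
  then show ?thesis by (rule differentiable_imp_continuous_on)
qed

lemma bumps_bounded:
  fixes f :: "'a::euclidean_space \<Rightarrow> real"
  assumes "f \<in> bumps d"
  obtains M where "0 \<le> M" "\<And>x. \<bar>f x\<bar> \<le> M"
proof -
  have "compact (f ` cball 0 d)"
    using bumps_continuous[OF assms] by (intro compact_continuous_image) (auto intro: continuous_on_subset)
  then obtain M where M: "\<And>x. x \<in> cball 0 d \<Longrightarrow> \<bar>f x\<bar> \<le> M"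
    by (meson compact_imp_bounded bounded_real imageI)
  have "\<bar>f x\<bar> \<le> max M 0" for x
    using M[of x] assms by (cases "norm x > d") (auto simp: bumps_def)
  then show thesis by (intro that[of "max M 0"]) auto
qed

lemma linear_sum_Basis:
  fixes g :: "'a::euclidean_space \<Rightarrow> real"
  assumes "linear g"
  shows "g h = (\<Sum>b\<in>Basis. (h \<bullet> b) * g b)"
proof -
  have "g h = g (\<Sum>b\<in>Basis. (h \<bullet> b) *\<^sub>R b)" by (simp add: euclidean_representation)
  also have "\<dots> = (\<Sum>b\<in>Basis. (h \<bullet> b) *\<^sub>R g b)"
    by (simp add: linear_sum[OF assms] linear_cmul[OF assms])
  finally show ?thesis by simp
qed

lemma bumps_Lipschitz:
  fixes f :: "'a::euclidean_space \<Rightarrow> real"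
  assumes "f \<in> bumps d"
  obtains L where "0 \<le> L" "\<And>x y. \<bar>f x - f y\<bar> \<le> L * norm (x - y)"
proof -
  obtain g where g: "\<And>x. (f has_derivative g x) (at x)" "\<And>b. (\<lambda>x. g x b) \<in> bumps d"
    using bumps_derivative[OF assms] by metis
  have "\<forall>b. \<exists>M. 0 \<le> M \<and> (\<forall>x. \<bar>g x b\<bar> \<le> M)"
    using bumps_bounded[OF g(2)] by metis
  then obtain M where M: "\<And>b. 0 \<le> M b" "\<And>b x. \<bar>g x b\<bar> \<le> M b" by metis
  have "onorm (g x) \<le> (\<Sum>b\<in>Basis. M b)" for x
  proof (rule onorm_le)
    fix h
    have "norm (g x h) = \<bar>\<Sum>b\<in>Basis. (h \<bullet> b) * g x b\<bar>"
      using linear_sum_Basis[OF has_derivative_linear[OF g(1)], of x h] by simp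
    also have "\<dots> \<le> (\<Sum>b\<in>Basis. norm h * M b)"
    proof (rule order_trans[OF sum_abs sum_mono])
      fix b :: 'a assume "b \<in> Basis"
      show "\<bar>(h \<bullet> b) * g x b\<bar> \<le> norm h * M b"
        unfolding abs_mult
        by (rule mult_mono[OF Basis_le_norm[OF \<open>b \<in> Basis\<close>] M(2) norm_ge_zero abs_ge_zero])
    qed
    finally show "norm (g x h) \<le> (\<Sum>b\<in>Basis. M b) * norm h"
      by (simp add: sum_distrib_left mult.commute)
  qed
  then have "norm (f x - f y) \<le> (\<Sum>b\<in>Basis. M b) * norm (x - y)" for x y
    using g(1) by (intro differentiable_bound[OF convex_UNIV]) auto
  then show thesis using M by (intro that[of "\<Sum>b\<in>Basis. M b"]) (auto intro: sum_nonneg)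
qed

text \<open>The mean value inequality is applied to \<open>\<lambda>w. f w - g z w\<close>, whose
  derivative has norm of order norm h on the ball around z, as the partial derivatives are again in
  \<open>bumps d\<close> and hence Lipschitz. The bound is uniform in z, as differentiation under
  the integral demands.\<close>

lemma bumps_quadratic:
  fixes f :: "'a::euclidean_space \<Rightarrow> real"
  assumes "f \<in> bumps d" and g: "\<And>x. (f has_derivative g x) (at x)" "\<And>b. (\<lambda>x. g x b) \<in> bumps d"
  obtains M where "0 \<le> M" "\<And>z h. \<bar>f (z + h) - f z - g z h\<bar> \<le> M * norm h * norm h"
proof -
  have "\<forall>b. \<exists>L. 0 \<le> L \<and> (\<forall>x y. \<bar>g x b - g y b\<bar> \<le> L * norm (x - y))"
    using bumps_Lipschitz[OF g(2)] by metis
  then obtain L where L: "\<And>b. 0 \<le> L b" "\<And>b x y. \<bar>g x b - g y b\<bar> \<le> L b * norm (x - y)" by metis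
  have "\<bar>f (z + h) - f z - g z h\<bar> \<le> (\<Sum>b\<in>Basis. L b) * norm h * norm h" for z h
  proof -
    let ?S = "cball z (norm h)"
    have on: "onorm (\<lambda>v. g w v - g z v) \<le> (\<Sum>b\<in>Basis. L b) * norm h" if w: "w \<in> ?S" for w
    proof (rule onorm_le)
      fix v
      have "norm (g w v - g z v) = \<bar>\<Sum>b\<in>Basis. (v \<bullet> b) * (g w b - g z b)\<bar>"
        using linear_sum_Basis[OF has_derivative_linear[OF g(1)], of w v] linear_sum_Basis[OF has_derivative_linear[OF g(1)], of z v]
        by (simp add: right_diff_distrib sum_subtractf)
      also have "\<dots> \<le> (\<Sum>b\<in>Basis. norm v * (L b * norm h))"
      proof (rule order_trans[OF sum_abs sum_mono])
        fix b :: 'a assume "b \<in> Basis"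
        have "\<bar>g w b - g z b\<bar> \<le> L b * norm (w - z)" by (rule L)
        also have "\<dots> \<le> L b * norm h" using w L(1) by (intro mult_left_mono) (auto simp: dist_norm norm_minus_commute)
        finally show "\<bar>(v \<bullet> b) * (g w b - g z b)\<bar> \<le> norm v * (L b * norm h)"
          unfolding abs_mult using Basis_le_norm[OF \<open>b \<in> Basis\<close>] by (intro mult_mono) auto
      qed
      finally show "norm (g w v - g z v) \<le> (\<Sum>b\<in>Basis. L b) * norm h * norm v"
        by (simp add: sum_distrib_left sum_distrib_right mult_ac)
    qed
    have der: "((\<lambda>w. f w - g z w) has_derivative (\<lambda>v. g w v - g z v)) (at w within ?S)" for w
      by (intro has_derivative_diff has_derivative_at_withinI[OF g(1)]
          bounded_linear.has_derivative[OF has_derivative_bounded_linear[OF g(1)]] has_derivative_ident)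
    have "norm ((f (z + h) - g z (z + h)) - (f z - g z z)) \<le> (\<Sum>b\<in>Basis. L b) * norm h * norm (z + h - z)"
      by (rule differentiable_bound[OF convex_cball der on]) (auto simp: dist_norm)
    moreover have "g z (z + h) = g z z + g z h"
      by (rule linear_add[OF has_derivative_linear[OF g(1)]])
    ultimately show ?thesis by simp
  qed
  then show thesis using L by (intro that[of "\<Sum>b\<in>Basis. L b"]) (auto intro: sum_nonneg)
qed

section \<open>Mollification by convolution with bumps\<close>

definition convolution :: "('a::euclidean_space \<Rightarrow> real) \<Rightarrow> ('a \<Rightarrow> real) \<Rightarrow> 'a \<Rightarrow> real" where
  "convolution f \<phi> x = (LINT y|lborel. f (x - y) * \<phi> y)"

lemma bumps_conv_integrable:
  fixes f :: "'a::euclidean_space \<Rightarrow> real"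
  assumes "f \<in> bumps d" and \<phi>: "integrable lborel \<phi>"
  shows "integrable lborel (\<lambda>y. f (x - y) * \<phi> y)"
proof -
  obtain M where M: "0 \<le> M" "\<And>x. \<bar>f x\<bar> \<le> M" using bumps_bounded[OF assms(1)] by metis
  have [measurable]: "f \<in> borel_measurable borel" "\<phi> \<in> borel_measurable borel"
    using bumps_continuous[OF assms(1)] \<phi> by (auto intro: borel_measurable_continuous_onI)
  show ?thesis
  proof (rule Bochner_Integration.integrable_bound)
    show "integrable lborel (\<lambda>y. M * \<phi> y)" using \<phi> by simp
    show "AE y in lborel. norm (f (x - y) * \<phi> y) \<le> norm (M * \<phi> y)"
      using M by (auto simp: abs_mult intro!: mult_right_mono)
  qed measurable
qed

text \<open>The uniform quadratic remainder of \<open>bumps_quadratic\<close>, integrated against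
  \<phi>, is at most a constant times the L^1 norm of \<phi> times the square of norm h; no
  dominated convergence is involved.\<close>

lemma conv_has_derivative:
  fixes f :: "'a::euclidean_space \<Rightarrow> real"
  assumes f: "f \<in> bumps d" and g: "\<And>x. (f has_derivative g x) (at x)" "\<And>b. (\<lambda>x. g x b) \<in> bumps d"
    and \<phi>: "integrable lborel \<phi>"
  shows "(convolution f \<phi> has_derivative (\<lambda>h. convolution (\<lambda>x. g x h) \<phi> x)) (at x)"
  unfolding has_derivative_at_alt
proof (intro conjI allI impI)
  note int = bumps_conv_integrable[OF f \<phi>] bumps_conv_integrable[OF g(2) \<phi>]
  have lin: "convolution (\<lambda>x. g x h) \<phi> x = (\<Sum>b\<in>Basis. (h \<bullet> b) * convolution (\<lambda>x. g x b) \<phi> x)" for h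
  proof -
    have "convolution (\<lambda>x. g x h) \<phi> x = (LINT y|lborel. (\<Sum>b\<in>Basis. (h \<bullet> b) * (g (x - y) b * \<phi> y)))"
      unfolding convolution_def
      by (intro Bochner_Integration.integral_cong refl, subst linear_sum_Basis[OF has_derivative_linear[OF g(1)], of _ h])
        (simp add: sum_distrib_right mult.assoc)
    also have "\<dots> = (\<Sum>b\<in>Basis. (h \<bullet> b) * convolution (\<lambda>x. g x b) \<phi> x)"
      unfolding convolution_def using int by (subst Bochner_Integration.integral_sum) auto
    finally show ?thesis .
  qed
  show "bounded_linear (\<lambda>h. convolution (\<lambda>x. g x h) \<phi> x)"
    by (subst ext[OF lin]) (intro bounded_linear_sum bounded_linear_mult_const bounded_linear_inner_left)
  fix e :: real assume e: "e > 0"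
  obtain M where M: "0 \<le> M" "\<And>z h. \<bar>f (z + h) - f z - g z h\<bar> \<le> M * norm h * norm h"
    using bumps_quadratic[OF f g] by metis
  define I where "I = (LINT y|lborel. \<bar>\<phi> y\<bar>)"
  have I: "I \<ge> 0" by (simp add: I_def)
  have *: "\<bar>convolution f \<phi> (x + h) - convolution f \<phi> x - convolution (\<lambda>x. g x h) \<phi> x\<bar> \<le> M * I * norm h * norm h" for h
  proof -
    have "convolution f \<phi> (x + h) - convolution f \<phi> x - convolution (\<lambda>x. g x h) \<phi> x
      = (LINT y|lborel. f (x + h - y) * \<phi> y - f (x - y) * \<phi> y - g (x - y) h * \<phi> y)"
      unfolding convolution_def using int by simp
    also have "\<bar>\<dots>\<bar> \<le> (LINT y|lborel. M * norm h * norm h * \<bar>\<phi> y\<bar>)"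
    proof (rule integral_abs_bound[THEN order_trans], rule integral_mono)
      fix y
      have "\<bar>f ((x - y) + h) - f (x - y) - g (x - y) h\<bar> * \<bar>\<phi> y\<bar> \<le> M * norm h * norm h * \<bar>\<phi> y\<bar>"
        by (intro mult_right_mono M) simp
      then show "\<bar>f (x + h - y) * \<phi> y - f (x - y) * \<phi> y - g (x - y) h * \<phi> y\<bar> \<le> M * norm h * norm h * \<bar>\<phi> y\<bar>"
        by (simp add: abs_mult [symmetric] algebra_simps)
    qed (use int \<phi> in auto)
    also have "\<dots> = M * I * norm h * norm h" by (simp add: I_def mult_ac)
    finally show ?thesis .
  qed
  show "\<exists>d>0. \<forall>y. norm (y - x) < d \<longrightarrow> norm (convolution f \<phi> y - convolution f \<phi> x - convolution (\<lambda>z. g z (y - x)) \<phi> x) \<le> e * norm (y - x)"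
  proof (intro exI[of _ "e / (M * I + 1)"] conjI allI impI)
    show "e / (M * I + 1) > 0" using e M I by (simp add: add_nonneg_pos)
    fix y assume "norm (y - x) < e / (M * I + 1)"
    then have "norm (y - x) * (M * I + 1) \<le> e"
      using M I by (simp add: pos_less_divide_eq add_nonneg_pos)
    then have "norm (y - x) * (M * I) \<le> e" 
      by (smt (verit) distrib_left mult_cancel_left2 norm_ge_zero)
    then have "(norm (y - x) * (M * I)) * norm (y - x) \<le> e * norm (y - x)"
      by (intro mult_right_mono) auto
    then have "M * I * norm (y - x) * norm (y - x) \<le> e * norm (y - x)"
      by (simp add: mult_ac)
    with *[of "y - x"] show "norm (convolution f \<phi> y - convolution f \<phi> x - convolution (\<lambda>z. g z (y - x)) \<phi> x) \<le> e * norm (y - x)"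
      by simp
  qed
qed

text \<open>Reduces smoothness to the stability of a whole family under directional derivatives, so
  that the recursion in \<open>Ck\<close> is unfolded only here. The family in question consists of
  all \<open>convolution f \<phi>\<close> with f in \<open>bumps d\<close>.\<close>

lemma Ck_derivative_closed:
  assumes S: "\<And>f. f \<in> S \<Longrightarrow> \<exists>g. (\<forall>x. (f has_derivative g x) (at x)) \<and> (\<forall>b. (\<lambda>x. g x b) \<in> S)"
    and "f \<in> S"
  shows "Ck k f"
  using assms(2)
proof (induction k arbitrary: f)
  case 0
  then obtain g where "\<And>x. (f has_derivative g x) (at x)" using S by blast
  then have "f differentiable_on UNIV"
    by (auto simp: differentiable_on_def differentiable_def)
  then show ?case by (simp add: differentiable_imp_continuous_on)
next
  case (Suc k)
  obtain g where g: "\<And>x. (f has_derivative g x) (at x)" "\<And>b. (\<lambda>x. g x b) \<in> S" using S Suc.prems by blast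
  have "frechet_derivative f (at x) = g x" for x
    using frechet_derivative_at[OF g(1)] by metis
  then show ?case using g Suc.IH by (auto simp: differentiable_def)
qed

lemma smooth_conv:
  fixes f :: "'a::euclidean_space \<Rightarrow> real"
  assumes "f \<in> bumps d" "integrable lborel \<phi>"
  shows "smooth (convolution f \<phi>)"
  unfolding smooth_def
proof
  fix k
  show "Ck k (convolution f \<phi>)"
  proof (rule Ck_derivative_closed[where S = "{convolution f \<phi> | f. f \<in> bumps d}"])
    fix F assume "F \<in> {convolution f \<phi> | f. f \<in> bumps d}"
    then obtain f where f: "F = convolution f \<phi>" "f \<in> bumps d" by blast
    obtain g where g: "\<And>x. (f has_derivative g x) (at x)" "\<And>b. (\<lambda>x. g x b) \<in> bumps d"
      using bumps_derivative[OF f(2)] by metis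
    show "\<exists>g. (\<forall>x. (F has_derivative g x) (at x)) \<and> (\<forall>b. (\<lambda>x. g x b) \<in> {convolution f \<phi> | f. f \<in> bumps d})"
      by (rule exI[of _ "\<lambda>x h. convolution (\<lambda>x. g x h) \<phi> x"])
        (use conv_has_derivative[OF f(2) g assms(2)] g f in auto)
  qed (use assms in auto)
qed

text \<open>Left unnormalised: averages against it are only tested for being 0, for which a positive
  integral suffices.\<close>

definition bump :: "real \<Rightarrow> 'a::euclidean_space \<Rightarrow> real" where
  "bump d x = flat 0 (d\<^sup>2 - x \<bullet> x)"

lemma bump_zero: "0 < d \<Longrightarrow> norm x \<ge> d \<Longrightarrow> bump d x = 0"
  unfolding bump_def using power_mono[of d "norm x" 2]
  by (intro flat_nonpos_arg) (simp add: power2_norm_eq_inner)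

lemma bump_pos: "norm x < d \<Longrightarrow> 0 < bump d x"
  unfolding bump_def using power_strict_mono[of "norm x" d 2]
  by (intro flat_pos) (simp add: power2_norm_eq_inner)

lemma bump_nonneg: "0 \<le> bump d x"
  by (simp add: bump_def flat_nonneg)

lemma bump_in_bumps: "0 < d \<Longrightarrow> bump d \<in> bumps d"
  using bump_zero[of d] bump_algebra.flat[of 0 d] by (auto simp: bumps_def bump_def [abs_def] dest: less_imp_le)

lemma test_function_conv:
  fixes \<phi> :: "'a::euclidean_space \<Rightarrow> real"
  assumes d: "0 < d" and "integrable lborel \<phi>" and K: "compact K" "\<And>x. x \<notin> K \<Longrightarrow> \<phi> x = 0"
    and Kd: "{x + y | x y. x \<in> K \<and> y \<in> cball 0 d} \<subseteq> \<Omega>"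
  shows "test_function \<Omega> (convolution (bump d) \<phi>)"
  unfolding test_function_def compactly_contained_def
proof (intro conjI)
  show "smooth (convolution (bump d) \<phi>)"
    by (rule smooth_conv[OF bump_in_bumps[OF d]]) fact
  let ?K = "{x + y | x y. x \<in> K \<and> y \<in> cball 0 d}"
  have c: "compact ?K" by (intro compact_sums K compact_cball)
  have "convolution (bump d) \<phi> x = 0" if "x \<notin> ?K" for x
  proof -
    have "bump d (x - y) * \<phi> y = 0" for y
    proof (cases "y \<in> K")
      case True
      have "x - y \<notin> cball 0 d"
      proof
        assume "x - y \<in> cball 0 d"
        with True have "y + (x - y) \<in> ?K" by blast
        then show False using that by simp
      qed
      then show ?thesis using bump_zero[OF d, of "x - y"] by simp
    qed (use K in auto)
    then have "(\<lambda>y. bump d (x - y) * \<phi> y) = (\<lambda>_. 0)" by blast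
    then show ?thesis by (simp add: convolution_def)
  qed
  then have sub: "{x. convolution (bump d) \<phi> x \<noteq> 0} \<subseteq> ?K" by blast
  then have "closure {x. convolution (bump d) \<phi> x \<noteq> 0} \<subseteq> ?K"
    using c by (intro closure_minimal compact_imp_closed)
  then show "closure {x. convolution (bump d) \<phi> x \<noteq> 0} \<subseteq> \<Omega>"
    using Kd by (rule order_trans)
  show "compact (closure {x. convolution (bump d) \<phi> x \<noteq> 0})"
    using bounded_subset[OF compact_imp_bounded[OF c] sub] by (simp only: compact_closure)
qed

subsection \<open>The Gagliardo energy\<close>

definition plap :: "real \<Rightarrow> real \<Rightarrow> real" where
  "plap p t = \<bar>t\<bar> powr (p - 2) * t"

lemma plap_nonneg: "0 \<le> t \<Longrightarrow> plap p t = t powr (p - 1)"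
  using powr_minus_one_mult[of t "p - 1"] by (simp add: plap_def)

lemma plap_minus: "plap p (- t) = - plap p t"
  by (simp add: plap_def)

lemma abs_plap: "\<bar>plap p t\<bar> = \<bar>t\<bar> powr (p - 1)"
  using plap_nonneg[of "\<bar>t\<bar>" p] by (simp add: plap_def abs_mult)

lemma plap_strict_mono:
  assumes "1 < p" "a < b"
  shows "plap p a < plap p b"
proof (cases "0 \<le> a")
  case True
  then show ?thesis using assms by (simp add: plap_nonneg powr_less_mono2)
next
  case a: False
  show ?thesis
  proof (cases "b \<le> 0")
    case True
    have "plap p (- b) < plap p (- a)"
      using assms True by (simp add: plap_nonneg powr_less_mono2)
    then show ?thesis by (simp add: plap_minus)
  next
    case False
    have "0 < plap p (- a)" "0 < plap p b"
      using assms a False by (auto simp: plap_nonneg)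
    then show ?thesis by (simp add: plap_minus)
  qed
qed

lemma plap_mono: "1 < p \<Longrightarrow> a \<le> b \<Longrightarrow> plap p a \<le> plap p b"
  using plap_strict_mono[of p a b] by (cases "a = b") auto

lemma plap_mult: "plap p (a * b) = plap p a * plap p b"
  by (simp add: plap_def abs_mult powr_mult)

lemma isCont_plap:
  assumes "1 < p"
  shows "isCont (plap p) t"
proof -
  \<comment> \<open>For p < 2 the factor \<open>\<bar>t\<bar> powr (p - 2)\<close> is singular at 0.
    Separating positive and negative parts leaves powers with the positive exponent p - 1.\<close>
  have eq: "plap p = (\<lambda>t. (max t 0) powr (p - 1) - (max (- t) 0) powr (p - 1))"
  proof
    fix t show "plap p t = (max t 0) powr (p - 1) - (max (- t) 0) powr (p - 1)"
      using plap_nonneg[of t p] plap_nonneg[of "- t" p] plap_minus[of p t] assms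
      by (cases "t \<ge> 0") (auto simp: max_def)
  qed
  have "isCont (\<lambda>t::real. (max t 0) powr (p - 1)) u" for u
    unfolding isCont_def using assms
    by (intro tendsto_powr' tendsto_max tendsto_ident_at tendsto_const) auto
  then have *: "continuous (at u) (\<lambda>t::real. (max t 0) powr (p - 1))" for u .
  have "isCont (\<lambda>t::real. (max (- t) 0) powr (p - 1)) t"
    by (rule isCont_o2[OF _ *, of _ uminus]) simp
  with * show ?thesis unfolding eq by (intro continuous_diff) auto
qed

lemma borel_measurable_plap [measurable]: "1 < p \<Longrightarrow> plap p \<in> borel_measurable borel"
  by (intro borel_measurable_continuous_onI continuous_at_imp_continuous_on) (auto simp: isCont_plap)

text \<open>
  If \<open>a\<close> is close to \<open>b\<close> relative to \<open>\<bar>b\<bar>\<close>, homogeneity and continuity of \<^const>\<open>plap\<close> at 1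
  apply; otherwise all terms are controlled by \<open>\<bar>a - b\<bar>\<close>.
\<close>

lemma plap_diff_mult_le:
  fixes p e :: real
  assumes p: "1 < p" and e: "0 < e"
  shows "\<exists>C>0. \<forall>a b D. 0 \<le> D \<longrightarrow>
    \<bar>plap p a - plap p b\<bar> * D \<le> e * (\<bar>b\<bar> powr p + D powr p) + C * \<bar>a - b\<bar> powr p"
proof -
  have "plap p 1 = 1" by (simp add: plap_nonneg)
  then obtain t where t: "t > 0" "\<And>x. \<bar>x - 1\<bar> < t \<Longrightarrow> \<bar>plap p x - 1\<bar> < e"
    using isCont_plap[OF p, of 1] e unfolding continuous_at_eps_delta by (metis dist_real_def)
  \<comment> \<open>When a is not relatively close to b, \<bar>b\<bar> is at most 1 / t times
    \<bar>a - b\<bar> and \<bar>a\<bar> at most 1 + 1 / t times it; c adds up the two resulting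
    powers.\<close>
  define c where "c = (1 + 1/t) powr (p - 1) + (1/t) powr (p - 1)"
  have "0 < (1 / t) powr (p - 1)" using t by simp
  then have c: "c > 0" unfolding c_def by (intro add_nonneg_pos) auto
  obtain C where C: "C > 0" "\<And>D y. D \<ge> 0 \<Longrightarrow> y \<ge> 0 \<Longrightarrow> c * (y powr (p - 1) * D) \<le> e * D powr p + C * y powr p"
  proof -
    \<comment> \<open>\<open>k\<close> solves c * k powr (p - 1) = e. If y \<le> k * D, the product
      is absorbed into e * D powr p; otherwise D < y / k and the product is bounded by a multiple of
      y powr p.\<close>
    define k where "k = (e / c) powr (1 / (p - 1))"
    have k: "k > 0" using e c by (simp add: k_def)
    have ke: "c * k powr (p - 1) = e" using e c p by (simp add: k_def powr_powr)
    have "c * (y powr (p - 1) * D) \<le> e * D powr p + (c * (1 / k)) * y powr p" if "D \<ge> 0" "y \<ge> 0" for D y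
    proof (cases "y \<le> k * D")
      case True
      have "c * (y powr (p - 1) * D) \<le> c * ((k * D) powr (p - 1) * D)"
        using True that c p by (intro mult_left_mono mult_right_mono powr_mono2) auto
      also have "\<dots> = (c * k powr (p - 1)) * (D powr (p - 1) * D)"
        using k that by (simp add: powr_mult)
      also have "\<dots> = e * D powr p" using that by (simp add: ke powr_minus_one_mult)
      finally show ?thesis using c k by (smt (verit) divide_nonneg_nonneg mult_nonneg_nonneg powr_ge_zero)
    next
      case False
      then have "D \<le> y * (1/k)" using k by (simp add: field_simps)
      then have "c * (y powr (p - 1) * D) \<le> c * (y powr (p - 1) * (y * (1/k)))"
        using c by (intro mult_left_mono) auto
      also have "\<dots> = (c * (1/k)) * (y powr (p - 1) * y)" by simp
      also have "\<dots> = (c * (1/k)) * y powr p" using that by (simp add: powr_minus_one_mult)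
      finally show ?thesis using e by (smt (verit) mult_nonneg_nonneg powr_ge_zero)
    qed
    then show thesis using that[of "c * (1/k)"] c k by auto
  qed
  have "\<bar>plap p a - plap p b\<bar> * D \<le> e * (\<bar>b\<bar> powr p + D powr p) + C * \<bar>a - b\<bar> powr p" if D: "0 \<le> D" for a b D
  proof (cases "\<bar>a - b\<bar> < t * \<bar>b\<bar>")
    case True
    then have b: "b \<noteq> 0" by auto
    have "a / b - 1 = (a - b) / b" using b by (simp add: field_simps)
    then have "\<bar>a / b - 1\<bar> < t" using True b by (simp add: abs_divide pos_divide_less_eq)
    then have "\<bar>plap p (a / b) - 1\<bar> < e" by (rule t)
    moreover have "plap p a = plap p (a / b) * plap p b" using b by (simp flip: plap_mult)
    then have "plap p a - plap p b = (plap p (a / b) - 1) * plap p b" by (simp add: algebra_simps)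
    ultimately have "\<bar>plap p a - plap p b\<bar> \<le> e * \<bar>b\<bar> powr (p - 1)"
      by (simp add: abs_mult abs_plap mult_right_mono)
    then have "\<bar>plap p a - plap p b\<bar> * D \<le> e * (\<bar>b\<bar> powr (p - 1) * D)"
      using D by (metis mult.assoc mult_right_mono)
    also have "\<dots> \<le> e * (\<bar>b\<bar> powr p + D powr p)"
      using powr_mult_le_add[OF p, of "\<bar>b\<bar>" D] e D by (intro mult_left_mono) auto
    finally show ?thesis using C by (smt (verit) mult_nonneg_nonneg powr_ge_zero)
  next
    case False
    then have b: "\<bar>b\<bar> \<le> (1/t) * \<bar>a - b\<bar>" using t by (simp add: field_simps)
    then have a: "\<bar>a\<bar> \<le> (1 + 1/t) * \<bar>a - b\<bar>" by (simp add: algebra_simps)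
    have "\<bar>plap p a - plap p b\<bar> \<le> \<bar>a\<bar> powr (p - 1) + \<bar>b\<bar> powr (p - 1)"
      unfolding abs_plap[symmetric] by simp
    also have "\<dots> \<le> ((1 + 1/t) * \<bar>a - b\<bar>) powr (p - 1) + ((1/t) * \<bar>a - b\<bar>) powr (p - 1)"
      using a b p by (intro add_mono powr_mono2) auto
    also have "\<dots> = c * \<bar>a - b\<bar> powr (p - 1)"
      using t by (simp only: powr_mult) (simp add: c_def algebra_simps)
    finally have "\<bar>plap p a - plap p b\<bar> * D \<le> c * \<bar>a - b\<bar> powr (p - 1) * D"
      using D by (rule mult_right_mono)
    also have "\<dots> \<le> e * D powr p + C * \<bar>a - b\<bar> powr p" using C(2)[OF D, of "\<bar>a - b\<bar>"] by simp
    finally show ?thesis using e by (smt (verit) mult_nonneg_nonneg powr_ge_zero distrib_left)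
  qed
  then show ?thesis using C(1) by blast
qed

section \<open>The Gagliardo kernel and Sobolev norms over Borel functions\<close>

definition gag_denom :: "real \<Rightarrow> real \<Rightarrow> 'a::euclidean_space \<times> 'a \<Rightarrow> real" where
  "gag_denom s p z = norm (fst z - snd z) powr (real DIM('a) + s * p)"

definition gag_energy :: "real \<Rightarrow> real \<Rightarrow> ('a::euclidean_space \<Rightarrow> real) \<Rightarrow> ennreal" where
  "gag_energy s p w = (\<integral>\<^sup>+z. ennreal (\<bar>w (fst z) - w (snd z)\<bar> powr p / gag_denom s p z) \<partial>lborel)"

text \<open>Kept as a p-th power with values in \<open>ennreal\<close>: integrals then add without
  side conditions, at the price of a factor \<open>2 powr p\<close> in the triangle
  inequality.\<close>

definition Wsp_norm_p :: "real \<Rightarrow> real \<Rightarrow> ('a::euclidean_space \<Rightarrow> real) \<Rightarrow> ennreal" where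
  "Wsp_norm_p s p w = gag_energy s p w + (\<integral>\<^sup>+x. ennreal (\<bar>w x\<bar> powr p) \<partial>lborel)"

lemma gag_denom_nonneg: "0 \<le> gag_denom s p z"
  by (simp add: gag_denom_def)

lemma borel_measurable_fst_snd [measurable]:
  "fst \<in> (borel :: ('a::euclidean_space \<times> 'a) measure) \<rightarrow>\<^sub>M borel"
  "snd \<in> (borel :: ('a::euclidean_space \<times> 'a) measure) \<rightarrow>\<^sub>M borel"
  by (intro borel_measurable_continuous_onI continuous_intros)+

lemma borel_measurable_gag_denom [measurable]: "gag_denom s p \<in> borel_measurable borel"
  unfolding gag_denom_def by measurable

text \<open>Tonelli's theorem and translation invariance separate the variables y and h = x -
  y.\<close>

lemma nn_integral_kernel_snd:
  fixes g k :: "'a::euclidean_space \<Rightarrow> ennreal"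
  assumes [measurable]: "g \<in> borel_measurable borel" "k \<in> borel_measurable borel"
  shows "(\<integral>\<^sup>+z. g (snd z) * k (fst z - snd z) \<partial>lborel) = (\<integral>\<^sup>+y. g y \<partial>lborel) * (\<integral>\<^sup>+h. k h \<partial>lborel)"
proof -
  have "(\<integral>\<^sup>+z. g (snd z) * k (fst z - snd z) \<partial>lborel)
    = (\<integral>\<^sup>+z. g (snd z) * k (fst z - snd z) \<partial>(lborel \<Otimes>\<^sub>M lborel))"
    by (simp add: lborel_prod)
  also have "\<dots> = (\<integral>\<^sup>+y. \<integral>\<^sup>+x. g y * k (x - y) \<partial>lborel \<partial>lborel)"
    by (subst lborel_pair.nn_integral_snd[symmetric]) auto
  also have "\<dots> = (\<integral>\<^sup>+y. g y * (\<integral>\<^sup>+h. k h \<partial>lborel) \<partial>lborel)"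
  proof (rule nn_integral_cong)
    fix y
    have "(\<integral>\<^sup>+x. g y * k (x - y) \<partial>lborel) = g y * (\<integral>\<^sup>+x. k (x + (- y)) \<partial>lborel)"
      by (subst nn_integral_cmult) auto
    then show "(\<integral>\<^sup>+x. g y * k (x - y) \<partial>lborel) = g y * (\<integral>\<^sup>+h. k h \<partial>lborel)"
      by (subst (asm) nn_integral_lborel_translation) auto
  qed
  also have "\<dots> = (\<integral>\<^sup>+y. g y \<partial>lborel) * (\<integral>\<^sup>+h. k h \<partial>lborel)"
    by (subst nn_integral_multc) auto
  finally show ?thesis .
qed

lemma nn_integral_swap:
  fixes g :: "'a::euclidean_space \<times> 'a \<Rightarrow> ennreal"
  assumes [measurable]: "g \<in> borel_measurable borel"
  shows "(\<integral>\<^sup>+z. g (snd z, fst z) \<partial>lborel) = (\<integral>\<^sup>+z. g z \<partial>lborel)"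
proof -
  have [measurable]: "g \<in> borel_measurable (lborel \<Otimes>\<^sub>M lborel)"
    by (simp add: lborel_prod)
  have [measurable]: "(\<lambda>z. g (snd z, fst z)) \<in> borel_measurable (lborel \<Otimes>\<^sub>M lborel)"
    by measurable
  have "(\<integral>\<^sup>+z. g (snd z, fst z) \<partial>lborel) = (\<integral>\<^sup>+z. g (snd z, fst z) \<partial>(lborel \<Otimes>\<^sub>M lborel))"
    by (simp add: lborel_prod)
  also have "\<dots> = (\<integral>\<^sup>+y. \<integral>\<^sup>+x. g (y, x) \<partial>lborel \<partial>lborel)"
    by (subst lborel_pair.nn_integral_snd[symmetric]) auto
  also have "\<dots> = (\<integral>\<^sup>+z. g z \<partial>(lborel \<Otimes>\<^sub>M lborel))"
    by (subst lborel.nn_integral_fst) auto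
  finally show ?thesis by (simp add: lborel_prod)
qed

lemma nn_integral_kernel_fst:
  fixes g k :: "'a::euclidean_space \<Rightarrow> ennreal"
  assumes [measurable]: "g \<in> borel_measurable borel" "k \<in> borel_measurable borel"
    and even: "\<And>h. k (- h) = k h"
  shows "(\<integral>\<^sup>+z. g (fst z) * k (fst z - snd z) \<partial>lborel) = (\<integral>\<^sup>+y. g y \<partial>lborel) * (\<integral>\<^sup>+h. k h \<partial>lborel)"
proof -
  have "(\<integral>\<^sup>+z. g (fst z) * k (fst z - snd z) \<partial>lborel) = (\<integral>\<^sup>+z. g (snd z) * k (snd z - fst z) \<partial>lborel)"
    by (subst nn_integral_swap[symmetric]) auto
  also have "\<dots> = (\<integral>\<^sup>+z. g (snd z) * k (fst z - snd z) \<partial>lborel)"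
    by (intro nn_integral_cong) (metis even minus_diff_eq)
  finally show ?thesis by (simp add: nn_integral_kernel_snd)
qed

text \<open>At distance at least d from the diagonal the kernel is integrable in x - y, so an
  integrable weight in one variable is enough. This controls all nonlocal tails below.\<close>

lemma far_finite:
  fixes g :: "'a::euclidean_space \<Rightarrow> real"
  assumes "0 < s * p" "0 < d" and [measurable]: "g \<in> borel_measurable borel"
    and g: "(\<integral>\<^sup>+x. ennreal (g x) \<partial>lborel) < \<infinity>"
  shows "(\<integral>\<^sup>+z. ennreal (g (fst z)) * ennreal (indicator {z. d \<le> norm (fst z - snd z)} z / gag_denom s p z) \<partial>lborel) < \<infinity>"
    and "(\<integral>\<^sup>+z. ennreal (g (snd z)) * ennreal (indicator {z. d \<le> norm (fst z - snd z)} z / gag_denom s p z) \<partial>lborel) < \<infinity>"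
proof -
  define k where "k h = ennreal (indicator {h. d \<le> norm h} h / norm (h::'a) powr (real DIM('a) + s * p))" for h
  have [measurable]: "k \<in> borel_measurable borel" unfolding k_def by measurable
  have eq: "ennreal (indicator {z. d \<le> norm (fst z - snd z)} z / gag_denom s p z) = k (fst z - snd z)" for z :: "'a \<times> 'a"
    by (auto simp: k_def gag_denom_def indicator_def)
  have fin: "(\<integral>\<^sup>+h. k h \<partial>lborel) < \<infinity>" unfolding k_def using assms by (intro nn_integral_powr_far)
  have even: "k (- h) = k h" for h by (simp add: k_def indicator_def)
  show "(\<integral>\<^sup>+z. ennreal (g (fst z)) * ennreal (indicator {z. d \<le> norm (fst z - snd z)} z / gag_denom s p z) \<partial>lborel) < \<infinity>"
    unfolding eq using g fin
    by (subst nn_integral_kernel_fst[of "\<lambda>x. ennreal (g x)" k]) (auto simp: ennreal_mult_less_top even)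
  show "(\<integral>\<^sup>+z. ennreal (g (snd z)) * ennreal (indicator {z. d \<le> norm (fst z - snd z)} z / gag_denom s p z) \<partial>lborel) < \<infinity>"
    unfolding eq using g fin
    by (subst nn_integral_kernel_snd[of "\<lambda>x. ennreal (g x)" k]) (auto simp: ennreal_mult_less_top)
qed

lemma gag_energy_cong_le:
  assumes "\<And>x y. \<bar>v x - v y\<bar> \<le> \<bar>w x - w y\<bar>" "0 < p"
  shows "gag_energy s p v \<le> gag_energy s p w"
  unfolding gag_energy_def using assms gag_denom_nonneg[of s p]
  by (intro nn_integral_mono ennreal_leI divide_right_mono powr_mono2) auto

lemma Wsp_norm_p_cong_le:
  assumes "\<And>x y. \<bar>v x - v y\<bar> \<le> \<bar>w x - w y\<bar>" "\<And>x. \<bar>v x\<bar> \<le> \<bar>w x\<bar>" "0 < p"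
  shows "Wsp_norm_p s p v \<le> Wsp_norm_p s p w"
  unfolding Wsp_norm_p_def using assms
  by (intro add_mono gag_energy_cong_le nn_integral_mono ennreal_leI powr_mono2) auto

lemma gag_energy_add:
  fixes v w :: "'a::euclidean_space \<Rightarrow> real"
  assumes p: "0 < p" and [measurable]: "v \<in> borel_measurable borel" "w \<in> borel_measurable borel"
  shows "gag_energy s p (\<lambda>x. v x + w x) \<le> ennreal (2 powr p) * (gag_energy s p v + gag_energy s p w)"
proof -
  have "gag_energy s p (\<lambda>x. v x + w x) \<le> (\<integral>\<^sup>+z. ennreal (2 powr p) * (ennreal (\<bar>v (fst z) - v (snd z)\<bar> powr p / gag_denom s p z)
     + ennreal (\<bar>w (fst z) - w (snd z)\<bar> powr p / gag_denom s p z)) \<partial>lborel)"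
    unfolding gag_energy_def
  proof (intro nn_integral_mono)
    fix z
    have "\<bar>v (fst z) + w (fst z) - (v (snd z) + w (snd z))\<bar> powr p
      \<le> 2 powr p * (\<bar>v (fst z) - v (snd z)\<bar> powr p + \<bar>w (fst z) - w (snd z)\<bar> powr p)"
      using powr_add_le[OF p, of "v (fst z) - v (snd z)" "w (fst z) - w (snd z)"] by (simp add: algebra_simps)
    then have "\<bar>v (fst z) + w (fst z) - (v (snd z) + w (snd z))\<bar> powr p / gag_denom s p z
      \<le> 2 powr p * (\<bar>v (fst z) - v (snd z)\<bar> powr p / gag_denom s p z + \<bar>w (fst z) - w (snd z)\<bar> powr p / gag_denom s p z)"
      using gag_denom_nonneg[of s p z] by (simp add: divide_right_mono flip: add_divide_distrib)
    then show "ennreal (\<bar>v (fst z) + w (fst z) - (v (snd z) + w (snd z))\<bar> powr p / gag_denom s p z)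
      \<le> ennreal (2 powr p) * (ennreal (\<bar>v (fst z) - v (snd z)\<bar> powr p / gag_denom s p z)
     + ennreal (\<bar>w (fst z) - w (snd z)\<bar> powr p / gag_denom s p z))"
      using gag_denom_nonneg[of s p z] by (simp add: ennreal_leI flip: ennreal_plus ennreal_mult')
  qed
  also have "\<dots> = ennreal (2 powr p) * (gag_energy s p v + gag_energy s p w)"
    unfolding gag_energy_def by (subst nn_integral_cmult, simp, subst nn_integral_add) auto
  finally show ?thesis .
qed

lemma Wsp_norm_p_add:
  fixes v w :: "'a::euclidean_space \<Rightarrow> real"
  assumes p: "0 < p" and [measurable]: "v \<in> borel_measurable borel" "w \<in> borel_measurable borel"
  shows "Wsp_norm_p s p (\<lambda>x. v x + w x) \<le> ennreal (2 powr p) * (Wsp_norm_p s p v + Wsp_norm_p s p w)"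
proof -
  have "(\<integral>\<^sup>+x. ennreal (\<bar>v x + w x\<bar> powr p) \<partial>lborel)
    \<le> (\<integral>\<^sup>+x. ennreal (2 powr p) * (ennreal (\<bar>v x\<bar> powr p) + ennreal (\<bar>w x\<bar> powr p)) \<partial>lborel)"
    using powr_add_le[OF p] by (intro nn_integral_mono) (simp add: ennreal_leI flip: ennreal_plus ennreal_mult')
  also have "\<dots> = ennreal (2 powr p) * ((\<integral>\<^sup>+x. ennreal (\<bar>v x\<bar> powr p) \<partial>lborel) + (\<integral>\<^sup>+x. ennreal (\<bar>w x\<bar> powr p) \<partial>lborel))"
    by (subst nn_integral_cmult, simp, subst nn_integral_add) auto
  finally have "Wsp_norm_p s p (\<lambda>x. v x + w x) \<le> ennreal (2 powr p) * (gag_energy s p v + gag_energy s p w)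
     + ennreal (2 powr p) * ((\<integral>\<^sup>+x. ennreal (\<bar>v x\<bar> powr p) \<partial>lborel) + (\<integral>\<^sup>+x. ennreal (\<bar>w x\<bar> powr p) \<partial>lborel))"
    unfolding Wsp_norm_p_def by (intro add_mono gag_energy_add assms)
  also have "\<dots> = ennreal (2 powr p) * (Wsp_norm_p s p v + Wsp_norm_p s p w)"
    by (simp add: Wsp_norm_p_def distrib_left add_ac)
  finally show ?thesis .
qed

text \<open>By the discrete product rule the difference of \<zeta> * w is \<zeta>(x) * (w(x) - w(y))
  + (\<zeta>(x) - \<zeta>(y)) * w(y). The first term is controlled by the energy of w; the second
  yields \<bar>w(y)\<bar>^p times the kernel of \<open>nn_integral_powr_annuli\<close> with a = s *
  p and b = p, where s < 1 enters.\<close>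

lemma Wsp_norm_p_cutoff_finite:
  fixes w \<zeta> :: "'a::euclidean_space \<Rightarrow> real"
  assumes p: "1 < p" and s: "0 < s" "s < 1"
    and [measurable]: "w \<in> borel_measurable borel" "\<zeta> \<in> borel_measurable borel"
    and w: "Wsp_norm_p s p w < \<infinity>"
    and \<zeta>: "\<And>x. 0 \<le> \<zeta> x" "\<And>x. \<zeta> x \<le> 1" "0 \<le> L" "\<And>x y. \<bar>\<zeta> x - \<zeta> y\<bar> \<le> L * norm (x - y)"
  shows "Wsp_norm_p s p (\<lambda>x. \<zeta> x * w x) < \<infinity>"
proof -
  \<comment> \<open>Chosen so that the range [0, 1] and the Lipschitz bound of \<zeta> merge into
    the single estimate M * min 1 (norm (x - y)).\<close>
  define M where "M = max 1 L"
  define k where "k h = ennreal (min 1 (norm (h::'a)) powr p / norm h powr (real DIM('a) + s * p))" for h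
  have [measurable]: "k \<in> borel_measurable borel" unfolding k_def by measurable
  have fink: "(\<integral>\<^sup>+h. k h \<partial>lborel) < \<infinity>"
    unfolding k_def using p s by (intro nn_integral_powr_annuli) auto
  have L1: "\<bar>\<zeta> x - \<zeta> y\<bar> \<le> M * min 1 (norm (x - y))" for x y
  proof -
    have "\<bar>\<zeta> x - \<zeta> y\<bar> \<le> 1" using \<zeta>(1,2)[of x] \<zeta>(1,2)[of y] by auto
    moreover have "L * norm (x - y) \<le> M * norm (x - y)" by (intro mult_right_mono) (auto simp: M_def)
    moreover have "1 \<le> M" by (simp add: M_def)
    ultimately show ?thesis using \<zeta>(4)[of x y] by (auto simp: min_def)
  qed
  have fin_w: "gag_energy s p w < \<infinity>" "(\<integral>\<^sup>+x. ennreal (\<bar>w x\<bar> powr p) \<partial>lborel) < \<infinity>"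
    using w by (auto simp: Wsp_norm_p_def)
  have "gag_energy s p (\<lambda>x. \<zeta> x * w x) \<le> (\<integral>\<^sup>+z. ennreal (2 powr p) * (ennreal (\<bar>w (fst z) - w (snd z)\<bar> powr p / gag_denom s p z)
     + ennreal (M powr p) * (ennreal (\<bar>w (snd z)\<bar> powr p) * k (fst z - snd z))) \<partial>lborel)"
    unfolding gag_energy_def
  proof (intro nn_integral_mono)
    fix z :: "'a \<times> 'a"
    let ?x = "fst z" and ?y = "snd z" let ?m = "min 1 (norm (?x - ?y))"
    have "\<bar>\<zeta> ?x * w ?x - \<zeta> ?y * w ?y\<bar> powr p = \<bar>\<zeta> ?x * (w ?x - w ?y) + (\<zeta> ?x - \<zeta> ?y) * w ?y\<bar> powr p"
      by (simp add: algebra_simps)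
    also have "\<dots> \<le> 2 powr p * (\<bar>\<zeta> ?x * (w ?x - w ?y)\<bar> powr p + \<bar>(\<zeta> ?x - \<zeta> ?y) * w ?y\<bar> powr p)"
      using p by (intro powr_add_le) auto
    also have "\<dots> \<le> 2 powr p * (\<bar>w ?x - w ?y\<bar> powr p + (M * ?m * \<bar>w ?y\<bar>) powr p)"
    proof (intro mult_left_mono add_mono powr_mono2)
      show "\<bar>\<zeta> ?x * (w ?x - w ?y)\<bar> \<le> \<bar>w ?x - w ?y\<bar>"
        using \<zeta>(1,2)[of ?x] by (simp add: abs_mult mult_left_le_one_le)
      show "\<bar>(\<zeta> ?x - \<zeta> ?y) * w ?y\<bar> \<le> M * ?m * \<bar>w ?y\<bar>"
        unfolding abs_mult by (intro mult_right_mono L1) auto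
    qed (use p in auto)
    also have "(M * ?m * \<bar>w ?y\<bar>) powr p = M powr p * (\<bar>w ?y\<bar> powr p * ?m powr p)"
      by (simp add: M_def powr_mult)
    finally have "\<bar>\<zeta> ?x * w ?x - \<zeta> ?y * w ?y\<bar> powr p / gag_denom s p z
       \<le> 2 powr p * (\<bar>w ?x - w ?y\<bar> powr p + M powr p * (\<bar>w ?y\<bar> powr p * ?m powr p)) / gag_denom s p z"
      using gag_denom_nonneg[of s p z] by (intro divide_right_mono)
    also have "\<dots> = 2 powr p * (\<bar>w ?x - w ?y\<bar> powr p / gag_denom s p z + M powr p * (\<bar>w ?y\<bar> powr p * (?m powr p / gag_denom s p z)))"
      by (simp add: add_divide_distrib distrib_left)
    finally have "ennreal (\<bar>\<zeta> ?x * w ?x - \<zeta> ?y * w ?y\<bar> powr p / gag_denom s p z)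
       \<le> ennreal (2 powr p * (\<bar>w ?x - w ?y\<bar> powr p / gag_denom s p z + M powr p * (\<bar>w ?y\<bar> powr p * (?m powr p / gag_denom s p z))))"
      by (rule ennreal_leI)
    also have "\<dots> = ennreal (2 powr p) * (ennreal (\<bar>w ?x - w ?y\<bar> powr p / gag_denom s p z)
     + ennreal (M powr p) * (ennreal (\<bar>w ?y\<bar> powr p) * ennreal (?m powr p / gag_denom s p z)))"
      using gag_denom_nonneg[of s p z] by (simp flip: ennreal_plus ennreal_mult')
    finally show "ennreal (\<bar>\<zeta> ?x * w ?x - \<zeta> ?y * w ?y\<bar> powr p / gag_denom s p z)
       \<le> ennreal (2 powr p) * (ennreal (\<bar>w ?x - w ?y\<bar> powr p / gag_denom s p z)
     + ennreal (M powr p) * (ennreal (\<bar>w ?y\<bar> powr p) * k (?x - ?y)))"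
      by (simp add: k_def gag_denom_def)
  qed
  also have "\<dots> = ennreal (2 powr p) * (gag_energy s p w + ennreal (M powr p) *
     (\<integral>\<^sup>+z. ennreal (\<bar>w (snd z)\<bar> powr p) * k (fst z - snd z) \<partial>lborel))"
    unfolding gag_energy_def by (subst nn_integral_cmult, simp, subst nn_integral_add, simp, simp, subst nn_integral_cmult) auto
  also have "\<dots> < \<infinity>"
    using fin_w fink
    by (subst nn_integral_kernel_snd[of "\<lambda>x. ennreal (\<bar>w x\<bar> powr p)" k]) (auto simp: ennreal_mult_less_top)
  finally have "gag_energy s p (\<lambda>x. \<zeta> x * w x) < \<infinity>" .
  moreover have "(\<integral>\<^sup>+x. ennreal (\<bar>\<zeta> x * w x\<bar> powr p) \<partial>lborel) \<le> (\<integral>\<^sup>+x. ennreal (\<bar>w x\<bar> powr p) \<partial>lborel)"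
    using \<zeta>(1,2) p by (intro nn_integral_mono ennreal_leI powr_mono2) (auto simp: abs_mult mult_left_le_one_le)
  ultimately show ?thesis using fin_w by (auto simp: Wsp_norm_p_def less_top[symmetric] top_unique)
qed

section \<open>Translations in the Sobolev norm\<close>

lemma gag_denom_translate: "gag_denom s p (z + (h, h)) = gag_denom s p z"
  by (simp add: gag_denom_def)

text \<open>The energy is the p-th power of the L^p norm of a weighted difference quotient on pairs.
  The kernel is invariant under diagonal shifts, so translating w by h translates that quotient by
  (h, h), and continuity of translations in L^p applies. The half of d accounts for norm (h, h)
  \<le> 2 * norm h.\<close>

lemma gag_energy_translation_continuous:
  fixes w :: "'a::euclidean_space \<Rightarrow> real"
  assumes p: "1 < p" and [measurable]: "w \<in> borel_measurable borel" and w: "gag_energy s p w < \<infinity>" and e: "e > 0"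
  shows "\<exists>d>0. \<forall>h. norm h < d \<longrightarrow> gag_energy s p (\<lambda>x. w (x + h) - w x) \<le> ennreal e"
proof -
  define g where "g z = (w (fst z) - w (snd z)) / gag_denom s p z powr (1 / p)" for z
  have [measurable]: "g \<in> borel_measurable borel" unfolding g_def by measurable
  have gp: "\<bar>a / gag_denom s p z powr (1 / p)\<bar> powr p = \<bar>a\<bar> powr p / gag_denom s p z" for a z
    using p gag_denom_nonneg[of s p z] by (simp add: abs_divide powr_divide powr_powr)
  have "(\<integral>\<^sup>+z. ennreal (\<bar>g z\<bar> powr p) \<partial>lborel) < \<infinity>"
    using w unfolding g_def gp gag_energy_def .
  then obtain d where d: "d > 0" "\<And>h. norm h < d \<Longrightarrow> (\<integral>\<^sup>+z. ennreal (\<bar>g (z + h) - g z\<bar> powr p) \<partial>lborel) \<le> ennreal e"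
    using Lp_translation_continuous[of p g e] p e by auto
  have "gag_energy s p (\<lambda>x. w (x + h) - w x) \<le> ennreal e" if h: "norm h < d / 2" for h
  proof -
    have "norm (h, h) \<le> norm h + norm h" by (rule norm_Pair_le)
    then have "norm (h, h) < d" using h by simp
    then have "(\<integral>\<^sup>+z. ennreal (\<bar>g (z + (h, h)) - g z\<bar> powr p) \<partial>lborel) \<le> ennreal e" by (rule d)
    moreover have "g (z + (h, h)) - g z = (w (fst z + h) - w (fst z) - (w (snd z + h) - w (snd z))) / gag_denom s p z powr (1 / p)" for z
      by (simp add: g_def gag_denom_translate diff_divide_distrib add_divide_distrib)
    ultimately show ?thesis unfolding gag_energy_def by (simp only: gp)
  qed
  then show ?thesis using d(1) by (intro exI[of _ "d/2"]) auto
qed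

lemma Wsp_norm_p_translation_continuous:
  fixes w :: "'a::euclidean_space \<Rightarrow> real"
  assumes p: "1 < p" and [measurable]: "w \<in> borel_measurable borel" and w: "Wsp_norm_p s p w < \<infinity>" and e: "e > 0"
  shows "\<exists>d>0. \<forall>h. norm h < d \<longrightarrow> Wsp_norm_p s p (\<lambda>x. w (x + h) - w x) \<le> ennreal e"
proof -
  have fin_w: "gag_energy s p w < \<infinity>" "(\<integral>\<^sup>+x. ennreal (\<bar>w x\<bar> powr p) \<partial>lborel) < \<infinity>"
    using w by (auto simp: Wsp_norm_p_def)
  have e2: "e / 2 > 0" using e by simp
  obtain d where d: "d > 0" "\<And>h. norm h < d \<Longrightarrow> gag_energy s p (\<lambda>x. w (x + h) - w x) \<le> ennreal (e/2)"
    using gag_energy_translation_continuous[OF p _ fin_w(1) e2] by auto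
  obtain d' where d': "d' > 0" "\<And>h. norm h < d' \<Longrightarrow> (\<integral>\<^sup>+z. ennreal (\<bar>w (z + h) - w z\<bar> powr p) \<partial>lborel) \<le> ennreal (e/2)"
    using Lp_translation_continuous[OF _ _ fin_w(2) e2] p by auto
  have "Wsp_norm_p s p (\<lambda>x. w (x + h) - w x) \<le> ennreal e" if "norm h < min d d'" for h
  proof -
    have "Wsp_norm_p s p (\<lambda>x. w (x + h) - w x) \<le> ennreal (e/2) + ennreal (e/2)"
      unfolding Wsp_norm_p_def using that d d' by (intro add_mono) auto
    then show ?thesis using e by (simp flip: ennreal_plus)
  qed
  then show ?thesis using d(1) d'(1) by (intro exI[of _ "min d d'"]) auto
qed

subsection \<open>Bounded test functions of finite energy\<close>

lemma integral_lborel_translation: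
  fixes f :: "'a::euclidean_space \<Rightarrow> real"
  assumes [measurable]: "f \<in> borel_measurable borel"
  shows "(LINT z|lborel. f (z + h)) = (LINT z|lborel. f z)"
proof -
  have "(LINT z|lborel. f z) = (LINT z|distr lborel borel ((+) h). f z)"
    by (simp add: lborel_distr_plus)
  also have "\<dots> = (LINT z|lborel. f (h + z))"
    by (subst integral_distr) auto
  finally show ?thesis by (simp add: add.commute)
qed

lemma integral_lborel_reflection:
  fixes f :: "'a::euclidean_space \<Rightarrow> real"
  assumes [measurable]: "f \<in> borel_measurable borel"
  shows "(LINT z|lborel. f (x - z)) = (LINT z|lborel. f z)"
proof -
  have "distr lborel borel ((-) x) = lborel"
    by (rule lborel_distr_isometry[where L = uminus]) (auto intro: surjI)
  then have "(LINT z|lborel. f z) = (LINT z|distr lborel borel ((-) x). f z)"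
    by simp
  also have "\<dots> = (LINT z|lborel. f (x - z))"
    by (subst integral_distr) auto
  finally show ?thesis by simp
qed

lemma integrable_lborel_translation:
  fixes f :: "'a::euclidean_space \<Rightarrow> real"
  assumes "integrable lborel f"
  shows "integrable lborel (\<lambda>z. f (z + h))"
proof -
  have [measurable]: "f \<in> borel_measurable borel" using assms by auto
  have "integrable (distr lborel borel ((+) h)) f" using assms by (simp add: lborel_distr_plus)
  then have "integrable lborel (\<lambda>z. f (h + z))" by (subst (asm) integrable_distr_eq) auto
  then show ?thesis by (simp add: add.commute)
qed

lemma integrable_mult_bounded:
  fixes G D :: "'a::euclidean_space \<Rightarrow> real"
  assumes G: "integrable lborel G" and [measurable]: "D \<in> borel_measurable borel" and D: "\<And>z. \<bar>D z\<bar> \<le> M"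
  shows "integrable lborel (\<lambda>z. G z * D z)"
proof (rule Bochner_Integration.integrable_bound)
  have [measurable]: "G \<in> borel_measurable borel" using G by auto
  show "integrable lborel (\<lambda>z. M * G z)" using G by simp
  show "AE z in lborel. norm (G z * D z) \<le> norm (M * G z)"
  proof (rule AE_I2)
    fix z
    have "\<bar>D z\<bar> * \<bar>G z\<bar> \<le> \<bar>M\<bar> * \<bar>G z\<bar>" using D[of z] by (intro mult_right_mono) auto
    then show "norm (G z * D z) \<le> norm (M * G z)" by (simp add: abs_mult mult.commute)
  qed
qed (use G in measurable)

text \<open>A change of variables moves the translation from D, which is merely bounded and may be
  discontinuous, to the integrable G, whose translates depend continuously on h in L^1.\<close>

lemma translate_bounded_weakly_continuous:
  fixes G D :: "'a::euclidean_space \<Rightarrow> real"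
  assumes G: "integrable lborel G" and [measurable]: "D \<in> borel_measurable borel" and D: "\<And>z. \<bar>D z\<bar> \<le> M"
    and e: "0 < e"
  shows "\<exists>d>0. \<forall>h. norm h < d \<longrightarrow> \<bar>(LINT z|lborel. G z * D (z - h)) - (LINT z|lborel. G z * D z)\<bar> \<le> e"
proof -
  have [measurable]: "G \<in> borel_measurable borel" using G by auto
  have M: "0 \<le> M" using D[of 0] by linarith
  have "e / (M + 1) > 0" using e M by simp
  then obtain d where d: "d > 0" "\<And>h. norm h < d \<Longrightarrow>
     (\<integral>\<^sup>+z. ennreal \<bar>G (z + h) - G z\<bar> \<partial>lborel) \<le> ennreal (e / (M + 1))"
    using integrable_L1_translation_continuous[OF G] unfolding L1_translation_continuous_def by blast
  have "\<bar>(LINT z|lborel. G z * D (z - h)) - (LINT z|lborel. G z * D z)\<bar> \<le> e" if h: "norm h < d" for h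
  proof -
    note int = integrable_mult_bounded[OF integrable_lborel_translation[OF G] _ D] integrable_mult_bounded[OF G _ D]
    have "(LINT z|lborel. G z * D (z - h)) = (LINT z|lborel. G (z + h) * D (z + h - h))"
      by (rule integral_lborel_translation[symmetric]) simp
    then have "(LINT z|lborel. G z * D (z - h)) - (LINT z|lborel. G z * D z) = (LINT z|lborel. (G (z + h) - G z) * D z)"
      using int by (simp add: left_diff_distrib)
    also have "\<bar>\<dots>\<bar> \<le> (LINT z|lborel. \<bar>G (z + h) - G z\<bar> * M)"
    proof (rule integral_abs_bound[THEN order_trans], rule integral_mono)
      show "integrable lborel (\<lambda>z. \<bar>(G (z + h) - G z) * D z\<bar>)"
        using int by (simp add: left_diff_distrib)
      show "integrable lborel (\<lambda>z. \<bar>G (z + h) - G z\<bar> * M)"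
        using G integrable_lborel_translation[OF G] by auto
      show "\<bar>(G (z + h) - G z) * D z\<bar> \<le> \<bar>G (z + h) - G z\<bar> * M" for z
        unfolding abs_mult using D by (intro mult_left_mono) auto
    qed
    also have "\<dots> = M * (LINT z|lborel. \<bar>G (z + h) - G z\<bar>)" by simp
    also have "(LINT z|lborel. \<bar>G (z + h) - G z\<bar>) = enn2real (\<integral>\<^sup>+z. ennreal \<bar>G (z + h) - G z\<bar> \<partial>lborel)"
      by (rule integral_eq_nn_integral) auto
    also have "\<dots> \<le> e / (M + 1)"
      using d(2)[OF h] e M by (intro enn2real_leI) auto
    finally have "\<bar>(LINT z|lborel. G z * D (z - h)) - (LINT z|lborel. G z * D z)\<bar> \<le> M * (e / (M + 1))"
      using M by (simp add: mult_left_mono)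
    also have "\<dots> \<le> e" using M e by (simp add: field_simps)
    finally show ?thesis .
  qed
  then show ?thesis using d(1) by blast
qed

text \<open>The slices are bounded only on the support of the weight, because later they are
  controlled only for short translations.\<close>

lemma weighted_Fubini:
  fixes P :: "'a::euclidean_space \<times> 'b::euclidean_space \<Rightarrow> real" and \<rho> :: "'a \<Rightarrow> real"
  assumes P[measurable]: "P \<in> borel_measurable borel" and \<rho>: "integrable lborel \<rho>" "\<And>h. 0 \<le> \<rho> h"
    and C: "\<And>h. \<rho> h \<noteq> 0 \<Longrightarrow> (\<integral>\<^sup>+z. ennreal \<bar>P (h, z)\<bar> \<partial>lborel) \<le> ennreal C"
  shows "integrable lborel (\<lambda>h. \<rho> h * (LINT z|lborel. P (h, z)))"
    and "(LINT z|lborel. LINT h|lborel. \<rho> h * P (h, z)) = (LINT h|lborel. \<rho> h * (LINT z|lborel. P (h, z)))"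
proof -
  have [measurable]: "\<rho> \<in> borel_measurable borel" using \<rho> by auto
  have [measurable]: "P \<in> borel_measurable (lborel \<Otimes>\<^sub>M lborel)" by (simp add: lborel_prod)
  have [measurable]: "P \<in> borel_measurable (borel \<Otimes>\<^sub>M borel)" by (simp add: borel_prod)
  have fin: "(\<integral>\<^sup>+h. ennreal (\<rho> h) \<partial>lborel) < \<infinity>"
    using \<rho> by (simp add: integrable_iff_bounded)
  have int: "integrable (lborel \<Otimes>\<^sub>M lborel) (\<lambda>(h, z). \<rho> h * P (h, z))"
    unfolding integrable_iff_bounded
  proof
    show "(\<lambda>(h, z). \<rho> h * P (h, z)) \<in> borel_measurable (lborel \<Otimes>\<^sub>M lborel)" by measurable
    have "(\<integral>\<^sup>+x. ennreal (norm (case x of (h, z) \<Rightarrow> \<rho> h * P (h, z))) \<partial>(lborel \<Otimes>\<^sub>M lborel))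
      = (\<integral>\<^sup>+h. \<integral>\<^sup>+z. ennreal (norm (\<rho> h * P (h, z))) \<partial>lborel \<partial>lborel)"
      by (subst lborel.nn_integral_fst[symmetric]) auto
    also have "\<dots> = (\<integral>\<^sup>+h. ennreal (\<rho> h) * (\<integral>\<^sup>+z. ennreal \<bar>P (h, z)\<bar> \<partial>lborel) \<partial>lborel)"
      using \<rho>(2) by (intro nn_integral_cong, subst nn_integral_cmult[symmetric]) (auto simp: abs_mult ennreal_mult')
    also have "\<dots> \<le> (\<integral>\<^sup>+h. ennreal (\<rho> h) * ennreal C \<partial>lborel)"
    proof (intro nn_integral_mono)
      fix h show "ennreal (\<rho> h) * (\<integral>\<^sup>+z. ennreal \<bar>P (h, z)\<bar> \<partial>lborel) \<le> ennreal (\<rho> h) * ennreal C"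
        using C[of h] by (cases "\<rho> h = 0") (auto intro: mult_left_mono)
    qed
    also have "\<dots> = (\<integral>\<^sup>+h. ennreal (\<rho> h) \<partial>lborel) * ennreal C"
      by (rule nn_integral_multc) measurable
    also have "\<dots> < \<infinity>" using fin by (simp add: ennreal_mult_less_top)
    finally show "(\<integral>\<^sup>+x. ennreal (norm (case x of (h, z) \<Rightarrow> \<rho> h * P (h, z))) \<partial>(lborel \<Otimes>\<^sub>M lborel)) < \<infinity>" .
  qed
  show "integrable lborel (\<lambda>h. \<rho> h * (LINT z|lborel. P (h, z)))"
    using lborel_pair.integrable_fst'[OF int] by simp
  show "(LINT z|lborel. LINT h|lborel. \<rho> h * P (h, z)) = (LINT h|lborel. \<rho> h * (LINT z|lborel. P (h, z)))"
    using lborel_pair.Fubini_integral[of "\<lambda>h z. \<rho> h * P (h, z)"] int by simp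
qed

lemma bump_integrable:
  assumes "0 < d"
  shows "integrable lborel (bump d :: 'a::euclidean_space \<Rightarrow> real)"
proof -
  obtain M where M: "\<And>x::'a. \<bar>bump d x\<bar> \<le> M"
    using bumps_bounded[OF bump_in_bumps[OF assms, where 'a='a]] by metis
  show ?thesis
  proof (rule integrableI_bounded_set[where A = "cball 0 d" and B = M])
    show "emeasure lborel (cball (0::'a) d) < \<infinity>" by (rule emeasure_lborel_cball_finite)
    show "bump d \<in> borel_measurable (lborel :: 'a measure)"
      using bumps_continuous[OF bump_in_bumps[OF assms]] borel_measurable_continuous_onI by auto
  qed (use M in \<open>auto intro!: AE_I2 bump_zero[OF assms]\<close>)
qed

lemma bump_integral_pos:
  assumes "0 < d"
  shows "0 < (LINT h|lborel. bump d (h :: 'a::euclidean_space))"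
proof (rule ccontr)
  assume "\<not> 0 < (LINT h|lborel. bump d (h :: 'a))"
  moreover have "0 \<le> (LINT h|lborel. bump d (h :: 'a))" by (intro Bochner_Integration.integral_nonneg bump_nonneg)
  ultimately have "(LINT h|lborel. bump d (h :: 'a)) = 0" by simp
  then have "AE h in lborel. bump d (h :: 'a) = 0"
    using integral_nonneg_eq_0_iff_AE[OF bump_integrable[OF assms, where 'a='a]] by (simp add: bump_nonneg)
  then have "AE h in lborel. (h :: 'a) \<notin> ball 0 d"
  proof eventually_elim
    case (elim h)
    then show ?case using bump_pos[of h d] by auto
  qed
  then have "emeasure lborel (ball (0::'a) d) = 0"
    by (subst (asm) AE_iff_measurable[where N = "ball 0 d"]) auto
  then have "measure lborel (ball (0::'a) d) = 0" by (simp add: measure_def)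
  then show False using content_ball_gt_0_iff[of "0::'a" d] assms by simp
qed

section \<open>The weak equation and its enlarged class of test functions\<close>

definition plap_integrand :: "real \<Rightarrow> real \<Rightarrow> ('a::euclidean_space \<Rightarrow> real) \<Rightarrow> ('a \<Rightarrow> real) \<Rightarrow> 'a \<times> 'a \<Rightarrow> real" where
  "plap_integrand s p u \<phi> z = plap p (u (fst z) - u (snd z)) * (\<phi> (fst z) - \<phi> (snd z)) / gag_denom s p z"

lemma borel_measurable_plap_integrand:
  assumes "1 < p" and [measurable]: "u \<in> borel_measurable borel" "\<phi> \<in> borel_measurable borel"
  shows "plap_integrand s p u \<phi> \<in> borel_measurable borel"
  unfolding plap_integrand_def using assms(1) by measurable

text \<open>The global integral controls interactions at a distance, the energy over K \<times> K
  those near the diagonal. Both sides of the weak equation then make sense for every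
  \<open>admissible\<close> test function.\<close>

definition locally_regular :: "real \<Rightarrow> real \<Rightarrow> 'a::euclidean_space set \<Rightarrow> ('a \<Rightarrow> real) \<Rightarrow> ('a \<Rightarrow> real) \<Rightarrow> bool" where
  "locally_regular s p \<Omega> F u \<longleftrightarrow> u \<in> borel_measurable borel \<and> F \<in> borel_measurable borel \<and>
     (\<integral>\<^sup>+x. ennreal (\<bar>u x\<bar> powr (p - 1)) \<partial>lborel) < \<infinity> \<and>
     (\<forall>K. compact K \<longrightarrow> K \<subseteq> \<Omega> \<longrightarrow>
        (\<integral>\<^sup>+z. ennreal (indicator (K \<times> K) z * (\<bar>u (fst z) - u (snd z)\<bar> powr p / gag_denom s p z)) \<partial>lborel) < \<infinity> \<and>
        integrable lborel (\<lambda>x. indicator K x * F x))"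

text \<open>Boundedness pairs with the functions that are merely integrable: F on compact sets, and
  the far part of the left-hand side. Finite energy pairs with the local energy of u.\<close>

definition admissible :: "real \<Rightarrow> real \<Rightarrow> 'a::euclidean_space set \<Rightarrow> ('a \<Rightarrow> real) \<Rightarrow> bool" where
  "admissible s p \<Omega> \<phi> \<longleftrightarrow> \<phi> \<in> borel_measurable borel \<and> (\<exists>M. \<forall>x. \<bar>\<phi> x\<bar> \<le> M) \<and>
     (\<exists>K. compact K \<and> K \<subseteq> \<Omega> \<and> (\<forall>x. x \<notin> K \<longrightarrow> \<phi> x = 0)) \<and> gag_energy s p \<phi> < \<infinity>"

definition weak_eq :: "real \<Rightarrow> real \<Rightarrow> ('a::euclidean_space \<Rightarrow> real) \<Rightarrow> ('a \<Rightarrow> real) \<Rightarrow> ('a \<Rightarrow> real) \<Rightarrow> bool" where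
  "weak_eq s p F u \<phi> \<longleftrightarrow> has_bochner_integral lborel (plap_integrand s p u \<phi>) (LINT x|lborel. F x * \<phi> x)"

text \<open>
  The defect of the weak equation for the translates of \<open>\<phi>\<close> is a function of the translation vector
  that is continuous at 0. Its average against a bump is the defect for a mollification of \<open>\<phi>\<close>, by
  Fubini's theorem, so it vanishes for all small bumps.
\<close>

lemma weak_eq_extend:
  fixes u F \<phi> :: "'a::euclidean_space \<Rightarrow> real"
  assumes p: "1 < p" and s: "0 < s" and \<Omega>: "open \<Omega>"
    and reg: "locally_regular s p \<Omega> F u"
    and test: "\<And>\<phi>. test_function \<Omega> \<phi> \<Longrightarrow> weak_eq s p F u \<phi>"
    and \<phi>: "admissible s p \<Omega> \<phi>"
  shows "weak_eq s p F u \<phi>"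
proof -
  have [measurable]: "u \<in> borel_measurable borel" "F \<in> borel_measurable borel"
    and \<phi>m[measurable]: "\<phi> \<in> borel_measurable borel"
    and u1: "(\<integral>\<^sup>+x. ennreal (\<bar>u x\<bar> powr (p - 1)) \<partial>lborel) < \<infinity>" and gag_energy: "gag_energy s p \<phi> < \<infinity>"
    using reg \<phi> by (auto simp: locally_regular_def admissible_def)
  obtain M K where M: "\<And>x. \<bar>\<phi> x\<bar> \<le> M" and K: "compact K" "K \<subseteq> \<Omega>" "\<And>x. x \<notin> K \<Longrightarrow> \<phi> x = 0"
    using \<phi> unfolding admissible_def by metis
  have M0: "0 \<le> M" using M[of 0] by linarith
  obtain d2 where d2: "d2 > 0" "(\<Union>x\<in>K. cball x d2) \<subseteq> \<Omega>"
    using compact_subset_open_imp_cball_epsilon_subset[OF K(1) \<Omega> K(2)] by blast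
  \<comment> \<open>A point of the translated support is within d of \<open>K\<close>, and a partner
    closer than d to it is still within d2.\<close>
  define d where "d = d2 / 2"
  have d: "d > 0" using d2 by (simp add: d_def)
  define K2 where "K2 = {x + y | x y. x \<in> K \<and> y \<in> cball 0 d2}"
  have K2: "compact K2" unfolding K2_def by (intro compact_sums K compact_cball)
  have K2\<Omega>: "K2 \<subseteq> \<Omega>"
  proof
    fix z assume "z \<in> K2"
    then obtain x y where xy: "z = x + y" "x \<in> K" "norm y \<le> d2" by (auto simp: K2_def)
    then have "z \<in> cball x d2" by (simp add: dist_norm)
    then show "z \<in> \<Omega>" using d2(2) xy(2) by blast
  qed
  have inK2: "z \<in> K2" if "x \<in> K" "norm (z - x) \<le> d2" for x z
    unfolding K2_def using that by (intro CollectI exI[of _ x] exI[of _ "z - x"]) auto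
  have [measurable]: "K2 \<in> sets borel" by (rule borel_compact[OF K2])
  define Q where "Q = (\<lambda>z. indicator (K2 \<times> K2) z * (\<bar>u (fst z) - u (snd z)\<bar> powr p / gag_denom s p z))"
  have Qind: "indicator (K2 \<times> K2) z = (indicator K2 (fst z) * indicator K2 (snd z) :: real)" for z
    by (cases z) (auto simp: indicator_def)
  have [measurable]: "Q \<in> borel_measurable borel" unfolding Q_def Qind by measurable
  have Q0: "Q z \<ge> 0" for z using gag_denom_nonneg[of s p z] by (simp add: Q_def)
  have Qfin: "(\<integral>\<^sup>+z. ennreal (Q z) \<partial>lborel) < \<infinity>" and F2: "integrable lborel (\<lambda>x. indicator K2 x * F x)"
    using reg K2 K2\<Omega> unfolding locally_regular_def Q_def by blast+
  define far where "far z = (indicator {z. d \<le> norm (fst z - snd z)} z :: real)" for z :: "'a \<times> 'a"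
  have [measurable]: "far \<in> borel_measurable borel" unfolding far_def by measurable
  \<comment> \<open>The coefficient of the test function away from the diagonal. It is integrable
    because u is in L^(p - 1), so it can be paired with any bounded function.\<close>
  define G where "G z = plap p (u (fst z) - u (snd z)) * (far z / gag_denom s p z)" for z
  have [measurable]: "G \<in> borel_measurable borel" unfolding G_def using p by measurable
  have G: "integrable lborel G"
    unfolding integrable_iff_bounded
  proof
    let ?g = "\<lambda>x. \<bar>u x\<bar> powr (p - 1)"
    let ?c = "2 powr (p - 1)"
    have "(\<integral>\<^sup>+z. ennreal (norm (G z)) \<partial>lborel) \<le> (\<integral>\<^sup>+z. ennreal ?c * (ennreal (?g (fst z)) * ennreal (far z / gag_denom s p z)
        + ennreal (?g (snd z)) * ennreal (far z / gag_denom s p z)) \<partial>lborel)"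
    proof (intro nn_integral_mono)
      fix z
      have f0: "0 \<le> far z / gag_denom s p z" using gag_denom_nonneg[of s p z] by (simp add: far_def)
      have "norm (G z) = \<bar>u (fst z) - u (snd z)\<bar> powr (p - 1) * (far z / gag_denom s p z)"
        unfolding G_def using f0 by (simp only: real_norm_def abs_mult abs_plap abs_of_nonneg)
      also have "\<dots> \<le> (?c * (?g (fst z) + ?g (snd z))) * (far z / gag_denom s p z)"
        using powr_add_le[of "p - 1" "u (fst z)" "- u (snd z)"] p f0 by (intro mult_right_mono) auto
      also have "\<dots> = ?c * (?g (fst z) * (far z / gag_denom s p z) + ?g (snd z) * (far z / gag_denom s p z))"
        by (simp add: algebra_simps)
      finally have "ennreal (norm (G z)) \<le> ennreal (?c * (?g (fst z) * (far z / gag_denom s p z) + ?g (snd z) * (far z / gag_denom s p z)))"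
        by (rule ennreal_leI)
      also have "\<dots> = ennreal ?c * (ennreal (?g (fst z)) * ennreal (far z / gag_denom s p z)
        + ennreal (?g (snd z)) * ennreal (far z / gag_denom s p z))"
        using f0 by (simp del: times_divide_eq_right flip: ennreal_plus ennreal_mult')
      finally show "ennreal (norm (G z)) \<le> \<dots>" .
    qed
    also have "\<dots> = ennreal ?c * ((\<integral>\<^sup>+z. ennreal (?g (fst z)) * ennreal (far z / gag_denom s p z) \<partial>lborel)
        + (\<integral>\<^sup>+z. ennreal (?g (snd z)) * ennreal (far z / gag_denom s p z) \<partial>lborel))"
      by (subst nn_integral_cmult, simp, subst nn_integral_add) auto
    also have "\<dots> < \<infinity>"
      using far_finite[of s p d ?g] s p d u1 unfolding far_def by (auto simp: ennreal_mult_less_top)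
    finally show "(\<integral>\<^sup>+z. ennreal (norm (G z)) \<partial>lborel) < \<infinity>" .
  qed simp
  have near: "fst z \<in> K2 \<and> snd z \<in> K2"
    if f0: "far z = 0" and hd: "norm h \<le> d" and nz: "\<phi> (fst z - h) \<noteq> 0 \<or> \<phi> (snd z - h) \<noteq> 0" for z h
  proof -
    have xy: "norm (fst z - snd z) < d" using f0 by (auto simp: far_def indicator_def split: if_splits)
    obtain x where x: "x \<in> K" "x = fst z - h \<or> x = snd z - h" using nz K(3) by blast
    have "norm (fst z - x) \<le> d2 \<and> norm (snd z - x) \<le> d2"
      using x(2)
    proof
      assume "x = fst z - h"
      then have *: "fst z - x = h" "snd z - x = h - (fst z - snd z)" by (auto simp: algebra_simps)
      show ?thesis unfolding * using xy hd norm_triangle_ineq4[of h "fst z - snd z"] d2(1) by (simp add: d_def)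
    next
      assume "x = snd z - h"
      then have *: "snd z - x = h" "fst z - x = h + (fst z - snd z)" by (auto simp: algebra_simps)
      show ?thesis unfolding * using xy hd norm_triangle_ineq[of h "fst z - snd z"] d2(1) by (simp add: d_def)
    qed
    then show ?thesis using inK2[OF x(1)] by blast
  qed
  define D where "D z = \<phi> (fst z) - \<phi> (snd z)" for z
  have Dm[measurable]: "D \<in> borel_measurable borel" unfolding D_def by measurable
  have DM: "\<bar>D z\<bar> \<le> 2 * M" for z using M[of "fst z"] M[of "snd z"] unfolding D_def by linarith
  \<comment> \<open>The integrand of the weak equation for the translate \<phi>(x - h), with u held
    fixed.\<close>
  define P where "P h z = plap p (u (fst z) - u (snd z)) * D (z - (h, h)) / gag_denom s p z" for h z
  have P0: "P 0 = plap_integrand s p u \<phi>" by (auto simp: P_def plap_integrand_def D_def zero_prod_def[symmetric])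
  have far01: "far z = 0 \<or> far z = 1" for z by (simp add: far_def indicator_def)
  have Pm: "(\<lambda>x. P (fst x) (snd x)) \<in> borel_measurable (borel :: ('a \<times> ('a \<times> 'a)) measure)"
  proof -
    have [measurable]: "fst \<in> (borel :: ('a \<times> ('a \<times> 'a)) measure) \<rightarrow>\<^sub>M borel" "snd \<in> (borel :: ('a \<times> ('a \<times> 'a)) measure) \<rightarrow>\<^sub>M borel"
      by (intro borel_measurable_continuous_onI continuous_intros)+
    have [measurable]: "(\<lambda>x. snd x - (fst x, fst x)) \<in> (borel :: ('a \<times> ('a \<times> 'a)) measure) \<rightarrow>\<^sub>M borel"
      by (intro borel_measurable_continuous_onI continuous_intros)
    show ?thesis unfolding P_def using p by measurable
  qed
  have [measurable]: "P h \<in> borel_measurable borel" for h unfolding P_def using p by measurable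
  define E where "E h z = \<bar>D (z - (h, h))\<bar> powr p / gag_denom s p z" for h z
  have [measurable]: "E h \<in> borel_measurable borel" for h unfolding E_def by measurable
  have E0: "E h z \<ge> 0" for h z using gag_denom_nonneg[of s p z] by (simp add: E_def)
  have Eint: "(\<integral>\<^sup>+z. ennreal (E h z) \<partial>lborel) = gag_energy s p \<phi>" for h
  proof -
    have eq: "E h z = E 0 (z + (- h, - h))" for z
      using gag_denom_translate[of s p z "- h"] by (simp add: E_def zero_prod_def[symmetric] minus_prod_def[symmetric] plus_prod_def minus_prod_def)
    have "(\<integral>\<^sup>+z. ennreal (E h z) \<partial>lborel) = (\<integral>\<^sup>+z. ennreal (E 0 z) \<partial>lborel)"
      unfolding eq by (rule nn_integral_lborel_translation[where f = "\<lambda>z. ennreal (E 0 z)"]) simp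
    also have "\<dots> = gag_energy s p \<phi>" by (simp add: gag_energy_def E_def D_def zero_prod_def[symmetric])
    finally show ?thesis .
  qed
  \<comment> \<open>A majorant whose integral does not depend on h: the far part costs only the
    bound of \<phi>, and near the diagonal Young's inequality separates the local energy of u from
    that of the translated \<phi>, which is invariant.\<close>
  have Pbound: "\<bar>P h z\<bar> \<le> 2 * M * \<bar>G z\<bar> + Q z + E h z" if h: "norm h \<le> d" for h z
  proof -
    consider "far z = 1" | "far z = 0" "D (z - (h, h)) = 0" | "far z = 0" "D (z - (h, h)) \<noteq> 0" using far01 by blast
    then show ?thesis
    proof cases
      case 1
      have "\<bar>P h z\<bar> = \<bar>D (z - (h, h))\<bar> * \<bar>G z\<bar>" by (simp add: P_def G_def 1 abs_mult)
      also have "\<dots> \<le> 2 * M * \<bar>G z\<bar>" by (intro mult_right_mono DM) simp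
      finally show ?thesis using Q0[of z] E0[of h z] by simp
    next
      case 2
      then show ?thesis using M0 Q0[of z] E0[of h z] by (simp add: P_def)
    next
      case 3
      then have "\<phi> (fst z - h) \<noteq> 0 \<or> \<phi> (snd z - h) \<noteq> 0" by (auto simp: D_def)
      then have "z \<in> K2 \<times> K2" using near[OF 3(1) h] by (cases z) auto
      then have Q: "Q z = \<bar>u (fst z) - u (snd z)\<bar> powr p / gag_denom s p z" by (simp add: Q_def)
      have "\<bar>P h z\<bar> = \<bar>u (fst z) - u (snd z)\<bar> powr (p - 1) * \<bar>D (z - (h, h))\<bar> / gag_denom s p z"
        using gag_denom_nonneg[of s p z] by (simp add: P_def abs_mult abs_divide abs_plap)
      also have "\<dots> \<le> (\<bar>u (fst z) - u (snd z)\<bar> powr p + \<bar>D (z - (h, h))\<bar> powr p) / gag_denom s p z"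
        using gag_denom_nonneg[of s p z] powr_mult_le_add[OF p] by (intro divide_right_mono) auto
      also have "\<dots> = Q z + E h z" by (simp add: Q E_def add_divide_distrib)
      finally show ?thesis using M0 by (smt (verit) abs_ge_zero mult_nonneg_nonneg)
    qed
  qed
  define C where "C = enn2real (ennreal (2 * M) * (\<integral>\<^sup>+z. ennreal \<bar>G z\<bar> \<partial>lborel) + (\<integral>\<^sup>+z. ennreal (Q z) \<partial>lborel) + gag_energy s p \<phi>)"
  have Pint: "(\<integral>\<^sup>+z. ennreal \<bar>P h z\<bar> \<partial>lborel) \<le> ennreal C" if h: "norm h \<le> d" for h
  proof -
    have "(\<integral>\<^sup>+z. ennreal \<bar>P h z\<bar> \<partial>lborel) \<le> (\<integral>\<^sup>+z. ennreal (2 * M) * ennreal \<bar>G z\<bar> + ennreal (Q z) + ennreal (E h z) \<partial>lborel)"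
      using Pbound[OF h] M0 Q0 E0 by (intro nn_integral_mono) (simp add: ennreal_leI flip: ennreal_plus ennreal_mult')
    also have "\<dots> = ennreal (2 * M) * (\<integral>\<^sup>+z. ennreal \<bar>G z\<bar> \<partial>lborel) + (\<integral>\<^sup>+z. ennreal (Q z) \<partial>lborel) + gag_energy s p \<phi>"
      by (simp add: nn_integral_add nn_integral_cmult Eint)
    also have "\<dots> = ennreal C"
      using G Qfin gag_energy unfolding C_def
      by (subst ennreal_enn2real) (auto simp: integrable_iff_bounded ennreal_mult_less_top)
    finally show ?thesis .
  qed
  have Pintegrable: "integrable lborel (P h)" if h: "norm h \<le> d" for h
    using Pint[OF h] unfolding integrable_iff_bounded by (auto simp: less_top[symmetric] top_unique)
  \<comment> \<open>For norm h \<le> d the indicator changes nothing, since the translated support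
    stays in \<open>K2\<close>; it makes the coefficient of \<phi> integrable over the whole
    space.\<close>
  define R where "R h x = indicator K2 x * F x * \<phi> (x - h)" for h x
  define c where "c h = (LINT z|lborel. P h z) - (LINT x|lborel. R h x)" for h
  have cont: "\<exists>r>0. \<forall>h. norm h < r \<longrightarrow> \<bar>c h - c 0\<bar> \<le> e" if e: "e > 0" for e
  proof -
    have e3: "e / 3 > 0" using e by simp
    obtain r1 where r1: "r1 > 0" "\<And>h. norm h < r1 \<Longrightarrow> \<bar>(LINT x|lborel. R h x) - (LINT x|lborel. R 0 x)\<bar> \<le> e / 3"
      using translate_bounded_weakly_continuous[OF F2 \<phi>m M e3] unfolding R_def by auto
    obtain r2 where r2: "r2 > 0" "\<And>h. norm h < r2 \<Longrightarrow> \<bar>(LINT z|lborel. G z * D (z - h)) - (LINT z|lborel. G z * D z)\<bar> \<le> e / 3"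
      using translate_bounded_weakly_continuous[OF G Dm DM e3] by blast
    define q where "q = enn2real (\<integral>\<^sup>+z. ennreal (Q z) \<partial>lborel)"
    have q: "q \<ge> 0" "(\<integral>\<^sup>+z. ennreal (Q z) \<partial>lborel) = ennreal q" using Qfin by (auto simp: q_def)
    have e6: "e / (6 * (q + 1)) > 0" using e q by simp
    obtain C1 where C1: "C1 > 0" "\<And>x y. x \<ge> 0 \<Longrightarrow> y \<ge> 0 \<Longrightarrow> 1 * (x powr (p - 1) * y) \<le> e / (6 * (q + 1)) * x powr p + C1 * y powr p"
      using powr_mult_le_eps[OF p e6 zero_less_one] by metis
    have "e / (6 * C1) > 0" using e C1 by simp
    then obtain r3 where r3: "r3 > 0" "\<And>h. norm h < r3 \<Longrightarrow> gag_energy s p (\<lambda>x. \<phi> (x + h) - \<phi> x) \<le> ennreal (e / (6 * C1))"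
      using gag_energy_translation_continuous[OF p _ gag_energy] by auto
    have "\<bar>c h - c 0\<bar> \<le> e" if h: "norm h < min d (min r1 (min (r2 / 2) r3))" for h
    proof -
      have hd: "norm h \<le> d" using h by simp
      have "norm (h, h) \<le> norm h + norm h" by (rule norm_Pair_le)
      then have hh: "norm (h, h) < r2" using h by simp
      have Gint: "integrable lborel (\<lambda>z. G z * D (z - (h, h)))" "integrable lborel (\<lambda>z. G z * D z)"
        using integrable_mult_bounded[OF G, of "\<lambda>z. D (z - (h, h))" "2 * M"] integrable_mult_bounded[OF G Dm DM] DM by auto
      \<comment> \<open>The change of the integrand near the diagonal, the far part having been
        subtracted. Young's inequality puts the small factor on the fixed local energy of u and the
        large one on the energy of the translation difference of \<phi>, which tends to 0 with
        h.\<close>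
      define N where "N z = P h z - P 0 z - (G z * D (z - (h, h)) - G z * D z)" for z
      have Nint: "integrable lborel N"
        unfolding N_def using Pintegrable[OF hd] Pintegrable[of 0] d Gint by auto
      have [measurable]: "N \<in> borel_measurable borel" using Nint by auto
      define S where "S z = \<bar>D (z - (h, h)) - D z\<bar> powr p / gag_denom s p z" for z
      have [measurable]: "S \<in> borel_measurable borel" unfolding S_def by measurable
      have S0: "S z \<ge> 0" for z using gag_denom_nonneg[of s p z] by (simp add: S_def)
      have Nb: "\<bar>N z\<bar> \<le> e / (6 * (q + 1)) * Q z + C1 * S z" for z
      proof -
        have N: "N z = (1 - far z) * (plap p (u (fst z) - u (snd z)) * (D (z - (h, h)) - D z) / gag_denom s p z)"
          by (simp add: N_def P_def G_def algebra_simps diff_divide_distrib zero_prod_def[symmetric])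
        consider "far z = 1 \<or> D (z - (h, h)) - D z = 0" | "far z = 0" "D (z - (h, h)) - D z \<noteq> 0" using far01 by blast
        then show ?thesis
        proof cases
          case 1
          then have "N z = 0" by (auto simp: N)
          then show ?thesis using e6 Q0[of z] C1(1) S0[of z] by (simp add: add_nonneg_nonneg less_imp_le del: divide_const_simps times_divide_eq_left)
        next
          case 2
          then have "(\<phi> (fst z - h) \<noteq> 0 \<or> \<phi> (snd z - h) \<noteq> 0) \<or> (\<phi> (fst z - 0) \<noteq> 0 \<or> \<phi> (snd z - 0) \<noteq> 0)" by (auto simp: D_def)
          then have "z \<in> K2 \<times> K2" using near[OF 2(1) hd] near[OF 2(1), of 0] d by (cases z) auto
          then have Q: "Q z = \<bar>u (fst z) - u (snd z)\<bar> powr p / gag_denom s p z" by (simp add: Q_def)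
          have "\<bar>N z\<bar> = (\<bar>u (fst z) - u (snd z)\<bar> powr (p - 1) * \<bar>D (z - (h, h)) - D z\<bar>) / gag_denom s p z"
            using gag_denom_nonneg[of s p z] 2 by (simp add: N abs_mult abs_divide abs_plap)
          also have "\<dots> \<le> (e / (6 * (q + 1)) * \<bar>u (fst z) - u (snd z)\<bar> powr p + C1 * \<bar>D (z - (h, h)) - D z\<bar> powr p) / gag_denom s p z"
            using gag_denom_nonneg[of s p z] C1(2)[of "\<bar>u (fst z) - u (snd z)\<bar>" "\<bar>D (z - (h, h)) - D z\<bar>"] by (intro divide_right_mono) auto
          also have "\<dots> = e / (6 * (q + 1)) * Q z + C1 * S z" unfolding Q S_def by (simp add: add_divide_distrib)
          finally show ?thesis .
        qed
      qed
      have Sgag: "(\<integral>\<^sup>+z. ennreal (S z) \<partial>lborel) \<le> ennreal (e / (6 * C1))"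
      proof -
        have "(\<integral>\<^sup>+z. ennreal (S z) \<partial>lborel) = gag_energy s p (\<lambda>x. \<phi> (x + (- h)) - \<phi> x)"
          unfolding gag_energy_def S_def D_def by (intro nn_integral_cong) (simp add: algebra_simps)
        then show ?thesis using r3(2)[of "- h"] h by simp
      qed
      have "(\<integral>\<^sup>+z. ennreal \<bar>N z\<bar> \<partial>lborel) \<le> (\<integral>\<^sup>+z. ennreal (e / (6 * (q + 1))) * ennreal (Q z) + ennreal C1 * ennreal (S z) \<partial>lborel)"
      proof (intro nn_integral_mono)
        fix z
        have "ennreal \<bar>N z\<bar> \<le> ennreal (e / (6 * (q + 1)) * Q z + C1 * S z)" by (rule ennreal_leI[OF Nb])
        also have "\<dots> = ennreal (e / (6 * (q + 1))) * ennreal (Q z) + ennreal C1 * ennreal (S z)"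
          using e6 C1(1) Q0[of z] S0[of z]
          by (subst ennreal_plus) (auto simp: ennreal_mult' simp del: divide_const_simps times_divide_eq_left)
        finally show "ennreal \<bar>N z\<bar> \<le> \<dots>" .
      qed
      also have "\<dots> = ennreal (e / (6 * (q + 1))) * ennreal q + ennreal C1 * (\<integral>\<^sup>+z. ennreal (S z) \<partial>lborel)"
        by (simp add: nn_integral_add nn_integral_cmult q)
      also have "\<dots> \<le> ennreal (e / (6 * (q + 1))) * ennreal q + ennreal C1 * ennreal (e / (6 * C1))"
        by (intro add_left_mono mult_left_mono Sgag) auto
      also have "\<dots> = ennreal (e / (6 * (q + 1)) * q + C1 * (e / (6 * C1)))"
        using e q C1(1) e6 by (subst ennreal_plus) (auto simp: ennreal_mult' simp del: divide_const_simps times_divide_eq_left times_divide_eq_right)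
      also have "\<dots> \<le> ennreal (e / 3)"
      proof (rule ennreal_leI)
        have "e / (6 * (q + 1)) * q \<le> e / 6" using e q by (simp add: field_simps)
        moreover have "C1 * (e / (6 * C1)) = e / 6" using C1 by simp
        ultimately show "e / (6 * (q + 1)) * q + C1 * (e / (6 * C1)) \<le> e / 3" by linarith
      qed
      finally have "enn2real (\<integral>\<^sup>+z. ennreal \<bar>N z\<bar> \<partial>lborel) \<le> e / 3"
        by (rule enn2real_leI[OF less_imp_le[OF e3]])
      then have "(LINT z|lborel. \<bar>N z\<bar>) \<le> e / 3"
        by (subst integral_eq_nn_integral) auto
      then have Nl: "\<bar>LINT z|lborel. N z\<bar> \<le> e / 3"
        using integral_abs_bound[of lborel N] by linarith
      have "(LINT z|lborel. N z) = (LINT z|lborel. P h z) - (LINT z|lborel. P 0 z)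
         - ((LINT z|lborel. G z * D (z - (h, h))) - (LINT z|lborel. G z * D z))"
        unfolding N_def using Pintegrable[OF hd] Pintegrable[of 0] d Gint by simp
      then show ?thesis
        using Nl r1(2)[of h] r2(2)[OF hh] h unfolding c_def by linarith
    qed
    then show ?thesis using d r1 r2 r3 by (intro exI[of _ "min d (min r1 (min (r2 / 2) r3))"]) auto
  qed
  have \<phi>int: "integrable lborel \<phi>"
    using M K(3) emeasure_bounded_finite[OF compact_imp_bounded[OF K(1)]]
    by (intro integrableI_bounded_set[where A = K and B = M]) (auto simp: borel_compact[OF K(1)])
  \<comment> \<open>After exchanging integrals, this average is the defect of the equation for
    \<open>convolution (bump r) \<phi>\<close>, which is a genuine test function as long as r \<le>
    d.\<close>
  have avg: "integrable lborel (\<lambda>h. bump r h * c h)" "(LINT h|lborel. bump r h * c h) = 0" if r: "0 < r" "r \<le> d" for r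
  proof -
    note bi = bump_integrable[OF r(1), where 'a='a]
    have supp: "norm h \<le> d" if "bump r h \<noteq> 0" for h :: 'a
      using bump_zero[OF r(1), of h] that r(2) by (cases "norm h \<ge> r") auto
    have convh: "convolution (bump r) \<phi> x = (LINT h|lborel. bump r h * \<phi> (x - h))" for x
    proof -
      have "convolution (bump r) \<phi> x = (LINT y|lborel. bump r (x - y) * \<phi> (x - (x - y)))"
        by (simp add: convolution_def)
      also have "\<dots> = (LINT h|lborel. bump r h * \<phi> (x - h))"
        using bi by (intro integral_lborel_reflection[where f = "\<lambda>h. bump r h * \<phi> (x - h)"]) auto
      finally show ?thesis .
    qed
    have hint: "integrable lborel (\<lambda>h. bump r h * \<phi> (x - h))" for x
      using integrable_mult_bounded[OF bi, of "\<lambda>h. \<phi> (x - h)" M] M by auto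
    let ?P = "\<lambda>x. P (fst x) (snd x)"
    have 1: "integrable lborel (\<lambda>h. bump r h * (LINT z|lborel. P h z))"
      "(LINT z|lborel. LINT h|lborel. bump r h * P h z) = (LINT h|lborel. bump r h * (LINT z|lborel. P h z))"
      using weighted_Fubini[of ?P "bump r" C] Pm bi bump_nonneg Pint supp by auto
    have Rm: "(\<lambda>x. R (fst x) (snd x)) \<in> borel_measurable (borel :: ('a \<times> 'a) measure)"
      unfolding R_def by measurable
    have Rint: "(\<integral>\<^sup>+x. ennreal \<bar>R h x\<bar> \<partial>lborel) \<le> ennreal (M * (LINT x|lborel. \<bar>indicator K2 x * F x\<bar>))" for h
    proof -
      have "(\<integral>\<^sup>+x. ennreal \<bar>R h x\<bar> \<partial>lborel) \<le> (\<integral>\<^sup>+x. ennreal (M * \<bar>indicator K2 x * F x\<bar>) \<partial>lborel)"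
        using M by (intro nn_integral_mono ennreal_leI) (auto simp: R_def abs_mult mult.commute[of M] intro!: mult_left_mono)
      also have "\<dots> = ennreal (LINT x|lborel. M * \<bar>indicator K2 x * F x\<bar>)"
        using F2 M0 by (intro nn_integral_eq_integral) auto
      finally show ?thesis by simp
    qed
    have 2: "integrable lborel (\<lambda>h. bump r h * (LINT x|lborel. R h x))"
      "(LINT x|lborel. LINT h|lborel. bump r h * R h x) = (LINT h|lborel. bump r h * (LINT x|lborel. R h x))"
      using weighted_Fubini[of "\<lambda>x. R (fst x) (snd x)" "bump r" "M * (LINT x|lborel. \<bar>indicator K2 x * F x\<bar>)"] Rm bi bump_nonneg Rint by auto
    show "integrable lborel (\<lambda>h. bump r h * c h)"
      using 1(1) 2(1) by (simp add: c_def right_diff_distrib)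
    have "{x + y | x y. x \<in> K \<and> y \<in> cball 0 r} \<subseteq> K2"
      using inK2 r by (auto simp: d_def)
    then have "test_function \<Omega> (convolution (bump r) \<phi>)"
      using K2\<Omega> by (intro test_function_conv[OF r(1) \<phi>int K(1) K(3)]) auto
    then have eq: "(LINT z|lborel. plap_integrand s p u (convolution (bump r) \<phi>) z) = (LINT x|lborel. F x * convolution (bump r) \<phi> x)"
      using test unfolding weak_eq_def by (blast dest: has_bochner_integral_integral_eq)
    have "plap_integrand s p u (convolution (bump r) \<phi>) z = (LINT h|lborel. bump r h * P h z)" for z
    proof -
      have "(LINT h|lborel. bump r h * P h z) = (LINT h|lborel. (plap p (u (fst z) - u (snd z)) / gag_denom s p z) *
         (bump r h * \<phi> (fst z - h) - bump r h * \<phi> (snd z - h)))"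
        by (intro Bochner_Integration.integral_cong) (auto simp: P_def D_def algebra_simps diff_divide_distrib add_divide_distrib)
      also have "\<dots> = (plap p (u (fst z) - u (snd z)) / gag_denom s p z) * (convolution (bump r) \<phi> (fst z) - convolution (bump r) \<phi> (snd z))"
        using hint by (simp add: convh)
      finally show ?thesis by (simp add: plap_integrand_def)
    qed
    moreover have "F x * convolution (bump r) \<phi> x = (LINT h|lborel. bump r h * R h x)" for x
    proof -
      have "bump r h * R h x = F x * (bump r h * \<phi> (x - h))" for h
      proof (cases "bump r h * \<phi> (x - h) = 0")
        case False
        then have "x - h \<in> K" "norm h \<le> d" using K(3) supp by auto
        then have "x \<in> K2" using inK2[of "x - h" x] d2 by (auto simp: d_def)
        then show ?thesis by (simp add: R_def)
      qed (auto simp: R_def)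
      then have "(\<lambda>h. bump r h * R h x) = (\<lambda>h. F x * (bump r h * \<phi> (x - h)))" by blast
      then show ?thesis unfolding convh by simp
    qed
    ultimately have "(LINT h|lborel. bump r h * (LINT z|lborel. P h z)) = (LINT h|lborel. bump r h * (LINT x|lborel. R h x))"
      using eq 1(2) 2(2) by simp
    then show "(LINT h|lborel. bump r h * c h) = 0"
      using 1(1) 2(1) by (simp add: c_def right_diff_distrib)
  qed
  have "c 0 = 0"
  proof (rule ccontr)
    assume c0: "c 0 \<noteq> 0"
    then obtain r where r: "r > 0" "\<And>h. norm h < r \<Longrightarrow> \<bar>c h - c 0\<bar> \<le> \<bar>c 0\<bar> / 2"
      using cont[of "\<bar>c 0\<bar> / 2"] by auto
    define t where "t = min r d"
    have t: "0 < t" "t \<le> d" "t \<le> r" using r d by (auto simp: t_def)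
    note bi = bump_integrable[OF t(1), where 'a='a]
    \<comment> \<open>As the average of c vanishes, that of c h - c 0 equals - c 0 times the mass of
      the bump, whereas continuity allows at most half of this in absolute value.\<close>
    have "(LINT h|lborel. bump t h * (c h - c 0)) = (LINT h|lborel. bump t h * c h) - (LINT h|lborel. bump t (h::'a) * c 0)"
      using avg(1)[OF t(1,2)] bi by (simp add: right_diff_distrib)
    then have "(LINT h|lborel. bump t h * (c h - c 0)) = - (c 0 * (LINT h|lborel. bump t (h::'a)))"
      using avg(2)[OF t(1,2)] by simp
    then have "\<bar>c 0\<bar> * (LINT h|lborel. bump t (h::'a)) = \<bar>LINT h|lborel. bump t h * (c h - c 0)\<bar>"
      using bump_integral_pos[OF t(1), where 'a='a] by (simp add: abs_mult)
    also have "\<dots> \<le> (LINT h|lborel. bump t (h::'a) * (\<bar>c 0\<bar> / 2))"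
    proof (rule integral_abs_bound[THEN order_trans], rule integral_mono)
      show "\<bar>bump t h * (c h - c 0)\<bar> \<le> bump t h * (\<bar>c 0\<bar> / 2)" for h
      proof (cases "norm h < t")
        case True
        then have "\<bar>c h - c 0\<bar> \<le> \<bar>c 0\<bar> / 2" using r(2)[of h] t by simp
        then show ?thesis
          unfolding abs_mult abs_of_nonneg[OF bump_nonneg] by (intro mult_left_mono bump_nonneg)
      qed (use bump_zero[OF t(1), of h] in auto)
    qed (use avg(1)[OF t(1,2)] bi in \<open>auto simp: right_diff_distrib\<close>)
    also have "\<dots> = \<bar>c 0\<bar> / 2 * (LINT h|lborel. bump t (h::'a))" by simp
    finally show False using c0 bump_integral_pos[OF t(1), where 'a='a] by simp
  qed
  moreover have "R 0 x = F x * \<phi> x" for x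
    using inK2[of x x] K(3)[of x] d2 by (cases "x \<in> K") (auto simp: R_def)
  ultimately have "(LINT z|lborel. plap_integrand s p u \<phi> z) = (LINT x|lborel. F x * \<phi> x)"
    by (simp add: c_def P0)
  then show ?thesis
    using Pintegrable[of 0] d unfolding weak_eq_def P0 by (simp add: has_bochner_integral_iff)
qed

subsection \<open>Approximation by compactly supported functions\<close>

definition compactly_supported_in :: "'a::euclidean_space set \<Rightarrow> ('a \<Rightarrow> real) \<Rightarrow> bool" where
  "compactly_supported_in \<Omega> \<eta> \<longleftrightarrow> (\<exists>K. compact K \<and> K \<subseteq> \<Omega> \<and> (\<forall>x. x \<notin> K \<longrightarrow> \<eta> x = 0))"

text \<open>Approximants carry no sign, bound or order here, which makes the notion additive; these
  are restored in \<open>approximable_from_below\<close>.\<close>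

definition approximable :: "real \<Rightarrow> real \<Rightarrow> 'a::euclidean_space set \<Rightarrow> ('a \<Rightarrow> real) \<Rightarrow> bool" where
  "approximable s p \<Omega> w \<longleftrightarrow> (\<forall>e>0. \<exists>\<eta>\<in>borel_measurable borel.
     compactly_supported_in \<Omega> \<eta> \<and> Wsp_norm_p s p (\<lambda>x. \<eta> x - w x) \<le> ennreal e)"

lemma approximable_add:
  assumes p: "0 < p" and v: "approximable s p \<Omega> v" and w: "approximable s p \<Omega> w"
    and [measurable]: "v \<in> borel_measurable borel" "w \<in> borel_measurable borel"
  shows "approximable s p \<Omega> (\<lambda>x. v x + w x)"
  unfolding approximable_def
proof (intro allI impI)
  fix e :: real assume e: "e > 0"
  define e' where "e' = e / (2 * 2 powr p)"
  have e': "e' > 0" using e by (simp add: e'_def)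
  obtain a where a[measurable]: "a \<in> borel_measurable borel" "compactly_supported_in \<Omega> a" "Wsp_norm_p s p (\<lambda>x. a x - v x) \<le> ennreal e'"
    using v e' unfolding approximable_def by blast
  obtain b where b[measurable]: "b \<in> borel_measurable borel" "compactly_supported_in \<Omega> b" "Wsp_norm_p s p (\<lambda>x. b x - w x) \<le> ennreal e'"
    using w e' unfolding approximable_def by blast
  obtain K L where "compact K" "K \<subseteq> \<Omega>" "\<And>x. x \<notin> K \<Longrightarrow> a x = 0" "compact L" "L \<subseteq> \<Omega>" "\<And>x. x \<notin> L \<Longrightarrow> b x = 0"
    using a(2) b(2) unfolding compactly_supported_in_def by metis
  then have "compactly_supported_in \<Omega> (\<lambda>x. a x + b x)"
    unfolding compactly_supported_in_def by (intro exI[of _ "K \<union> L"]) (auto intro: compact_Un)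
  moreover have "Wsp_norm_p s p (\<lambda>x. a x + b x - (v x + w x)) \<le> ennreal e"
  proof -
    have "Wsp_norm_p s p (\<lambda>x. (a x - v x) + (b x - w x)) \<le> ennreal (2 powr p) * (Wsp_norm_p s p (\<lambda>x. a x - v x) + Wsp_norm_p s p (\<lambda>x. b x - w x))"
      using p by (intro Wsp_norm_p_add) auto
    also have "\<dots> \<le> ennreal (2 powr p) * (ennreal e' + ennreal e')"
      using a(3) b(3) by (intro mult_left_mono add_mono) auto
    also have "\<dots> = ennreal e" using e by (simp add: e'_def flip: ennreal_plus ennreal_mult')
    finally show ?thesis by (simp add: algebra_simps)
  qed
  ultimately show "\<exists>\<eta>\<in>borel_measurable borel. compactly_supported_in \<Omega> \<eta> \<and> Wsp_norm_p s p (\<lambda>x. \<eta> x - (v x + w x)) \<le> ennreal e"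
    by (intro bexI[of _ "\<lambda>x. a x + b x"]) auto
qed

definition graph_ball :: "'a::euclidean_space set \<Rightarrow> 'a \<Rightarrow> real \<Rightarrow> bool" where
  "graph_ball \<Omega> c r \<longleftrightarrow> 0 < r \<and> (\<exists>e g. norm e = 1 \<and> continuous_on UNIV g \<and>
        \<Omega> \<inter> ball c r = {x \<in> ball c r. x \<bullet> e > g (x - (x \<bullet> e) *\<^sub>R e)})"

text \<open>A function supported in a boundary chart is pushed into the domain by translating it along the chart direction.\<close>

lemma approximable_graph_ball:
  fixes w :: "'a::euclidean_space \<Rightarrow> real"
  assumes p: "1 < p" and \<Omega>: "bounded \<Omega>" and gb: "graph_ball \<Omega> c r"
    and [measurable]: "w \<in> borel_measurable borel" and fin: "Wsp_norm_p s p w < \<infinity>"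
    and w: "\<And>x. x \<notin> \<Omega> \<Longrightarrow> w x = 0" "\<And>x. x \<notin> cball c (r / 2) \<Longrightarrow> w x = 0"
  shows "approximable s p \<Omega> w"
  unfolding approximable_def
proof (intro allI impI)
  fix \<epsilon> :: real assume \<epsilon>: "\<epsilon> > 0"
  obtain e g where r: "0 < r" and e: "norm e = 1" and g: "continuous_on UNIV g"
    and eq: "\<Omega> \<inter> ball c r = {x \<in> ball c r. x \<bullet> e > g (x - (x \<bullet> e) *\<^sub>R e)}"
    using gb unfolding graph_ball_def by blast
  obtain d where d: "d > 0" "\<And>h. norm h < d \<Longrightarrow> Wsp_norm_p s p (\<lambda>x. w (x + h) - w x) \<le> ennreal \<epsilon>"
    using Wsp_norm_p_translation_continuous[OF p _ fin \<epsilon>] by auto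
  \<comment> \<open>Short enough for the continuity of translations, and for the ball of radius r /
    2 to stay inside the chart when shifted.\<close>
  define t where "t = min d r / 4"
  have t: "0 < t" "t < d" "t < r / 2" using d r by (auto simp: t_def min_def)
  \<comment> \<open>The height above the graph. Moving by t along e raises it by exactly t, so
    points of the closure of the domain, where it is nonnegative by continuity, end strictly above
    the graph.\<close>
  define q where "q x = x \<bullet> e - g (x - (x \<bullet> e) *\<^sub>R e)" for x
  have qc: "continuous_on UNIV q"
    unfolding q_def by (intro continuous_intros continuous_on_compose2[OF g]) auto
  have ee: "e \<bullet> e = 1" using e by (simp add: dot_square_norm)
  have qt: "q (y + t *\<^sub>R e) = q y + t" for y
    by (simp add: q_def inner_add_left ee algebra_simps)
  define K where "K = (\<lambda>y. y + t *\<^sub>R e) ` (closure \<Omega> \<inter> cball c (r / 2))"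
  have "compact K"
    unfolding K_def by (intro compact_continuous_image continuous_intros closed_Int_compact) auto
  moreover have "K \<subseteq> \<Omega>"
  proof
    fix x assume "x \<in> K"
    then obtain y where y: "x = y + t *\<^sub>R e" "y \<in> closure \<Omega>" "y \<in> cball c (r / 2)" by (auto simp: K_def)
    have "y \<in> ball c r" using y(3) r by auto
    then have "y \<in> closure (ball c r \<inter> \<Omega>)"
      using open_Int_closure_subset[OF open_ball, of c r \<Omega>] y(2) by blast
    also have "\<dots> \<subseteq> {x. q x \<ge> 0}"
    proof (rule closure_minimal)
      show "ball c r \<inter> \<Omega> \<subseteq> {x. 0 \<le> q x}"
      proof
        fix x assume "x \<in> ball c r \<inter> \<Omega>"
        then have "x \<in> \<Omega> \<inter> ball c r" by blast
        then show "x \<in> {x. 0 \<le> q x}" unfolding eq by (simp add: q_def)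
      qed
      show "closed {x. 0 \<le> q x}" by (intro closed_Collect_le qc continuous_intros)
    qed
    finally have "q x > 0" using qt[of y] y(1) t by auto
    moreover have "x \<in> ball c r"
    proof -
      have "dist c x \<le> dist c y + dist y x" by (rule dist_triangle)
      also have "dist y x = t" using e t y(1) by (simp add: dist_norm)
      finally show ?thesis using y(3) t by simp
    qed
    ultimately have "x \<in> \<Omega> \<inter> ball c r" unfolding eq by (simp add: q_def)
    then show "x \<in> \<Omega>" by simp
  qed
  moreover have "w (x + - (t *\<^sub>R e)) = 0" if "x \<notin> K" for x
  proof (rule ccontr)
    assume "w (x + - (t *\<^sub>R e)) \<noteq> 0"
    then have "x - t *\<^sub>R e \<in> closure \<Omega> \<inter> cball c (r / 2)"
      using w[of "x - t *\<^sub>R e"] closure_subset[of \<Omega>] by auto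
    then have "x \<in> K" unfolding K_def by (intro image_eqI[of _ _ "x - t *\<^sub>R e"]) auto
    then show False using that by simp
  qed
  ultimately have "compactly_supported_in \<Omega> (\<lambda>x. w (x + - (t *\<^sub>R e)))"
    unfolding compactly_supported_in_def by blast
  moreover have "Wsp_norm_p s p (\<lambda>x. w (x + - (t *\<^sub>R e)) - w x) \<le> ennreal \<epsilon>"
    using e t by (intro d) simp
  ultimately show "\<exists>\<eta>\<in>borel_measurable borel. compactly_supported_in \<Omega> \<eta> \<and> Wsp_norm_p s p (\<lambda>x. \<eta> x - w x) \<le> ennreal \<epsilon>"
    by (intro bexI[of _ "\<lambda>x. w (x + - (t *\<^sub>R e))"]) auto
qed

text \<open>A partition of unity built one chart at a time. The cut-off z splits w into a part
  supported in the current chart and a remainder that vanishes on the quarter ball; \<open>V\<close>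
  collects the region where the remainder already vanishes.\<close>

lemma approximable_graph_cover:
  fixes w :: "'a::euclidean_space \<Rightarrow> real"
  assumes p: "1 < p" and s: "0 < s" "s < 1" and \<Omega>: "bounded \<Omega>"
    and "finite I" "\<And>c r. (c, r) \<in> I \<Longrightarrow> graph_ball \<Omega> c r"
    and "open V" "frontier \<Omega> \<subseteq> V \<union> (\<Union>(c, r)\<in>I. ball c (r / 4))"
    and "w \<in> borel_measurable borel" "Wsp_norm_p s p w < \<infinity>"
    and "\<And>x. x \<notin> \<Omega> \<Longrightarrow> w x = 0" "\<And>x. x \<in> V \<Longrightarrow> w x = 0"
  shows "approximable s p \<Omega> w"
  using assms(5-)
proof (induction I arbitrary: V w rule: finite_induct)
  case empty
  \<comment> \<open>With no chart left, \<open>V\<close> contains the whole boundary, so w has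
    compact support in the domain and approximates itself.\<close>
  have "compact (closure \<Omega> - V)" using \<Omega> \<open>open V\<close> by (intro compact_diff) auto
  moreover have "closure \<Omega> - V \<subseteq> \<Omega>"
    using empty(3) by (auto simp: frontier_def interior_open dest: interior_subset[THEN subsetD])
  moreover have "w x = 0" if "x \<notin> closure \<Omega> - V" for x
    using that empty closure_subset[of \<Omega>] by blast
  ultimately have "compactly_supported_in \<Omega> w"
    unfolding compactly_supported_in_def by blast
  then show ?case
    unfolding approximable_def using empty(4)
    by (intro allI impI bexI[of _ w]) (auto simp: Wsp_norm_p_def gag_energy_def)
next
  case (insert i I)
  obtain c r where i: "i = (c, r)" by (cases i)
  have gb: "graph_ball \<Omega> c r" using insert.prems(1) i by auto
  then have r: "0 < r" by (simp add: graph_ball_def)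
  note [measurable] = insert.prems(4)
  \<comment> \<open>Equal to 1 on the ball of radius r / 4, which is used for covering, and to 0
    outside radius r / 2, as \<open>approximable_graph_ball\<close> requires.\<close>
  define z where "z x = max 0 (min 1 (2 - 4 / r * dist x c))" for x
  have [measurable]: "z \<in> borel_measurable borel" unfolding z_def by measurable
  have z01: "0 \<le> z x" "z x \<le> 1" for x by (auto simp: z_def)
  have zL: "\<bar>z x - z y\<bar> \<le> 4 / r * norm (x - y)" for x y
  proof -
    have "\<bar>z x - z y\<bar> \<le> \<bar>4 / r * dist x c - 4 / r * dist y c\<bar>" by (auto simp: z_def)
    also have "\<dots> = 4 / r * \<bar>dist x c - dist y c\<bar>"
      unfolding right_diff_distrib[symmetric] abs_mult using r by simp
    also have "\<dots> \<le> 4 / r * norm (x - y)"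
      using r abs_dist_diff_le[of x c y] by (intro mult_left_mono) (auto simp: dist_norm norm_minus_commute[of c y])
    finally show ?thesis .
  qed
  have z1: "z x = 1" if "x \<in> ball c (r / 4)" for x
  proof -
    have "4 / r * dist x c < 1" using that r by (simp add: field_simps dist_commute)
    then show ?thesis by (simp add: z_def)
  qed
  have z0: "z x = 0" if "x \<notin> cball c (r / 2)" for x
  proof -
    have "4 / r * dist x c > 2" using that r by (simp add: field_simps dist_commute)
    then show ?thesis by (simp add: z_def)
  qed
  have "approximable s p \<Omega> (\<lambda>x. z x * w x)"
  proof (rule approximable_graph_ball[OF p \<Omega> gb])
    show "Wsp_norm_p s p (\<lambda>x. z x * w x) < \<infinity>"
      using r by (intro Wsp_norm_p_cutoff_finite[OF p s _ _ insert.prems(5) z01 _ zL]) auto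
  qed (use insert.prems z0 in auto)
  moreover have "approximable s p \<Omega> (\<lambda>x. (1 - z x) * w x)"
  proof (rule insert.IH[of "V \<union> ball c (r / 4)"])
    show "Wsp_norm_p s p (\<lambda>x. (1 - z x) * w x) < \<infinity>"
      using r zL z01 by (intro Wsp_norm_p_cutoff_finite[OF p s _ _ insert.prems(5), where L = "4 / r"]) (auto simp: abs_minus_commute)
  qed (use insert.prems z1 i in auto)
  ultimately have "approximable s p \<Omega> (\<lambda>x. z x * w x + (1 - z x) * w x)"
    using p by (intro approximable_add) auto
  then show ?case by (simp add: algebra_simps)
qed

lemma smooth_bounded_domain_approximable:
  fixes w :: "'a::euclidean_space \<Rightarrow> real"
  assumes p: "1 < p" and s: "0 < s" "s < 1" and \<Omega>: "smooth_bounded_domain \<Omega>"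
    and w: "w \<in> borel_measurable borel" "Wsp_norm_p s p w < \<infinity>" "\<And>x. x \<notin> \<Omega> \<Longrightarrow> w x = 0"
  shows "approximable s p \<Omega> w"
proof -
  have bd: "bounded \<Omega>" and sb: "smooth_boundary \<Omega>" using \<Omega> by (auto simp: smooth_bounded_domain_def)
  have "\<forall>c\<in>frontier \<Omega>. \<exists>r. graph_ball \<Omega> c r"
  proof
    fix c assume "c \<in> frontier \<Omega>"
    then obtain r e g where "r > 0" "norm e = 1" "smooth g"
        "\<Omega> \<inter> ball c r = {x \<in> ball c r. x \<bullet> e > g (x - (x \<bullet> e) *\<^sub>R e)}"
      using sb unfolding smooth_boundary_def by blast
    moreover from \<open>smooth g\<close> have "Ck 0 g" unfolding smooth_def by blast
    ultimately show "\<exists>r. graph_ball \<Omega> c r" unfolding graph_ball_def by auto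
  qed
  then obtain R where R: "\<And>c. c \<in> frontier \<Omega> \<Longrightarrow> graph_ball \<Omega> c (R c)" by metis
  have "compact (frontier \<Omega>)" using bd by (rule compact_frontier_bounded)
  then obtain C where C: "C \<subseteq> frontier \<Omega>" "finite C" "frontier \<Omega> \<subseteq> (\<Union>c\<in>C. ball c (R c / 4))"
  proof (rule compactE_image)
    show "frontier \<Omega> \<subseteq> (\<Union>c\<in>frontier \<Omega>. ball c (R c / 4))"
      using R by (force simp: graph_ball_def)
  qed auto
  show ?thesis
  proof (rule approximable_graph_cover[OF p s bd, of "(\<lambda>c. (c, R c)) ` C" "{}"])
    show "frontier \<Omega> \<subseteq> {} \<union> (\<Union>(c, r)\<in>(\<lambda>c. (c, R c)) ` C. ball c (r / 4))"
      using C(3) by auto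
  qed (use C R w in auto)
qed

section \<open>Approximation from below\<close>

text \<open>The series of the p-th powers has a finite integral, so it converges almost everywhere
  and its terms tend to 0. Prescribing the rate (1 / 2)^n spares the passage to
  subsequences.\<close>

lemma Lp_fast_convergence_AE:
  fixes g :: "nat \<Rightarrow> 'a::euclidean_space \<Rightarrow> real"
  assumes p: "0 < p" and [measurable]: "\<And>n. g n \<in> borel_measurable borel"
    and g: "\<And>n. (\<integral>\<^sup>+x. ennreal (\<bar>g n x\<bar> powr p) \<partial>lborel) \<le> ennreal ((1 / 2) ^ n)"
  shows "AE x in lborel. (\<lambda>n. g n x) \<longlonglongrightarrow> 0"
proof -
  have "(\<integral>\<^sup>+x. (\<Sum>n. ennreal (\<bar>g n x\<bar> powr p)) \<partial>lborel) = (\<Sum>n. \<integral>\<^sup>+x. ennreal (\<bar>g n x\<bar> powr p) \<partial>lborel)"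
    by (intro nn_integral_suminf) auto
  also have "\<dots> \<le> (\<Sum>n. ennreal ((1 / 2) ^ n))"
    by (intro suminf_le g) auto
  also have "\<dots> < \<infinity>"
    by (subst suminf_ennreal2) (auto intro: summable_geometric)
  finally have "AE x in lborel. (\<Sum>n. ennreal (\<bar>g n x\<bar> powr p)) \<noteq> \<infinity>"
    by (intro nn_integral_noteq_infinite) auto
  then show ?thesis
  proof eventually_elim
    case (elim x)
    then have "summable (\<lambda>n. \<bar>g n x\<bar> powr p)"
      by (intro summable_suminf_not_top) auto
    then have "(\<lambda>n. \<bar>g n x\<bar> powr p) \<longlonglongrightarrow> 0" by (rule summable_LIMSEQ_zero)
    then have "(\<lambda>n. (\<bar>g n x\<bar> powr p) powr (1 / p)) \<longlonglongrightarrow> 0 powr (1 / p)"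
      using p by (intro tendsto_powr') auto
    then have "(\<lambda>n. \<bar>g n x\<bar>) \<longlonglongrightarrow> 0" using p by (simp add: powr_powr)
    then show ?case by (simp add: tendsto_rabs_zero_iff)
  qed
qed

lemma AE_lborel_fst_snd:
  fixes P :: "'a::euclidean_space \<Rightarrow> bool"
  assumes "AE x in lborel. P x"
  shows "AE z in (lborel :: ('a \<times> 'a) measure). P (fst z) \<and> P (snd z)"
proof -
  obtain N where N: "N \<in> null_sets lborel" "{x. \<not> P x} \<subseteq> N"
    using assms by (auto elim!: AE_E simp: null_sets_def)
  then have [measurable]: "N \<in> sets borel" by auto
  have "emeasure (lborel :: ('a \<times> 'a) measure) (N \<times> UNIV) = 0"
    using N by (simp add: lborel_prod[symmetric] lborel.emeasure_pair_measure_Times null_sets_def)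
  moreover have "emeasure (lborel :: ('a \<times> 'a) measure) (UNIV \<times> N) = 0"
    using N by (simp add: lborel_prod[symmetric] lborel.emeasure_pair_measure_Times null_sets_def)
  moreover have "N \<times> UNIV \<in> sets (borel :: ('a \<times> 'a) measure)" "UNIV \<times> N \<in> sets (borel :: ('a \<times> 'a) measure)"
    unfolding borel_prod[symmetric] by measurable
  ultimately have "N \<times> UNIV \<union> UNIV \<times> N \<in> null_sets (lborel :: ('a \<times> 'a) measure)"
    by (intro null_sets.Un) (auto simp: null_sets_def)
  then show ?thesis
    by (rule AE_I') (use N(2) in auto)
qed

text \<open>The excess over n contracts differences, so the energy density of w is a majorant, and
  it vanishes at each point for large n.\<close>

lemma Wsp_norm_p_truncation_tendsto:
  fixes w :: "'a::euclidean_space \<Rightarrow> real"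
  assumes p: "1 < p" and [measurable]: "w \<in> borel_measurable borel" and fin: "Wsp_norm_p s p w < \<infinity>"
  shows "(\<lambda>n. Wsp_norm_p s p (\<lambda>x. w x - min (w x) (real n))) \<longlonglongrightarrow> 0"
proof -
  define g where "g n x = w x - min (w x) (real n)" for n x
  have [measurable]: "g n \<in> borel_measurable borel" for n unfolding g_def by measurable
  have ev: "\<forall>\<^sub>F n in sequentially. g n x = 0" for x
  proof -
    obtain m where m: "w x < real m" using reals_Archimedean2 by blast
    have "g n x = 0" if "n \<ge> m" for n using m that by (auto simp: g_def)
    then show ?thesis by (auto simp: eventually_sequentially)
  qed
  have fin_w: "gag_energy s p w < \<infinity>" "(\<integral>\<^sup>+x. ennreal (\<bar>w x\<bar> powr p) \<partial>lborel) < \<infinity>"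
    using fin by (auto simp: Wsp_norm_p_def)
  have "(\<lambda>n. gag_energy s p (g n)) \<longlonglongrightarrow> (\<integral>\<^sup>+z. 0 \<partial>(lborel :: ('a \<times> 'a) measure))"
    unfolding gag_energy_def
  proof (rule nn_integral_dominated_convergence[where w = "\<lambda>z. ennreal (\<bar>w (fst z) - w (snd z)\<bar> powr p / gag_denom s p z)"])
    show "AE z in lborel. ennreal (\<bar>g n (fst z) - g n (snd z)\<bar> powr p / gag_denom s p z) \<le> ennreal (\<bar>w (fst z) - w (snd z)\<bar> powr p / gag_denom s p z)" for n
      using p gag_denom_nonneg by (intro AE_I2 ennreal_leI divide_right_mono powr_mono2) (auto simp: g_def)
    show "AE z in lborel. (\<lambda>n. ennreal (\<bar>g n (fst z) - g n (snd z)\<bar> powr p / gag_denom s p z)) \<longlonglongrightarrow> 0"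
    proof (intro AE_I2 tendsto_eventually)
      fix z show "\<forall>\<^sub>F n in sequentially. ennreal (\<bar>g n (fst z) - g n (snd z)\<bar> powr p / gag_denom s p z) = 0"
        using ev[of "fst z"] ev[of "snd z"] by eventually_elim simp
    qed
  qed (use fin_w in \<open>auto simp: gag_energy_def\<close>)
  moreover have "(\<lambda>n. \<integral>\<^sup>+x. ennreal (\<bar>g n x\<bar> powr p) \<partial>lborel) \<longlonglongrightarrow> (\<integral>\<^sup>+x. 0 \<partial>(lborel :: 'a measure))"
  proof (rule nn_integral_dominated_convergence[where w = "\<lambda>x. ennreal (\<bar>w x\<bar> powr p)"])
    show "AE x in lborel. ennreal (\<bar>g n x\<bar> powr p) \<le> ennreal (\<bar>w x\<bar> powr p)" for n
      using p by (intro AE_I2 ennreal_leI powr_mono2) (auto simp: g_def)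
    show "AE x in lborel. (\<lambda>n. ennreal (\<bar>g n x\<bar> powr p)) \<longlonglongrightarrow> 0"
    proof (intro AE_I2 tendsto_eventually)
      fix x show "\<forall>\<^sub>F n in sequentially. ennreal (\<bar>g n x\<bar> powr p) = 0"
        using ev[of x] by eventually_elim simp
    qed
  qed (use fin_w in auto)
  ultimately show ?thesis
    unfolding Wsp_norm_p_def g_def[symmetric] using tendsto_add by fastforce
qed

text \<open>The map r \<mapsto> min w r is not a contraction in energy: where w is below r, the
  variation of w appears. That contribution is bounded by \<open>H\<close>, which the energy density
  of w dominates and which tends to 0 almost everywhere together with r.\<close>

lemma Wsp_norm_p_min_tendsto:
  fixes w :: "'a::euclidean_space \<Rightarrow> real" and r :: "nat \<Rightarrow> 'a \<Rightarrow> real"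
  assumes p: "1 < p" and [measurable]: "w \<in> borel_measurable borel" "\<And>n. r n \<in> borel_measurable borel"
    and fin: "Wsp_norm_p s p w < \<infinity>" and w: "\<And>x. 0 \<le> w x" and r: "\<And>n x. 0 \<le> r n x" "\<And>n. Wsp_norm_p s p (r n) \<le> ennreal ((1 / 2) ^ n)"
  shows "(\<lambda>n. Wsp_norm_p s p (\<lambda>x. min (w x) (r n x))) \<longlonglongrightarrow> 0"
proof -
  have nrm0: "(\<lambda>n. Wsp_norm_p s p (r n)) \<longlonglongrightarrow> 0"
  proof (rule tendsto_sandwich[where f = "\<lambda>_. 0"])
    show "\<forall>\<^sub>F n in sequentially. Wsp_norm_p s p (r n) \<le> ennreal ((1 / 2) ^ n)" using r by simp
    have "(\<lambda>n. ennreal ((1 / 2) ^ n)) \<longlonglongrightarrow> ennreal 0"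
      by (intro tendsto_ennrealI LIMSEQ_realpow_zero) auto
    then show "(\<lambda>n. ennreal ((1 / 2) ^ n)) \<longlonglongrightarrow> 0" by simp
  qed auto
  have Lr: "(\<integral>\<^sup>+x. ennreal (\<bar>r n x\<bar> powr p) \<partial>lborel) \<le> ennreal ((1 / 2) ^ n)" for n
    using r(2)[of n] unfolding Wsp_norm_p_def by (rule order_trans[rotated]) simp
  have ae: "AE x in lborel. (\<lambda>n. r n x) \<longlonglongrightarrow> 0"
    using p by (intro Lp_fast_convergence_AE[of p] Lr) auto
  have fin_w: "gag_energy s p w < \<infinity>" using fin by (auto simp: Wsp_norm_p_def)
  define H where "H n z = min \<bar>w (fst z) - w (snd z)\<bar> (r n (fst z))" for n z
  have [measurable]: "H n \<in> borel_measurable borel" for n unfolding H_def by measurable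
  have H0: "0 \<le> H n z" for n z using r by (simp add: H_def)
  have Hlim: "(\<lambda>n. \<integral>\<^sup>+z. ennreal (H n z powr p / gag_denom s p z) \<partial>lborel) \<longlonglongrightarrow> (\<integral>\<^sup>+z. 0 \<partial>(lborel :: ('a \<times> 'a) measure))"
  proof (rule nn_integral_dominated_convergence[where w = "\<lambda>z. ennreal (\<bar>w (fst z) - w (snd z)\<bar> powr p / gag_denom s p z)"])
    show "AE z in lborel. ennreal (H n z powr p / gag_denom s p z) \<le> ennreal (\<bar>w (fst z) - w (snd z)\<bar> powr p / gag_denom s p z)" for n
      using p gag_denom_nonneg H0 by (intro AE_I2 ennreal_leI divide_right_mono powr_mono2) (auto simp: H_def)
    show "AE z in lborel. (\<lambda>n. ennreal (H n z powr p / gag_denom s p z)) \<longlonglongrightarrow> 0"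
      using AE_lborel_fst_snd[OF ae]
    proof eventually_elim
      case (elim z)
      have "(\<lambda>n. H n z) \<longlonglongrightarrow> 0"
        by (rule tendsto_sandwich[OF _ _ tendsto_const, where h = "\<lambda>n. r n (fst z)"])
          (use elim H0 in \<open>auto simp: H_def\<close>)
      then have "(\<lambda>n. H n z powr p / gag_denom s p z) \<longlonglongrightarrow> 0 powr p / gag_denom s p z"
        unfolding divide_inverse using p H0 by (intro tendsto_mult_right tendsto_powr') auto
      then show ?case using tendsto_ennrealI by fastforce
    qed
  qed (use fin_w in \<open>auto simp: gag_energy_def\<close>)
  have le: "Wsp_norm_p s p (\<lambda>x. min (w x) (r n x)) \<le> ennreal (2 powr p) * (Wsp_norm_p s p (r n) + (\<integral>\<^sup>+z. ennreal (H n z powr p / gag_denom s p z) \<partial>lborel))" for n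
  proof -
    have "gag_energy s p (\<lambda>x. min (w x) (r n x)) \<le> (\<integral>\<^sup>+z. ennreal (2 powr p) * (ennreal (\<bar>r n (fst z) - r n (snd z)\<bar> powr p / gag_denom s p z)
       + ennreal (H n z powr p / gag_denom s p z)) \<partial>lborel)"
      unfolding gag_energy_def
    proof (intro nn_integral_mono)
      fix z
      \<comment> \<open>Change one argument of the minimum at a time. With the value of r at the
        first point kept, both minima lie between 0 and that value and differ by at most the
        difference of w; exchanging r costs its own difference.\<close>
      have "\<bar>min (w (fst z)) (r n (fst z)) - min (w (snd z)) (r n (snd z))\<bar> \<le> \<bar>r n (fst z) - r n (snd z)\<bar> + H n z"
        using w[of "fst z"] w[of "snd z"] r(1)[of n "fst z"] r(1)[of n "snd z"] unfolding H_def by (auto simp: min_def abs_if)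
      then have "\<bar>min (w (fst z)) (r n (fst z)) - min (w (snd z)) (r n (snd z))\<bar> powr p \<le> \<bar>\<bar>r n (fst z) - r n (snd z)\<bar> + H n z\<bar> powr p"
        using p by (intro powr_mono2) auto
      also have "\<dots> \<le> 2 powr p * (\<bar>r n (fst z) - r n (snd z)\<bar> powr p + H n z powr p)"
        using powr_add_le[of p "\<bar>r n (fst z) - r n (snd z)\<bar>" "H n z"] p H0[of n z] by simp
      finally have "\<bar>min (w (fst z)) (r n (fst z)) - min (w (snd z)) (r n (snd z))\<bar> powr p / gag_denom s p z
        \<le> 2 powr p * (\<bar>r n (fst z) - r n (snd z)\<bar> powr p + H n z powr p) / gag_denom s p z"
        by (intro divide_right_mono gag_denom_nonneg)
      also have "\<dots> = 2 powr p * (\<bar>r n (fst z) - r n (snd z)\<bar> powr p / gag_denom s p z + H n z powr p / gag_denom s p z)"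
        by (simp add: add_divide_distrib distrib_left)
      finally show "ennreal (\<bar>min (w (fst z)) (r n (fst z)) - min (w (snd z)) (r n (snd z))\<bar> powr p / gag_denom s p z)
        \<le> ennreal (2 powr p) * (ennreal (\<bar>r n (fst z) - r n (snd z)\<bar> powr p / gag_denom s p z) + ennreal (H n z powr p / gag_denom s p z))"
        using gag_denom_nonneg[of s p z] by (simp add: ennreal_leI flip: ennreal_plus ennreal_mult')
    qed
    also have "\<dots> = ennreal (2 powr p) * (gag_energy s p (r n) + (\<integral>\<^sup>+z. ennreal (H n z powr p / gag_denom s p z) \<partial>lborel))"
      unfolding gag_energy_def by (subst nn_integral_cmult, simp, subst nn_integral_add) auto
    finally have 1: "gag_energy s p (\<lambda>x. min (w x) (r n x)) \<le> \<dots>" .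
    have 2: "(\<integral>\<^sup>+x. ennreal (\<bar>min (w x) (r n x)\<bar> powr p) \<partial>lborel) \<le> ennreal (2 powr p) * (\<integral>\<^sup>+x. ennreal (\<bar>r n x\<bar> powr p) \<partial>lborel)"
    proof -
      have "(\<integral>\<^sup>+x. ennreal (\<bar>min (w x) (r n x)\<bar> powr p) \<partial>lborel) \<le> 1 * (\<integral>\<^sup>+x. ennreal (\<bar>r n x\<bar> powr p) \<partial>lborel)"
        using p w r(1) by (auto intro!: nn_integral_mono ennreal_leI powr_mono2)
      also have "\<dots> \<le> ennreal (2 powr p) * (\<integral>\<^sup>+x. ennreal (\<bar>r n x\<bar> powr p) \<partial>lborel)"
        using ge_one_powr_ge_zero[of 2 p] p by (intro mult_right_mono) (auto simp: ennreal_ge_1)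
      finally show ?thesis .
    qed
    show ?thesis
      using add_mono[OF 1 2] by (simp add: Wsp_norm_p_def distrib_left add_ac)
  qed
  show ?thesis
  proof (rule tendsto_sandwich[OF _ always_eventually[OF allI[OF le]] tendsto_const])
    have "(\<lambda>n. ennreal (2 powr p) * (Wsp_norm_p s p (r n) + (\<integral>\<^sup>+z. ennreal (H n z powr p / gag_denom s p z) \<partial>lborel)))
       \<longlonglongrightarrow> ennreal (2 powr p) * (0 + 0)"
      using Hlim nrm0 by (intro ennreal_tendsto_cmult tendsto_add) auto
    then show "(\<lambda>n. ennreal (2 powr p) * (Wsp_norm_p s p (r n) + (\<integral>\<^sup>+z. ennreal (H n z powr p / gag_denom s p z) \<partial>lborel))) \<longlonglongrightarrow> 0"
      by simp
  qed simp
qed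

text \<open>Lattice operations restore the order. With v a truncation of w and \<eta> an unordered
  approximant of v, min v (max \<eta> 0) lies between 0 and v and keeps the support of \<eta>; its
  error is min v (max (v - \<eta>) 0), for which \<open>Wsp_norm_p_min_tendsto\<close> is
  designed.\<close>

lemma approximable_from_below:
  fixes w :: "'a::euclidean_space \<Rightarrow> real"
  assumes p: "1 < p" and s: "0 < s" "s < 1" and \<Omega>: "smooth_bounded_domain \<Omega>"
    and wm[measurable]: "w \<in> borel_measurable borel" and fin: "Wsp_norm_p s p w < \<infinity>" and w0: "\<And>x. x \<notin> \<Omega> \<Longrightarrow> w x = 0"
    and w: "\<And>x. 0 \<le> w x" and e: "0 < e"
  shows "\<exists>\<eta>\<in>borel_measurable borel. compactly_supported_in \<Omega> \<eta> \<and> (\<exists>M. \<forall>x. \<eta> x \<le> M) \<and> (\<forall>x. 0 \<le> \<eta> x \<and> \<eta> x \<le> w x) \<and>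
    Wsp_norm_p s p (\<lambda>x. w x - \<eta> x) \<le> ennreal e"
proof -
  define e' where "e' = e / (2 * 2 powr p)"
  have e': "e' > 0" using e by (simp add: e'_def)
  have "\<forall>\<^sub>F n in sequentially. Wsp_norm_p s p (\<lambda>x. w x - min (w x) (real n)) < ennreal e'"
    using e' by (intro order_tendstoD(2)[OF Wsp_norm_p_truncation_tendsto[OF p wm fin]]) auto
  then obtain n where n: "Wsp_norm_p s p (\<lambda>x. w x - min (w x) (real n)) < ennreal e'"
    by (auto simp: eventually_sequentially)
  define v where "v x = min (w x) (real n)" for x
  have [measurable]: "v \<in> borel_measurable borel" unfolding v_def by measurable
  have v: "0 \<le> v x" "v x \<le> w x" "v x \<le> real n" for x using w by (auto simp: v_def)
  have "Wsp_norm_p s p v \<le> Wsp_norm_p s p w"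
    using p v w by (intro Wsp_norm_p_cong_le) (auto simp: v_def)
  then have vfin: "Wsp_norm_p s p v < \<infinity>" using fin by (rule le_less_trans)
  have "approximable s p \<Omega> v"
    using w0 by (intro smooth_bounded_domain_approximable[OF p s \<Omega> _ vfin]) (auto simp: v_def)
  then have "\<forall>j. \<exists>\<eta>. \<eta> \<in> borel_measurable borel \<and> compactly_supported_in \<Omega> \<eta> \<and> Wsp_norm_p s p (\<lambda>x. \<eta> x - v x) \<le> ennreal ((1 / 2) ^ j)"
    unfolding approximable_def by (metis zero_less_power half_gt_zero_iff zero_less_one)
  then obtain \<eta> where \<eta>: "\<And>j::nat. \<eta> j \<in> borel_measurable borel" "\<And>j. compactly_supported_in \<Omega> (\<eta> j)"
     "\<And>j. Wsp_norm_p s p (\<lambda>x. \<eta> j x - v x) \<le> ennreal ((1 / 2) ^ j)" by metis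
  note [measurable] = \<eta>(1)
  define r where "r j x = max (v x - \<eta> j x) 0" for j x
  have [measurable]: "r j \<in> borel_measurable borel" for j unfolding r_def by measurable
  have "Wsp_norm_p s p (r j) \<le> ennreal ((1 / 2) ^ j)" for j
  proof -
    have "Wsp_norm_p s p (r j) \<le> Wsp_norm_p s p (\<lambda>x. \<eta> j x - v x)"
      using p by (intro Wsp_norm_p_cong_le) (auto simp: r_def)
    then show ?thesis using \<eta>(3) by (rule order_trans)
  qed
  moreover have "0 \<le> r j x" for j x by (simp add: r_def)
  ultimately have "(\<lambda>j. Wsp_norm_p s p (\<lambda>x. min (v x) (r j x))) \<longlonglongrightarrow> 0"
    using v by (intro Wsp_norm_p_min_tendsto[OF p _ _ vfin]) auto
  then have "\<forall>\<^sub>F j in sequentially. Wsp_norm_p s p (\<lambda>x. min (v x) (r j x)) < ennreal e'"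
    using e' by (intro order_tendstoD(2)) auto
  then obtain j where j: "Wsp_norm_p s p (\<lambda>x. min (v x) (r j x)) < ennreal e'"
    by (auto simp: eventually_sequentially)
  define h where "h x = min (v x) (max (\<eta> j x) 0)" for x
  have [measurable]: "h \<in> borel_measurable borel" unfolding h_def by measurable
  have "v x - h x = min (v x) (r j x)" for x using v(1)[of x] by (auto simp: h_def r_def)
  then have jh: "Wsp_norm_p s p (\<lambda>x. v x - h x) < ennreal e'" using j by simp
  have "Wsp_norm_p s p (\<lambda>x. w x - h x) \<le> ennreal e"
  proof -
    have "Wsp_norm_p s p (\<lambda>x. (w x - v x) + (v x - h x)) \<le> ennreal (2 powr p) * (Wsp_norm_p s p (\<lambda>x. w x - v x) + Wsp_norm_p s p (\<lambda>x. v x - h x))"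
      using p by (intro Wsp_norm_p_add) auto
    also have "\<dots> \<le> ennreal (2 powr p) * (ennreal e' + ennreal e')"
      using n jh by (intro mult_left_mono add_mono) (auto simp: v_def)
    also have "\<dots> = ennreal e" using e by (simp add: e'_def flip: ennreal_plus ennreal_mult')
    finally show ?thesis by simp
  qed
  moreover have "compactly_supported_in \<Omega> h"
    using \<eta>(2)[of j] v(1) unfolding compactly_supported_in_def h_def by (auto simp: min_absorb2)
  moreover have "0 \<le> h x \<and> h x \<le> w x" "h x \<le> real n" for x
    using v[of x] by (auto simp: h_def)
  ultimately show ?thesis by (intro bexI[of _ h]) auto
qed

subsection \<open>Test functions for the comparison principle\<close>

text \<open>Where \<alpha> is positive, truncation lowers a by exactly \<epsilon> and b by at most
  \<epsilon>, so the difference a - b can only decrease; likewise with the roles exchanged. Applied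
  to the values of u and of a test function living on {u > \<epsilon>}, this makes the truncation of
  u a subsolution.\<close>

lemma plap_truncation_le:
  assumes p: "1 < p" and "0 \<le> \<alpha>" "0 \<le> \<beta>" "0 < \<alpha> \<Longrightarrow> \<epsilon> < a" "0 < \<beta> \<Longrightarrow> \<epsilon> < b"
  shows "plap p (max (a - \<epsilon>) 0 - max (b - \<epsilon>) 0) * (\<alpha> - \<beta>) \<le> plap p (a - b) * (\<alpha> - \<beta>)"
proof -
  consider "\<alpha> = 0" "\<beta> = 0" | "0 < \<alpha>" "0 < \<beta>" | "0 < \<alpha>" "\<beta> = 0" | "\<alpha> = 0" "0 < \<beta>"
    using assms(2,3) by linarith
  then show ?thesis
  proof cases
    case 2
    then show ?thesis using assms(4,5) by (simp add: max_def)
  next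
    case 3
    then have "plap p (max (a - \<epsilon>) 0 - max (b - \<epsilon>) 0) \<le> plap p (a - b)"
      using assms(4) by (intro plap_mono p) (auto simp: max_def)
    then show ?thesis using 3 by (simp add: mult_right_mono)
  next
    case 4
    then have "plap p (a - b) \<le> plap p (max (a - \<epsilon>) 0 - max (b - \<epsilon>) 0)"
      using assms(5) by (intro plap_mono p) (auto simp: max_def)
    then show ?thesis using 4 by (simp add: mult_right_mono)
  qed simp
qed

text \<open>A nonzero difference of the positive parts of a - c and b - d has the sign of (a - c) -
  (b - d), which is also (a - b) - (c - d); strict monotonicity of \<open>plap\<close> does the
  rest.\<close>

lemma plap_monotone_test:
  fixes a b c d p :: real
  assumes p: "1 < p"
  shows "0 \<le> (plap p (a - b) - plap p (c - d)) * (max (a - c) 0 - max (b - d) 0)"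
    and "(plap p (a - b) - plap p (c - d)) * (max (a - c) 0 - max (b - d) 0) = 0 \<Longrightarrow> max (a - c) 0 = max (b - d) 0"
proof -
  have *: "0 < (plap p (a - b) - plap p (c - d)) * (max (a - c) 0 - max (b - d) 0)"
    if ne: "max (a - c) 0 \<noteq> max (b - d) 0"
  proof (cases "max (a - c) 0 > max (b - d) 0")
    case True
    then have "c - d < a - b" by (auto simp: max_def split: if_splits)
    then show ?thesis using True plap_strict_mono[OF p] by simp
  next
    case False
    then have F: "max (a - c) 0 < max (b - d) 0" using ne by linarith
    then have "a - b < c - d" by (auto simp: max_def split: if_splits)
    then show ?thesis using F plap_strict_mono[OF p] by (simp add: mult_neg_neg)
  qed
  then show "0 \<le> (plap p (a - b) - plap p (c - d)) * (max (a - c) 0 - max (b - d) 0)"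
    by (cases "max (a - c) 0 = max (b - d) 0") (auto simp: less_imp_le)
  show "(plap p (a - b) - plap p (c - d)) * (max (a - c) 0 - max (b - d) 0) = 0 \<Longrightarrow> max (a - c) 0 = max (b - d) 0"
    using * by fastforce
qed

text \<open>
  This bounds the energy of \<open>(\<eta> - v)\<^sup>+\<close> by that of \<open>\<eta>\<close> for every supersolution \<open>v\<close>, even if
  \<open>v\<close> itself has infinite energy near the boundary.
\<close>

lemma plap_test_coercive:
  fixes a b c d p :: real
  assumes p: "1 < p"
  shows "\<bar>max (a - c) 0 - max (b - d) 0\<bar> powr p
    \<le> 2 powr p * \<bar>a - b\<bar> powr p - 2 powr (p - 1) * (plap p (c - d) * (max (a - c) 0 - max (b - d) 0))"
proof -
  \<comment> \<open>Here A = a - b, B = c - d and D is the difference of positive parts. If B \<le>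
    0, then D \<le> A + \<bar>B\<bar>, so either D \<le> 2 * \<bar>B\<bar>, and the term with
    \<open>plap p B\<close> absorbs it, or D \<le> 2 * A; this is the origin of the powers of 2. If
    B > 0, both B and D are at most A.\<close>
  have main: "D powr p \<le> 2 powr p * \<bar>A\<bar> powr p - 2 powr (p - 1) * (plap p B * D)"
    if D: "0 < D" "D \<le> A - B" for A B D
  proof (cases "B \<le> 0")
    case True
    have pl: "plap p B = - (\<bar>B\<bar> powr (p - 1))"
      using plap_nonneg[of "- B" p] True by (simp add: plap_minus)
    have "2 powr (p - 1) * (plap p B * D) = - ((2 * \<bar>B\<bar>) powr (p - 1) * D)"
      by (simp add: pl powr_mult)
    moreover have "D powr p \<le> (2 * \<bar>A\<bar>) powr p + (2 * \<bar>B\<bar>) powr (p - 1) * D"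
    proof (cases "D \<le> 2 * \<bar>B\<bar>")
      case True
      have "D powr p = D powr (p - 1) * D" using D by (simp add: powr_minus_one_mult)
      also have "\<dots> \<le> (2 * \<bar>B\<bar>) powr (p - 1) * D"
        using True D p by (intro mult_right_mono powr_mono2) auto
      finally show ?thesis by (smt (verit) powr_ge_zero)
    next
      case False
      then have "D powr p \<le> (2 * \<bar>A\<bar>) powr p"
        using D p \<open>B \<le> 0\<close> by (intro powr_mono2) auto
      moreover have "0 \<le> (2 * \<bar>B\<bar>) powr (p - 1) * D" using D by simp
      ultimately show ?thesis by linarith
    qed
    ultimately show ?thesis by (simp add: powr_mult)
  next
    case False
    then have A: "0 < A" "D \<le> A" "B \<le> A" using D by auto
    have "plap p B * D \<le> A powr (p - 1) * A"
      using False A D p by (simp add: plap_nonneg) (intro mult_mono powr_mono2; simp)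
    then have "plap p B * D \<le> A powr p" using A by (simp add: powr_minus_one_mult)
    then have "2 powr (p - 1) * (plap p B * D) \<le> 2 powr (p - 1) * A powr p"
      by (intro mult_left_mono) auto
    moreover have "D powr p \<le> A powr p" using A D p by (intro powr_mono2) auto
    moreover have "1 * A powr p \<le> 2 powr (p - 1) * A powr p"
      using p ge_one_powr_ge_zero[of 2 "p - 1"] by (intro mult_right_mono) auto
    moreover have "2 powr p * A powr p = 2 * (2 powr (p - 1) * A powr p)"
      using powr_minus_one_mult[of 2 p] by simp
    ultimately have "D powr p \<le> 2 powr p * A powr p - 2 powr (p - 1) * (plap p B * D)"
      by linarith
    then show ?thesis using A by simp
  qed
  consider "max (a - c) 0 = max (b - d) 0" | "max (b - d) 0 < max (a - c) 0" | "max (a - c) 0 < max (b - d) 0"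
    by linarith
  then show ?thesis
  proof cases
    case 2
    then have "max (a - c) 0 - max (b - d) 0 \<le> (a - b) - (c - d)" by (auto simp: max_def)
    moreover have D: "0 < max (a - c) 0 - max (b - d) 0" using 2 by linarith
    ultimately show ?thesis using main[OF D] unfolding abs_of_pos[OF D] by blast
  next
    case 3
    then have le: "max (b - d) 0 - max (a - c) 0 \<le> (b - a) - (d - c)" by (auto simp: max_def)
    have D: "0 < max (b - d) 0 - max (a - c) 0" using 3 by linarith
    have "(max (b - d) 0 - max (a - c) 0) powr p
      \<le> 2 powr p * \<bar>b - a\<bar> powr p - 2 powr (p - 1) * (plap p (d - c) * (max (b - d) 0 - max (a - c) 0))"
      by (rule main[OF D le])
    moreover have "plap p (d - c) * (max (b - d) 0 - max (a - c) 0) = plap p (c - d) * (max (a - c) 0 - max (b - d) 0)"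
      using plap_minus[of p "c - d"] by (simp add: algebra_simps)
    moreover have "\<bar>max (a - c) 0 - max (b - d) 0\<bar> = max (b - d) 0 - max (a - c) 0" using 3 by linarith
    ultimately show ?thesis by (simp only: abs_minus_commute[of b a])
  qed simp
qed

text \<open>The test function vanishes unless one of the two points lies in the support K of \<eta>.
  If the partner is far, the bound M and the tail of the kernel suffice; if it is near, both points
  lie in a compact neighbourhood of K, where v has finite energy. The behaviour of v at the boundary
  never enters.\<close>

lemma admissible_positive_part:
  fixes v \<eta> :: "'a::euclidean_space \<Rightarrow> real"
  assumes p: "1 < p" and s: "0 < s" and \<Omega>: "open \<Omega>" and reg: "locally_regular s p \<Omega> G v" and v: "\<And>x. 0 \<le> v x"
    and [measurable]: "\<eta> \<in> borel_measurable borel" and cs: "compactly_supported_in \<Omega> \<eta>"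
    and \<eta>: "\<And>x. 0 \<le> \<eta> x" "\<And>x. \<eta> x \<le> M" and fin: "gag_energy s p \<eta> < \<infinity>"
  shows "admissible s p \<Omega> (\<lambda>x. max (\<eta> x - v x) 0)"
proof -
  define \<phi> where "\<phi> x = max (\<eta> x - v x) 0" for x
  have [measurable]: "v \<in> borel_measurable borel" using reg by (simp add: locally_regular_def)
  have [measurable]: "\<phi> \<in> borel_measurable borel" unfolding \<phi>_def by measurable
  obtain K where K: "compact K" "K \<subseteq> \<Omega>" "\<And>x. x \<notin> K \<Longrightarrow> \<eta> x = 0"
    using cs unfolding compactly_supported_in_def by blast
  have \<phi>K: "\<phi> x = 0" if "x \<notin> K" for x using K(3)[OF that] v[of x] by (simp add: \<phi>_def)
  have \<phi>0: "0 \<le> \<phi> x" and \<phi>M: "\<phi> x \<le> M" for x using \<eta>[of x] v[of x] by (auto simp: \<phi>_def)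
  have M: "0 \<le> M" using \<eta>[of 0] by linarith
  obtain d where d: "d > 0" "(\<Union>x\<in>K. cball x d) \<subseteq> \<Omega>"
    using compact_subset_open_imp_cball_epsilon_subset[OF K(1) \<Omega> K(2)] by blast
  define K2 where "K2 = {x + y | x y. x \<in> K \<and> y \<in> cball 0 d}"
  have K2: "compact K2" unfolding K2_def by (intro compact_sums K compact_cball)
  have inK2: "z \<in> K2" if "x \<in> K" "norm (z - x) \<le> d" for x z
    unfolding K2_def using that by (intro CollectI exI[of _ x] exI[of _ "z - x"]) auto
  have K2\<Omega>: "K2 \<subseteq> \<Omega>"
  proof
    fix z assume "z \<in> K2"
    then obtain x y where xy: "z = x + y" "x \<in> K" "norm y \<le> d" by (auto simp: K2_def)
    then have "z \<in> cball x d" by (simp add: dist_norm)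
    then show "z \<in> \<Omega>" using d(2) xy(2) by blast
  qed
  have [measurable]: "K \<in> sets borel" "K2 \<in> sets borel" using K K2 by (auto intro: borel_compact)
  define Q where "Q = (\<lambda>z. indicator (K2 \<times> K2) z * (\<bar>v (fst z) - v (snd z)\<bar> powr p / gag_denom s p z))"
  have Qind: "indicator (K2 \<times> K2) z = (indicator K2 (fst z) * indicator K2 (snd z) :: real)" for z
    by (cases z) (auto simp: indicator_def)
  have [measurable]: "Q \<in> borel_measurable borel" unfolding Q_def Qind by measurable
  have Q0: "Q z \<ge> 0" for z using gag_denom_nonneg[of s p z] by (simp add: Q_def)
  have Qfin: "(\<integral>\<^sup>+z. ennreal (Q z) \<partial>lborel) < \<infinity>"
    using reg K2 K2\<Omega> unfolding locally_regular_def Q_def by blast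
  define far where "far z = (indicator {z. d \<le> norm (fst z - snd z)} z :: real)" for z :: "'a \<times> 'a"
  have [measurable]: "far \<in> borel_measurable borel" unfolding far_def by measurable
  have far01: "far z = 0 \<or> far z = 1" for z by (simp add: far_def indicator_def)
  define g where "g x = M powr p * indicator K x" for x
  have [measurable]: "g \<in> borel_measurable borel" unfolding g_def by measurable
  have g0: "0 \<le> g x" for x by (simp add: g_def)
  have gfin: "(\<integral>\<^sup>+x. ennreal (g x) \<partial>lborel) < \<infinity>"
  proof -
    have "(\<integral>\<^sup>+x. ennreal (g x) \<partial>lborel) = (\<integral>\<^sup>+x. ennreal (M powr p) * indicator K x \<partial>lborel)"
      by (intro nn_integral_cong) (auto simp: g_def indicator_def)
    also have "\<dots> < \<infinity>"
      using emeasure_bounded_finite[OF compact_imp_bounded[OF K(1)]]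
      by (subst nn_integral_cmult_indicator) (auto simp: ennreal_mult_less_top)
    finally show ?thesis .
  qed
  let ?E = "\<lambda>z. \<bar>\<eta> (fst z) - \<eta> (snd z)\<bar> powr p / gag_denom s p z"
  have E0: "0 \<le> ?E z" for z using gag_denom_nonneg[of s p z] by simp
  have "gag_energy s p \<phi> \<le> (\<integral>\<^sup>+z. ennreal (2 powr p) * (ennreal (?E z) + ennreal (Q z))
     + (ennreal (g (fst z)) * ennreal (far z / gag_denom s p z) + ennreal (g (snd z)) * ennreal (far z / gag_denom s p z)) \<partial>lborel)"
    unfolding gag_energy_def
  proof (intro nn_integral_mono)
    fix z
    have f0: "0 \<le> far z / gag_denom s p z" using gag_denom_nonneg[of s p z] by (simp add: far_def)
    have nn: "0 \<le> 2 powr p * (?E z + Q z)" "0 \<le> g (fst z) * (far z / gag_denom s p z) + g (snd z) * (far z / gag_denom s p z)"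
      using E0[of z] Q0[of z] by (auto intro!: add_nonneg_nonneg mult_nonneg_nonneg g0 f0 simp del: times_divide_eq_right)
    have "\<bar>\<phi> (fst z) - \<phi> (snd z)\<bar> powr p / gag_denom s p z \<le> 2 powr p * (?E z + Q z) + (g (fst z) * (far z / gag_denom s p z) + g (snd z) * (far z / gag_denom s p z))"
    proof -
      consider "\<phi> (fst z) = \<phi> (snd z)" | "far z = 1" "\<phi> (fst z) \<noteq> 0 \<or> \<phi> (snd z) \<noteq> 0" | "far z = 0" "\<phi> (fst z) \<noteq> 0 \<or> \<phi> (snd z) \<noteq> 0"
        using far01[of z] by metis
      then show ?thesis
      proof cases
        case 1
        then have "\<bar>\<phi> (fst z) - \<phi> (snd z)\<bar> powr p / gag_denom s p z = 0" by simp
        then show ?thesis using nn by linarith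
      next
        case 2
        have "\<bar>\<phi> (fst z) - \<phi> (snd z)\<bar> powr p \<le> M powr p"
          using \<phi>0[of "fst z"] \<phi>0[of "snd z"] \<phi>M[of "fst z"] \<phi>M[of "snd z"] p by (intro powr_mono2) auto
        also have "\<dots> \<le> g (fst z) + g (snd z)"
          using 2(2) \<phi>K by (auto simp: g_def indicator_def)
        finally have "\<bar>\<phi> (fst z) - \<phi> (snd z)\<bar> powr p / gag_denom s p z \<le> (g (fst z) + g (snd z)) / gag_denom s p z"
          by (intro divide_right_mono gag_denom_nonneg)
        also have "\<dots> = g (fst z) * (far z / gag_denom s p z) + g (snd z) * (far z / gag_denom s p z)"
          by (simp add: 2(1) add_divide_distrib)
        finally show ?thesis using nn by linarith
      next
        case 3
        have xy: "norm (fst z - snd z) < d" using 3(1) by (auto simp: far_def indicator_def split: if_splits)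
        have "fst z \<in> K \<or> snd z \<in> K" using 3(2) \<phi>K by blast
        then have "fst z \<in> K2 \<and> snd z \<in> K2"
          using inK2[of "fst z" "fst z"] inK2[of "fst z" "snd z"] inK2[of "snd z" "fst z"] inK2[of "snd z" "snd z"] xy d(1)
          by (auto simp: norm_minus_commute)
        then have "z \<in> K2 \<times> K2" by (cases z) auto
        then have Q: "Q z = \<bar>v (fst z) - v (snd z)\<bar> powr p / gag_denom s p z" by (simp add: Q_def)
        have "\<bar>\<phi> (fst z) - \<phi> (snd z)\<bar> \<le> \<bar>(\<eta> (fst z) - \<eta> (snd z)) + (v (snd z) - v (fst z))\<bar>"
          unfolding \<phi>_def by (auto simp: max_def abs_if)
        then have "\<bar>\<phi> (fst z) - \<phi> (snd z)\<bar> powr p \<le> \<bar>(\<eta> (fst z) - \<eta> (snd z)) + (v (snd z) - v (fst z))\<bar> powr p"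
          using p by (intro powr_mono2) auto
        also have "\<dots> \<le> 2 powr p * (\<bar>\<eta> (fst z) - \<eta> (snd z)\<bar> powr p + \<bar>v (snd z) - v (fst z)\<bar> powr p)"
          using p by (intro powr_add_le) auto
        finally have "\<bar>\<phi> (fst z) - \<phi> (snd z)\<bar> powr p / gag_denom s p z
          \<le> 2 powr p * (\<bar>\<eta> (fst z) - \<eta> (snd z)\<bar> powr p + \<bar>v (snd z) - v (fst z)\<bar> powr p) / gag_denom s p z"
          by (intro divide_right_mono gag_denom_nonneg)
        also have "\<dots> = 2 powr p * (?E z + Q z)"
          unfolding Q by (simp add: add_divide_distrib distrib_left abs_minus_commute)
        finally show ?thesis using nn by linarith
      qed
    qed
    then have "ennreal (\<bar>\<phi> (fst z) - \<phi> (snd z)\<bar> powr p / gag_denom s p z)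
       \<le> ennreal (2 powr p * (?E z + Q z) + (g (fst z) * (far z / gag_denom s p z) + g (snd z) * (far z / gag_denom s p z)))"
      by (rule ennreal_leI)
    also have "\<dots> = ennreal (2 powr p) * (ennreal (?E z) + ennreal (Q z))
     + (ennreal (g (fst z)) * ennreal (far z / gag_denom s p z) + ennreal (g (snd z)) * ennreal (far z / gag_denom s p z))"
      using E0[of z] Q0[of z] g0[of "fst z"] g0[of "snd z"] f0
      by (simp add: add_nonneg_nonneg mult_nonneg_nonneg ennreal_mult ennreal_plus del: times_divide_eq_right)
    finally show "ennreal (\<bar>\<phi> (fst z) - \<phi> (snd z)\<bar> powr p / gag_denom s p z) \<le> \<dots>" .
  qed
  also have "\<dots> = ennreal (2 powr p) * (gag_energy s p \<eta> + (\<integral>\<^sup>+z. ennreal (Q z) \<partial>lborel))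
     + ((\<integral>\<^sup>+z. ennreal (g (fst z)) * ennreal (far z / gag_denom s p z) \<partial>lborel) + (\<integral>\<^sup>+z. ennreal (g (snd z)) * ennreal (far z / gag_denom s p z) \<partial>lborel))"
    unfolding gag_energy_def by (simp add: nn_integral_add nn_integral_cmult)
  also have "\<dots> < \<infinity>"
    using fin Qfin far_finite[of s p d g] gfin s p d unfolding far_def by (auto simp: ennreal_mult_less_top)
  finally have "gag_energy s p \<phi> < \<infinity>" .
  moreover have "\<exists>M. \<forall>x. \<bar>\<phi> x\<bar> \<le> M" using \<phi>0 \<phi>M by (intro exI[of _ M]) auto
  ultimately have "admissible s p \<Omega> \<phi>"
    unfolding admissible_def using K \<phi>K by auto
  then show ?thesis by (simp add: \<phi>_def [abs_def])
qed

lemma plap_integrand_integrable: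
  fixes w \<phi> :: "'a::euclidean_space \<Rightarrow> real"
  assumes p: "1 < p" and [measurable]: "w \<in> borel_measurable borel" "\<phi> \<in> borel_measurable borel"
    and "gag_energy s p w < \<infinity>" "gag_energy s p \<phi> < \<infinity>"
  shows "integrable lborel (plap_integrand s p w \<phi>)"
  unfolding integrable_iff_bounded
proof
  have [measurable]: "plap_integrand s p w \<phi> \<in> borel_measurable borel" using p by (intro borel_measurable_plap_integrand) auto
  then show "plap_integrand s p w \<phi> \<in> borel_measurable lborel" by simp
  have "(\<integral>\<^sup>+z. ennreal (norm (plap_integrand s p w \<phi> z)) \<partial>lborel) \<le> (\<integral>\<^sup>+z. ennreal (\<bar>w (fst z) - w (snd z)\<bar> powr p / gag_denom s p z)
      + ennreal (\<bar>\<phi> (fst z) - \<phi> (snd z)\<bar> powr p / gag_denom s p z) \<partial>lborel)"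
  proof (intro nn_integral_mono)
    fix z
    have "norm (plap_integrand s p w \<phi> z) = \<bar>w (fst z) - w (snd z)\<bar> powr (p - 1) * \<bar>\<phi> (fst z) - \<phi> (snd z)\<bar> / gag_denom s p z"
      using gag_denom_nonneg[of s p z] by (simp add: plap_integrand_def abs_mult abs_divide abs_plap)
    also have "\<dots> \<le> (\<bar>w (fst z) - w (snd z)\<bar> powr p + \<bar>\<phi> (fst z) - \<phi> (snd z)\<bar> powr p) / gag_denom s p z"
      by (intro divide_right_mono gag_denom_nonneg powr_mult_le_add p) auto
    finally show "ennreal (norm (plap_integrand s p w \<phi> z)) \<le> ennreal (\<bar>w (fst z) - w (snd z)\<bar> powr p / gag_denom s p z)
      + ennreal (\<bar>\<phi> (fst z) - \<phi> (snd z)\<bar> powr p / gag_denom s p z)"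
      using gag_denom_nonneg[of s p z] by (simp add: add_divide_distrib ennreal_leI flip: ennreal_plus)
  qed
  also have "\<dots> = gag_energy s p w + gag_energy s p \<phi>"
    unfolding gag_energy_def by (rule nn_integral_add) auto
  also have "\<dots> < \<infinity>" using assms by simp
  finally show "(\<integral>\<^sup>+z. ennreal (norm (plap_integrand s p w \<phi> z)) \<partial>lborel) < \<infinity>" .
qed

lemma gag_energy_integrable:
  fixes w :: "'a::euclidean_space \<Rightarrow> real"
  assumes [measurable]: "w \<in> borel_measurable borel" and "gag_energy s p w < \<infinity>"
  shows "integrable lborel (\<lambda>z. \<bar>w (fst z) - w (snd z)\<bar> powr p / gag_denom s p z)"
    and "gag_energy s p w = ennreal (LINT z|lborel. \<bar>w (fst z) - w (snd z)\<bar> powr p / gag_denom s p z)"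
proof -
  show *: "integrable lborel (\<lambda>z. \<bar>w (fst z) - w (snd z)\<bar> powr p / gag_denom s p z)"
    unfolding integrable_iff_bounded using assms by (simp add: gag_energy_def abs_of_nonneg[OF gag_denom_nonneg])
  show "gag_energy s p w = ennreal (LINT z|lborel. \<bar>w (fst z) - w (snd z)\<bar> powr p / gag_denom s p z)"
    unfolding gag_energy_def by (intro nn_integral_eq_integral[OF *] AE_I2) (simp add: gag_denom_nonneg)
qed

lemma locally_regular_integrable:
  assumes "locally_regular s p \<Omega> F u" "admissible s p \<Omega> \<phi>"
  shows "integrable lborel (\<lambda>x. F x * \<phi> x)"
proof -
  obtain K M where K: "compact K" "K \<subseteq> \<Omega>" "\<And>x. x \<notin> K \<Longrightarrow> \<phi> x = 0" and M: "\<And>x. \<bar>\<phi> x\<bar> \<le> M"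
    and \<phi>: "\<phi> \<in> borel_measurable borel"
    using assms(2) unfolding admissible_def by metis
  have "integrable lborel (\<lambda>x. indicator K x * F x)"
    using assms(1) K unfolding locally_regular_def by blast
  from integrable_mult_bounded[OF this \<phi> M]
  show ?thesis
    by (rule Bochner_Integration.integrable_cong[THEN iffD1, rotated -1]) (use K(3) in \<open>auto simp: indicator_def\<close>)
qed

subsection \<open>The comparison principle\<close>

text \<open>The working form of a solution: sign and vanishing hold at every point, and the test
  class is already enlarged. The right-hand side is a frozen function F, so its singular dependence
  on the solution matters only when two right-hand sides are compared.\<close>

definition weak_sol :: "real \<Rightarrow> real \<Rightarrow> 'a::euclidean_space set \<Rightarrow> ('a \<Rightarrow> real) \<Rightarrow> ('a \<Rightarrow> real) \<Rightarrow> bool" where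
  "weak_sol s p \<Omega> F u \<longleftrightarrow> locally_regular s p \<Omega> F u \<and> (\<forall>x. 0 \<le> u x) \<and> (\<forall>x. x \<notin> \<Omega> \<longrightarrow> u x = 0) \<and>
     (\<forall>\<phi>. admissible s p \<Omega> \<phi> \<longrightarrow> weak_eq s p F u \<phi>)"

text \<open>Fix a typical x: almost every y has the same value as x. If that value were nonzero,
  almost every y would lie in \<Omega>, although \<Omega> is bounded and the space has infinite
  measure.\<close>

lemma AE_diagonal_constant:
  fixes \<phi> :: "'a::euclidean_space \<Rightarrow> real"
  assumes [measurable]: "\<phi> \<in> borel_measurable borel" and ae: "AE z in lborel. \<phi> (fst z) = \<phi> (snd z)"
    and \<Omega>: "bounded \<Omega>" and [measurable]: "\<Omega> \<in> sets borel" and 0: "\<And>x. x \<notin> \<Omega> \<Longrightarrow> \<phi> x = 0"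
  shows "AE x in lborel. \<phi> x = 0"
proof -
  have "AE z in lborel \<Otimes>\<^sub>M lborel. \<phi> (fst z) = \<phi> (snd z)"
    unfolding lborel_prod by (rule ae)
  then have "AE x in lborel. AE y in lborel. \<phi> (fst (x, y)) = \<phi> (snd (x, y))"
    by (rule lborel_pair.AE_pair)
  then show ?thesis
  proof eventually_elim
    case (elim x)
    show "\<phi> x = 0"
    proof (rule ccontr)
      assume "\<phi> x \<noteq> 0"
      then have "AE y in lborel. y \<in> \<Omega>" using elim by (auto elim!: eventually_mono) (metis 0)
      then have "emeasure lborel \<Omega> = emeasure lborel (UNIV :: 'a set)"
        by (intro emeasure_eq_AE) auto
      then show False using emeasure_bounded_finite[OF \<Omega>] by simp
    qed
  qed
qed

lemma integral_linear_combination: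
  fixes f g h :: "'a \<Rightarrow> real"
  assumes "integrable M f" "integrable M g" "integrable M h"
  shows "(LINT z|M. a * (f z + g z) + b * h z) = a * ((LINT z|M. f z) + (LINT z|M. g z)) + b * (LINT z|M. h z)"
  using assms by simp

text \<open>The order of the right-hand sides is asked for only where v < u, since a decreasing
  nonlinearity provides it only there. Nonnegativity of G makes v a supersolution, which yields the
  energy bound for the test functions.\<close>

theorem weak_sol_comparison:
  fixes u v F G :: "'a::euclidean_space \<Rightarrow> real"
  assumes p: "1 < p" and s: "0 < s" "s < 1" and \<Omega>: "smooth_bounded_domain \<Omega>"
    and u: "weak_sol s p \<Omega> F u" and v: "weak_sol s p \<Omega> G v"
    and trunc: "\<And>\<epsilon>. 0 < \<epsilon> \<Longrightarrow> Wsp_norm_p s p (\<lambda>x. max (u x - \<epsilon>) 0) < \<infinity>"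
    and FG: "AE x in lborel. v x < u x \<longrightarrow> F x \<le> G x" and G0: "\<And>x. 0 \<le> G x"
  shows "AE x in lborel. u x \<le> v x"
proof -
  have op: "open \<Omega>" and bd: "bounded \<Omega>" using \<Omega> by (auto simp: smooth_bounded_domain_def)
  have [measurable]: "\<Omega> \<in> sets borel" using op by simp
  have ru: "locally_regular s p \<Omega> F u" and rv: "locally_regular s p \<Omega> G v"
    and u0: "\<And>x. 0 \<le> u x" "\<And>x. x \<notin> \<Omega> \<Longrightarrow> u x = 0" and v0: "\<And>x. 0 \<le> v x"
    and eu: "\<And>\<phi>. admissible s p \<Omega> \<phi> \<Longrightarrow> weak_eq s p F u \<phi>" and ev: "\<And>\<phi>. admissible s p \<Omega> \<phi> \<Longrightarrow> weak_eq s p G v \<phi>"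
    using u v by (auto simp: weak_sol_def)
  have [measurable]: "u \<in> borel_measurable borel" "v \<in> borel_measurable borel"
    using ru rv by (auto simp: locally_regular_def)
  have main: "AE x in lborel. max (u x - \<epsilon>) 0 \<le> v x" if \<epsilon>: "0 < \<epsilon>" for \<epsilon>
  proof -
    define w where "w x = max (u x - \<epsilon>) 0" for x
    have wm[measurable]: "w \<in> borel_measurable borel" unfolding w_def by measurable
    have w0: "0 \<le> w x" and w\<Omega>: "x \<notin> \<Omega> \<Longrightarrow> w x = 0" for x using u0 \<epsilon> by (auto simp: w_def)
    have nw: "Wsp_norm_p s p w < \<infinity>" using trunc[OF \<epsilon>] by (simp add: w_def [abs_def])
    then have gw: "gag_energy s p w < \<infinity>" by (auto simp: Wsp_norm_p_def)
    \<comment> \<open>The rate (1 / 2)^n also gives convergence almost everywhere, by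
      \<open>Lp_fast_convergence_AE\<close>.\<close>
    have "\<forall>n. \<exists>\<eta>. \<eta> \<in> borel_measurable borel \<and> compactly_supported_in \<Omega> \<eta> \<and> (\<exists>M. \<forall>x. \<eta> x \<le> M) \<and>
        (\<forall>x. 0 \<le> \<eta> x \<and> \<eta> x \<le> w x) \<and> Wsp_norm_p s p (\<lambda>x. w x - \<eta> x) \<le> ennreal ((1 / 2) ^ n)"
    proof
      fix n :: nat
      have "(0::real) < (1 / 2) ^ n" by simp
      from approximable_from_below[OF p s \<Omega> wm nw w\<Omega> w0 this] show "\<exists>\<eta>. \<eta> \<in> borel_measurable borel \<and> compactly_supported_in \<Omega> \<eta> \<and> (\<exists>M. \<forall>x. \<eta> x \<le> M) \<and>
        (\<forall>x. 0 \<le> \<eta> x \<and> \<eta> x \<le> w x) \<and> Wsp_norm_p s p (\<lambda>x. w x - \<eta> x) \<le> ennreal ((1 / 2) ^ n)"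
        by blast
    qed
    then obtain \<eta> where \<eta>m: "\<And>n::nat. \<eta> n \<in> borel_measurable borel" and \<eta>c: "\<And>n. compactly_supported_in \<Omega> (\<eta> n)"
      and \<eta>b: "\<And>n. \<exists>M. \<forall>x. \<eta> n x \<le> M" and \<eta>0: "\<And>n x. 0 \<le> \<eta> n x" and \<eta>w: "\<And>n x. \<eta> n x \<le> w x"
      and \<eta>n: "\<And>n. Wsp_norm_p s p (\<lambda>x. w x - \<eta> n x) \<le> ennreal ((1 / 2) ^ n)"
      by metis
    note [measurable] = \<eta>m
    have \<eta>gd: "gag_energy s p (\<lambda>x. w x - \<eta> n x) \<le> ennreal ((1 / 2) ^ n)" for n
      using \<eta>n[of n] unfolding Wsp_norm_p_def by (rule order_trans[rotated]) simp
    have lim: "AE x in lborel. (\<lambda>n. w x - \<eta> n x) \<longlonglongrightarrow> 0"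
    proof (rule Lp_fast_convergence_AE[of p])
      show "(\<integral>\<^sup>+x. ennreal (\<bar>w x - \<eta> n x\<bar> powr p) \<partial>lborel) \<le> ennreal ((1 / 2) ^ n)" for n
        using \<eta>n[of n] unfolding Wsp_norm_p_def by (rule order_trans[rotated]) simp
    qed (use p in auto)
    define Ew where "Ew = (LINT z|lborel. \<bar>w (fst z) - w (snd z)\<bar> powr p / gag_denom s p z)"
    have Ew: "gag_energy s p w = ennreal Ew" "0 \<le> Ew"
      using gag_energy_integrable(2)[OF wm gw] by (auto simp: Ew_def gag_denom_nonneg intro!: Bochner_Integration.integral_nonneg)
    \<comment> \<open>The outer factor comes from \<open>plap_test_coercive\<close>; the rest bounds
      the energy of \<eta> n, which is the sum of w and a function of energy at most 1.\<close>
    define B where "B = 2 powr p * (2 powr p * (Ew + 1))"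
    have B: "0 \<le> B" using Ew by (simp add: B_def)
    have g\<eta>: "gag_energy s p (\<eta> n) \<le> ennreal (2 powr p * (Ew + 1))" for n
    proof -
      have "gag_energy s p (\<lambda>x. w x + (- (w x - \<eta> n x))) \<le> ennreal (2 powr p) * (gag_energy s p w + gag_energy s p (\<lambda>x. - (w x - \<eta> n x)))"
        using p by (intro gag_energy_add) auto
      also have "gag_energy s p (\<lambda>x. - (w x - \<eta> n x)) = gag_energy s p (\<lambda>x. w x - \<eta> n x)"
        by (simp add: gag_energy_def abs_minus_commute algebra_simps)
      also have "\<dots> \<le> ennreal 1"
        using \<eta>gd[of n] by (rule order_trans) (auto intro!: ennreal_leI power_le_one)
      finally have "gag_energy s p (\<eta> n) \<le> ennreal (2 powr p) * (ennreal Ew + ennreal 1)"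
        using Ew by (simp add: mult_left_mono add_left_mono)
      also have "\<dots> = ennreal (2 powr p * (Ew + 1))"
        using Ew(2) by (subst ennreal_mult') (auto simp: ennreal_plus)
      finally show ?thesis .
    qed
    then have g\<eta>fin: "gag_energy s p (\<eta> n) < \<infinity>" for n by (rule le_less_trans) simp
    define \<phi> where "\<phi> n x = max (\<eta> n x - v x) 0" for n x
    have [measurable]: "\<phi> n \<in> borel_measurable borel" for n unfolding \<phi>_def by measurable
    have \<phi>0: "0 \<le> \<phi> n x" for n x by (simp add: \<phi>_def)
    \<comment> \<open>Positivity of \<phi> n gives v < \<eta> n \<le> w; as v \<ge> 0 this forces w
      > 0, hence u = w + \<epsilon>, which exceeds both \<epsilon> and v.\<close>
    have \<phi>u: "\<epsilon> < u x \<and> v x < u x" if "0 < \<phi> n x" for n x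
      using that \<eta>w[of n x] v0[of x] \<epsilon> by (auto simp: \<phi>_def w_def split: if_splits)
    have adm: "admissible s p \<Omega> (\<phi> n)" for n
    proof -
      obtain M where "\<And>x. \<eta> n x \<le> M" using \<eta>b by blast
      then show ?thesis
        unfolding \<phi>_def using \<eta>0 g\<eta>fin by (intro admissible_positive_part[OF p s(1) op rv v0 _ \<eta>c]) auto
    qed
    have g\<phi>fin: "gag_energy s p (\<phi> n) < \<infinity>" for n using adm[of n] by (simp add: admissible_def)
    have iv: "integrable lborel (plap_integrand s p v (\<phi> n))" "(LINT z|lborel. plap_integrand s p v (\<phi> n) z) = (LINT x|lborel. G x * \<phi> n x)"
     and iu: "integrable lborel (plap_integrand s p u (\<phi> n))" "(LINT z|lborel. plap_integrand s p u (\<phi> n) z) = (LINT x|lborel. F x * \<phi> n x)" for n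
      using ev[OF adm[of n]] eu[OF adm[of n]] by (auto simp: weak_eq_def has_bochner_integral_iff)
    have iw: "integrable lborel (plap_integrand s p w (\<phi> n))" and i\<eta>: "integrable lborel (plap_integrand s p (\<eta> n) (\<phi> n))" for n
      using p gw g\<eta>fin g\<phi>fin by (auto intro!: plap_integrand_integrable)
    have wv: "(LINT z|lborel. plap_integrand s p w (\<phi> n) z) \<le> (LINT z|lborel. plap_integrand s p v (\<phi> n) z)" for n
    proof -
      have "(LINT z|lborel. plap_integrand s p w (\<phi> n) z) \<le> (LINT z|lborel. plap_integrand s p u (\<phi> n) z)"
      proof (rule integral_mono[OF iw iu(1)])
        fix z
        show "plap_integrand s p w (\<phi> n) z \<le> plap_integrand s p u (\<phi> n) z"
          unfolding plap_integrand_def w_def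
          using \<phi>0 \<phi>u[of n "fst z"] \<phi>u[of n "snd z"]
          by (intro divide_right_mono gag_denom_nonneg plap_truncation_le p) auto
      qed
      also have "\<dots> = (LINT x|lborel. F x * \<phi> n x)" by (rule iu)
      also have "\<dots> \<le> (LINT x|lborel. G x * \<phi> n x)"
      proof (rule integral_mono_AE[OF locally_regular_integrable[OF ru adm] locally_regular_integrable[OF rv adm]])
        show "AE x in lborel. F x * \<phi> n x \<le> G x * \<phi> n x"
          using FG
        proof eventually_elim
          case (elim x)
          then show ?case
            using \<phi>0[of n x] \<phi>u[of n x] by (cases "\<phi> n x = 0") (auto intro!: mult_right_mono)
        qed
      qed
      also have "\<dots> = (LINT z|lborel. plap_integrand s p v (\<phi> n) z)" by (rule iv(2)[symmetric])
      finally show ?thesis .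
    qed
    have E\<phi>: "(LINT z|lborel. \<bar>\<phi> n (fst z) - \<phi> n (snd z)\<bar> powr p / gag_denom s p z) \<le> B" for n
    proof -
      let ?E = "\<lambda>z. \<bar>\<eta> n (fst z) - \<eta> n (snd z)\<bar> powr p / gag_denom s p z"
      have "(LINT z|lborel. \<bar>\<phi> n (fst z) - \<phi> n (snd z)\<bar> powr p / gag_denom s p z)
        \<le> (LINT z|lborel. 2 powr p * ?E z - 2 powr (p - 1) * plap_integrand s p v (\<phi> n) z)"
      proof (rule integral_mono)
        fix z
        have "\<bar>\<phi> n (fst z) - \<phi> n (snd z)\<bar> powr p / gag_denom s p z
          \<le> (2 powr p * \<bar>\<eta> n (fst z) - \<eta> n (snd z)\<bar> powr p
             - 2 powr (p - 1) * (plap p (v (fst z) - v (snd z)) * (\<phi> n (fst z) - \<phi> n (snd z)))) / gag_denom s p z"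
          unfolding \<phi>_def by (intro divide_right_mono gag_denom_nonneg plap_test_coercive p)
        then show "\<bar>\<phi> n (fst z) - \<phi> n (snd z)\<bar> powr p / gag_denom s p z \<le> 2 powr p * ?E z - 2 powr (p - 1) * plap_integrand s p v (\<phi> n) z"
          by (simp add: plap_integrand_def diff_divide_distrib)
      next
        show "integrable lborel (\<lambda>z. 2 powr p * ?E z - 2 powr (p - 1) * plap_integrand s p v (\<phi> n) z)"
          by (intro Bochner_Integration.integrable_diff integrable_mult_right iv gag_energy_integrable(1) g\<eta>fin) auto
      qed (intro gag_energy_integrable(1) g\<phi>fin, simp)
      also have "\<dots> = 2 powr p * (LINT z|lborel. ?E z) - 2 powr (p - 1) * (LINT z|lborel. plap_integrand s p v (\<phi> n) z)"
        by (subst Bochner_Integration.integral_diff, intro integrable_mult_right gag_energy_integrable(1) g\<eta>fin, simp,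
            intro integrable_mult_right iv, simp only: integral_mult_right_zero)
      also have "\<dots> \<le> 2 powr p * (LINT z|lborel. ?E z)"
        unfolding iv(2) using G0 \<phi>0 by (simp add: Bochner_Integration.integral_nonneg)
      also have "\<dots> \<le> 2 powr p * (2 powr p * (Ew + 1))"
      proof (intro mult_left_mono)
        have "ennreal (LINT z|lborel. ?E z) \<le> ennreal (2 powr p * (Ew + 1))"
          using g\<eta>[of n] by (simp add: gag_energy_integrable(2)[OF \<eta>m g\<eta>fin])
        then show "(LINT z|lborel. ?E z) \<le> 2 powr p * (Ew + 1)"
          using Ew by (subst (asm) ennreal_le_iff) auto
      qed simp
      finally show ?thesis by (simp add: B_def)
    qed
    define T where "T n z = plap_integrand s p (\<eta> n) (\<phi> n) z - plap_integrand s p v (\<phi> n) z" for n z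
    have Teq: "T n z = (plap p (\<eta> n (fst z) - \<eta> n (snd z)) - plap p (v (fst z) - v (snd z))) * (\<phi> n (fst z) - \<phi> n (snd z)) / gag_denom s p z" for n z
      by (simp add: T_def plap_integrand_def left_diff_distrib diff_divide_distrib)
    have T0: "0 \<le> T n z" for n z
      unfolding Teq \<phi>_def by (intro divide_nonneg_nonneg gag_denom_nonneg plap_monotone_test(1) p)
    have Tint: "integrable lborel (T n)" for n unfolding T_def using i\<eta> iv by auto
    have [measurable]: "T n \<in> borel_measurable borel" for n using Tint[of n] by auto
    \<comment> \<open>Through \<open>wv\<close> the term with v is replaced by the one with w, so
      that only the passage from w to \<eta> n has to be estimated.\<close>
    have TS: "(LINT z|lborel. T n z) \<le> (LINT z|lborel. plap_integrand s p (\<eta> n) (\<phi> n) z - plap_integrand s p w (\<phi> n) z)" for n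
      unfolding T_def using wv[of n] i\<eta> iv iw by simp
    \<comment> \<open>The coefficient of e is independent of n thanks to the uniform energy bound B,
      so e can be fixed before n is sent to infinity.\<close>
    have small: "\<exists>C>0. \<forall>n. (LINT z|lborel. T n z) \<le> e * (Ew + B) + C * (1 / 2) ^ n" if e: "0 < e" for e
    proof -
      obtain C where C: "C > 0" "\<And>a b D. 0 \<le> D \<Longrightarrow> \<bar>plap p a - plap p b\<bar> * D \<le> e * (\<bar>b\<bar> powr p + D powr p) + C * \<bar>a - b\<bar> powr p"
        using plap_diff_mult_le[OF p e] by blast
      have "(LINT z|lborel. T n z) \<le> e * (Ew + B) + C * (1 / 2) ^ n" for n
      proof -
        let ?Ew = "\<lambda>z. \<bar>w (fst z) - w (snd z)\<bar> powr p / gag_denom s p z"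
        let ?E\<phi> = "\<lambda>z. \<bar>\<phi> n (fst z) - \<phi> n (snd z)\<bar> powr p / gag_denom s p z"
        let ?d = "\<lambda>x. w x - \<eta> n x"
        let ?Ed = "\<lambda>z. \<bar>?d (fst z) - ?d (snd z)\<bar> powr p / gag_denom s p z"
        have gd: "gag_energy s p ?d < \<infinity>" using \<eta>gd[of n] by (rule le_less_trans) simp
        have ints: "integrable lborel ?Ew" "integrable lborel ?E\<phi>" "integrable lborel ?Ed"
          by (rule gag_energy_integrable(1)[OF wm gw], rule gag_energy_integrable(1)[OF _ g\<phi>fin], simp, rule gag_energy_integrable(1)[OF _ gd], simp)
        have Ed: "(LINT z|lborel. ?Ed z) \<le> (1 / 2) ^ n"
        proof -
          have "ennreal (LINT z|lborel. ?Ed z) = gag_energy s p ?d" by (rule gag_energy_integrable(2)[OF _ gd, symmetric]) simp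
          also have "\<dots> \<le> ennreal ((1 / 2) ^ n)" by (rule \<eta>gd)
          finally show ?thesis by (subst (asm) ennreal_le_iff) auto
        qed
        have "(LINT z|lborel. plap_integrand s p (\<eta> n) (\<phi> n) z - plap_integrand s p w (\<phi> n) z) \<le> (LINT z|lborel. e * (?Ew z + ?E\<phi> z) + C * ?Ed z)"
        proof (rule integral_mono)
          fix z
          let ?a = "\<eta> n (fst z) - \<eta> n (snd z)" and ?b = "w (fst z) - w (snd z)" and ?D = "\<phi> n (fst z) - \<phi> n (snd z)"
          have "plap_integrand s p (\<eta> n) (\<phi> n) z - plap_integrand s p w (\<phi> n) z = ((plap p ?a - plap p ?b) * ?D) / gag_denom s p z"
            by (simp add: plap_integrand_def left_diff_distrib diff_divide_distrib)
          also have "\<dots> \<le> (e * (\<bar>?b\<bar> powr p + \<bar>?D\<bar> powr p) + C * \<bar>?a - ?b\<bar> powr p) / gag_denom s p z"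
          proof (intro divide_right_mono gag_denom_nonneg)
            have "(plap p ?a - plap p ?b) * ?D \<le> \<bar>plap p ?a - plap p ?b\<bar> * \<bar>?D\<bar>"
              by (metis abs_ge_self abs_mult)
            also have "\<dots> \<le> e * (\<bar>?b\<bar> powr p + \<bar>?D\<bar> powr p) + C * \<bar>?a - ?b\<bar> powr p" by (rule C) simp
            finally show "(plap p ?a - plap p ?b) * ?D \<le> e * (\<bar>?b\<bar> powr p + \<bar>?D\<bar> powr p) + C * \<bar>?a - ?b\<bar> powr p" .
          qed
          also have "\<bar>?a - ?b\<bar> = \<bar>?d (fst z) - ?d (snd z)\<bar>" by linarith
          also have "(e * (\<bar>?b\<bar> powr p + \<bar>?D\<bar> powr p) + C * \<bar>?d (fst z) - ?d (snd z)\<bar> powr p) / gag_denom s p z = e * (?Ew z + ?E\<phi> z) + C * ?Ed z"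
            by (simp add: add_divide_distrib distrib_left)
          finally show "plap_integrand s p (\<eta> n) (\<phi> n) z - plap_integrand s p w (\<phi> n) z \<le> e * (?Ew z + ?E\<phi> z) + C * ?Ed z" .
        next
          show "integrable lborel (\<lambda>z. e * (?Ew z + ?E\<phi> z) + C * ?Ed z)"
            by (intro Bochner_Integration.integrable_add integrable_mult_right ints)
        qed (use i\<eta> iw in auto)
        also have "\<dots> = e * (Ew + (LINT z|lborel. ?E\<phi> z)) + C * (LINT z|lborel. ?Ed z)"
          unfolding Ew_def by (rule integral_linear_combination[OF ints])
        also have "\<dots> \<le> e * (Ew + B) + C * (1 / 2) ^ n"
          using E\<phi>[of n] Ed e C(1) by (intro add_mono mult_left_mono) auto
        finally show ?thesis using TS[of n] by linarith
      qed
      then show ?thesis using C(1) by blast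
    qed
    have Tlim: "(\<lambda>n. LINT z|lborel. T n z) \<longlonglongrightarrow> 0"
    proof (rule LIMSEQ_I)
      fix r :: real assume r: "0 < r"
      define e where "e = r / (2 * (Ew + B + 1))"
      have e: "0 < e" using r Ew(2) B by (simp add: e_def)
      obtain C where C: "C > 0" "\<And>n. (LINT z|lborel. T n z) \<le> e * (Ew + B) + C * (1 / 2) ^ n" using small[OF e] by blast
      have eb: "e * (Ew + B) < r / 2" using r Ew(2) B by (simp add: e_def field_simps add_pos_nonneg)
      have "(\<lambda>n. C * (1 / 2) ^ n :: real) \<longlonglongrightarrow> C * 0"
        by (intro tendsto_mult_left LIMSEQ_realpow_zero) auto
      then have "\<forall>\<^sub>F n in sequentially. C * (1 / 2) ^ n < r / 2"
        using r by (intro order_tendstoD(2)) auto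
      then obtain N where N: "\<And>n. n \<ge> N \<Longrightarrow> C * (1 / 2) ^ n < r / 2" by (auto simp: eventually_sequentially)
      have "norm ((LINT z|lborel. T n z) - 0) < r" if "n \<ge> N" for n
      proof -
        have "0 \<le> (LINT z|lborel. T n z)" using T0 by (intro Bochner_Integration.integral_nonneg)
        then show ?thesis using C(2)[of n] N[OF that] eb by simp
      qed
      then show "\<exists>N. \<forall>n\<ge>N. norm ((LINT z|lborel. T n z) - 0) < r" by blast
    qed
    define \<psi> where "\<psi> x = max (w x - v x) 0" for x
    have [measurable]: "\<psi> \<in> borel_measurable borel" unfolding \<psi>_def by measurable
    define T' where "T' z = (plap p (w (fst z) - w (snd z)) - plap p (v (fst z) - v (snd z))) * (\<psi> (fst z) - \<psi> (snd z)) / gag_denom s p z" for z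
    have [measurable]: "T' \<in> borel_measurable borel" unfolding T'_def using p by measurable
    have T'0: "0 \<le> T' z" for z
      unfolding T'_def \<psi>_def by (intro divide_nonneg_nonneg gag_denom_nonneg plap_monotone_test(1) p)
    have Tconv: "AE z in lborel. (\<lambda>n. ennreal (T n z)) \<longlonglongrightarrow> ennreal (T' z)"
      using AE_lborel_fst_snd[OF lim]
    proof eventually_elim
      case (elim z)
      have 1: "(\<lambda>n. \<eta> n x) \<longlonglongrightarrow> w x" if "(\<lambda>n. w x - \<eta> n x) \<longlonglongrightarrow> 0" for x
        using tendsto_diff[OF tendsto_const[of "w x"] that] by simp
      have 2: "(\<lambda>n. \<phi> n x) \<longlonglongrightarrow> \<psi> x" if "(\<lambda>n. w x - \<eta> n x) \<longlonglongrightarrow> 0" for x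
        unfolding \<phi>_def \<psi>_def by (intro tendsto_intros 1 that)
      have "(\<lambda>n. plap p (\<eta> n (fst z) - \<eta> n (snd z))) \<longlonglongrightarrow> plap p (w (fst z) - w (snd z))"
        using elim by (intro isCont_tendsto_compose[OF isCont_plap[OF p]] tendsto_diff 1) auto
      then have "(\<lambda>n. T n z) \<longlonglongrightarrow> T' z"
        unfolding Teq T'_def divide_inverse using elim by (intro tendsto_mult tendsto_diff 2 tendsto_const) auto
      then show ?case by (rule tendsto_ennrealI)
    qed
    \<comment> \<open>Fatou's lemma, available because T n is nonnegative: the terms with v come
      without an integrable majorant.\<close>
    have "(\<integral>\<^sup>+z. ennreal (T' z) \<partial>lborel) = (\<integral>\<^sup>+z. liminf (\<lambda>n. ennreal (T n z)) \<partial>lborel)"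
      using Tconv by (intro nn_integral_cong_AE) (auto elim!: eventually_mono dest: lim_imp_Liminf[rotated])
    also have "\<dots> \<le> liminf (\<lambda>n. \<integral>\<^sup>+z. ennreal (T n z) \<partial>lborel)"
      by (intro nn_integral_liminf) auto
    also have "\<dots> = 0"
    proof (rule lim_imp_Liminf)
      have "(\<integral>\<^sup>+z. ennreal (T n z) \<partial>lborel) = ennreal (LINT z|lborel. T n z)" for n
        by (intro nn_integral_eq_integral Tint AE_I2 T0)
      then show "(\<lambda>n. \<integral>\<^sup>+z. ennreal (T n z) \<partial>lborel) \<longlonglongrightarrow> 0"
        using tendsto_ennrealI[OF Tlim] by simp
    qed simp
    finally have "(\<integral>\<^sup>+z. ennreal (T' z) \<partial>lborel) = 0" by simp
    then have "AE z in lborel. ennreal (T' z) = 0"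
      by (subst (asm) nn_integral_0_iff_AE) auto
    then have "AE z in lborel. \<psi> (fst z) = \<psi> (snd z)"
    proof eventually_elim
      case (elim z)
      then have T0': "T' z = 0" using T'0[of z] by (simp add: ennreal_eq_0_iff)
      \<comment> \<open>On the diagonal the denominator is 0 and T' z = 0 carries no information,
        but there the claim is trivial.\<close>
      show ?case
      proof (cases "fst z = snd z")
        case False
        then have "gag_denom s p z \<noteq> 0" by (simp add: gag_denom_def)
        then have "(plap p (w (fst z) - w (snd z)) - plap p (v (fst z) - v (snd z))) * (\<psi> (fst z) - \<psi> (snd z)) = 0"
          using T0' by (simp add: T'_def)
        then show ?thesis unfolding \<psi>_def by (rule plap_monotone_test(2)[OF p])
      qed simp
    qed
    then have "AE x in lborel. \<psi> x = 0"
      using v0 w\<Omega> by (intro AE_diagonal_constant[OF _ _ bd]) (auto simp: \<psi>_def max_def)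
    then show ?thesis
      by eventually_elim (auto simp: \<psi>_def w_def max_def split: if_splits)
  qed
  \<comment> \<open>A countable sequence of values of \<epsilon>, so that the exceptional null sets
    can be united.\<close>
  have "\<forall>n::nat. AE x in lborel. max (u x - 1 / real (Suc n)) 0 \<le> v x"
    by (intro allI main) simp
  then have "AE x in lborel. \<forall>n::nat. max (u x - 1 / real (Suc n)) 0 \<le> v x"
    unfolding AE_all_countable .
  then show ?thesis
  proof eventually_elim
    case (elim x)
    show "u x \<le> v x"
    proof (rule field_le_epsilon)
      fix e :: real assume "0 < e"
      then obtain n where "1 / real (Suc n) < e" by (metis nat_approx_posE)
      then show "u x \<le> v x + e" using elim[rule_format, of n] by linarith
    qed
  qed
qed

subsection \<open>Borel representatives and reflections\<close>

lemma borel_measurable_lebesgue_AE: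
  fixes f g :: "'a::euclidean_space \<Rightarrow> real"
  assumes g: "g \<in> borel_measurable borel" and eq: "AE x in lborel. f x = g x"
  shows "f \<in> borel_measurable lebesgue"
proof (rule measurableI)
  fix A :: "real set" assume A: "A \<in> sets borel"
  have "g -` A \<inter> space borel \<in> sets borel" using g A by (rule measurable_sets)
  then have B: "g -` A \<in> sets lebesgue" by simp
  have "AE x in lebesgue. x \<in> g -` A \<longleftrightarrow> x \<in> f -` A"
    using AE_completion[OF eq] by (auto elim!: eventually_mono)
  from completion.in_sets_AE[OF this B] show "f -` A \<inter> space lebesgue \<in> sets lebesgue"
    by simp
qed simp

lemma has_bochner_integral_lebesgue_lborel:
  fixes f g :: "'a::euclidean_space \<Rightarrow> real"
  assumes f: "has_bochner_integral lebesgue f r" and g: "g \<in> borel_measurable borel" and eq: "AE x in lborel. f x = g x"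
  shows "has_bochner_integral lborel g r"
proof -
  have "f \<in> borel_measurable lebesgue" using f by (rule borel_measurable_has_bochner_integral)
  moreover have "g \<in> borel_measurable lebesgue" using g by (intro measurable_completion) simp
  ultimately have "has_bochner_integral lebesgue g r"
    using f AE_completion[OF eq] has_bochner_integral_cong_AE[of f lebesgue g r] by blast
  then show ?thesis
    using g by (auto simp: has_bochner_integral_iff integrable_completion integral_completion)
qed

lemma integral_lebesgue_lborel:
  fixes f g :: "'a::euclidean_space \<Rightarrow> real"
  assumes g: "g \<in> borel_measurable borel" and eq: "AE x in lborel. f x = g x"
  shows "(LINT x|lebesgue. f x) = (LINT x|lborel. g x)"
proof -
  have "(LINT x|lebesgue. f x) = (LINT x|lebesgue. g x)"
  proof (rule integral_cong_AE)
    show "g \<in> borel_measurable lebesgue" using g by (intro measurable_completion) simp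
  qed (rule borel_measurable_lebesgue_AE[OF g eq], rule AE_completion[OF eq])
  also have "\<dots> = (LINT x|lborel. g x)" using g by (intro integral_completion) simp
  finally show ?thesis .
qed

lemma nn_integral_lebesgue_lborel:
  assumes eq: "AE x in lborel. f x = g x"
  shows "(\<integral>\<^sup>+x. f x \<partial>lebesgue) = (\<integral>\<^sup>+x. g x \<partial>lborel)"
  using AE_completion[OF eq] by (subst nn_integral_completion[symmetric]) (rule nn_integral_cong_AE)

lemma gagliardo_energy_lborel:
  fixes u v :: "'a::euclidean_space \<Rightarrow> real"
  assumes "AE x in lborel. u x = v x"
  shows "gagliardo_energy s p A u =
    (\<integral>\<^sup>+z. ennreal (indicator (A \<times> A) z * (\<bar>v (fst z) - v (snd z)\<bar> powr p / gag_denom s p z)) \<partial>lborel)"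
  unfolding gagliardo_energy_def
proof (rule nn_integral_lebesgue_lborel)
  show "AE z in lborel. ennreal (\<bar>u (fst z) - u (snd z)\<bar> powr p / norm (fst z - snd z) powr (real DIM('a) + s * p)) * indicator (A \<times> A) z
     = ennreal (indicator (A \<times> A) z * (\<bar>v (fst z) - v (snd z)\<bar> powr p / gag_denom s p z))"
    using AE_lborel_fst_snd[OF assms] by eventually_elim (auto simp: gag_denom_def indicator_def)
qed

lemma Wsp_norm_p_finite:
  fixes u v :: "'a::euclidean_space \<Rightarrow> real"
  assumes "Wsp s p u" and eq: "AE x in lborel. u x = v x"
  shows "Wsp_norm_p s p v < \<infinity>"
proof -
  have "(\<integral>\<^sup>+x. ennreal (\<bar>u x\<bar> powr p) * indicator UNIV x \<partial>lebesgue) = (\<integral>\<^sup>+x. ennreal (\<bar>v x\<bar> powr p) \<partial>lborel)"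
    using eq by (intro nn_integral_lebesgue_lborel) (auto elim!: eventually_mono)
  moreover have "gagliardo_energy s p UNIV u = gag_energy s p v"
    unfolding gagliardo_energy_lborel[OF eq] gag_energy_def by simp
  ultimately show ?thesis using assms(1) by (simp add: Wsp_def Lp_on_def Wsp_norm_p_def)
qed

lemma smooth_borel_measurable:
  assumes "smooth \<phi>"
  shows "\<phi> \<in> borel_measurable borel"
proof -
  have "Ck 0 \<phi>" using assms unfolding smooth_def by blast
  then show ?thesis by (auto intro: borel_measurable_continuous_onI)
qed

text \<open>Lebesgue measure on pairs is the completion of the product measure and not the product
  itself. Passing once to Borel functions with pointwise signs lets everything else run over
  \<open>lborel\<close>, where Tonelli's theorem applies directly.\<close>

lemma weak_solution_borel_representative:
  fixes u f :: "'a::euclidean_space \<Rightarrow> real"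
  assumes p: "1 < p" and s: "0 < s" and \<Omega>: "open \<Omega>"
    and f: "set_integrable lebesgue \<Omega> f" "AE x in lebesgue. x \<in> \<Omega> \<longrightarrow> f x \<ge> 0"
    and u: "weak_solution s p \<gamma> \<Omega> f u" and zd: "zero_dirichlet s p \<Omega> u"
  shows "\<exists>v g. (AE x in lborel. u x = v x) \<and> (AE x in lborel. x \<in> \<Omega> \<longrightarrow> f x = g x) \<and> (\<forall>x. 0 \<le> g x) \<and>
    (\<forall>x\<in>\<Omega>. 0 < v x) \<and> weak_sol s p \<Omega> (\<lambda>x. indicator \<Omega> x * (g x / v x powr \<gamma>)) v \<and>
    (\<forall>\<epsilon>>0. Wsp_norm_p s p (\<lambda>x. max (v x - \<epsilon>) 0) < \<infinity>)"
proof -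
  have [measurable]: "\<Omega> \<in> sets borel" and \<Omega>L: "\<Omega> \<in> sets lebesgue" using \<Omega> by auto
  have upos: "AE x in lborel. x \<in> \<Omega> \<longrightarrow> u x > 0" and u0: "AE x in lborel. x \<notin> \<Omega> \<longrightarrow> u x = 0"
    using u by (auto simp: weak_solution_def AE_completion_iff)
  have "u \<in> borel_measurable (lebesgue_on \<Omega>)" using u by (simp add: weak_solution_def Lp_on_def)
  then have "(\<lambda>x. if x \<in> \<Omega> then u x else 0) \<in> borel_measurable lebesgue"
    using borel_measurable_if[OF \<Omega>L] by blast
  then obtain u1 where u1[measurable]: "u1 \<in> borel_measurable lborel" and u1eq: "AE x in lborel. (if x \<in> \<Omega> then u x else 0) = u1 x"
    using completion_ex_borel_measurable_real by blast
  \<comment> \<open>The value 1 fills the null set of points of \<Omega> at which the Borel version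
    fails to be positive.\<close>
  define v where "v x = (if x \<in> \<Omega> then (if u1 x > 0 then u1 x else 1) else 0)" for x
  have [measurable]: "u1 \<in> borel_measurable borel" using u1 by simp
  have vm[measurable]: "v \<in> borel_measurable borel" unfolding v_def by measurable
  have vpos: "0 < v x" if "x \<in> \<Omega>" for x using that by (simp add: v_def)
  have v0: "v x = 0" if "x \<notin> \<Omega>" for x using that by (simp add: v_def)
  have uv: "AE x in lborel. u x = v x"
    using u1eq upos u0 by eventually_elim (auto simp: v_def split: if_splits)
  have "(\<lambda>x. indicator \<Omega> x *\<^sub>R f x) \<in> borel_measurable lebesgue"
    using f(1) unfolding set_integrable_def by (rule borel_measurable_integrable)
  then obtain f1 where f1[measurable]: "f1 \<in> borel_measurable lborel" and f1eq: "AE x in lborel. indicator \<Omega> x *\<^sub>R f x = f1 x"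
    using completion_ex_borel_measurable_real by blast
  have [measurable]: "f1 \<in> borel_measurable borel" using f1 by simp
  define g where "g x = max (f1 x) 0" for x
  have [measurable]: "g \<in> borel_measurable borel" unfolding g_def by measurable
  have fpos: "AE x in lborel. x \<in> \<Omega> \<longrightarrow> f x \<ge> 0" using f(2) by (simp add: AE_completion_iff)
  have fg: "AE x in lborel. x \<in> \<Omega> \<longrightarrow> f x = g x"
    using f1eq fpos by eventually_elim (auto simp: g_def max_def)
  define F where "F x = indicator \<Omega> x * (g x / v x powr \<gamma>)" for x
  have [measurable]: "F \<in> borel_measurable borel" unfolding F_def by measurable
  have reg: "locally_regular s p \<Omega> F v"
    unfolding locally_regular_def
  proof (intro conjI allI impI)
    have "(\<integral>\<^sup>+x. ennreal (\<bar>u x\<bar> powr (p - 1)) * indicator \<Omega> x \<partial>lebesgue) = (\<integral>\<^sup>+x. ennreal (\<bar>v x\<bar> powr (p - 1)) \<partial>lborel)"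
      using uv p by (intro nn_integral_lebesgue_lborel) (auto elim!: eventually_mono simp: indicator_def v0)
    then show "(\<integral>\<^sup>+x. ennreal (\<bar>v x\<bar> powr (p - 1)) \<partial>lborel) < \<infinity>"
      using u by (simp add: weak_solution_def Lp_on_def)
    fix K :: "'a set" assume K: "compact K" "K \<subseteq> \<Omega>"
    then have cc: "compactly_contained K \<Omega>" by (simp add: compactly_contained_def compact_imp_closed closure_closed)
    have KB[measurable]: "K \<in> sets borel" using K(1) by (rule borel_compact)
    then have KL: "K \<in> sets lebesgue" by simp
    show "(\<integral>\<^sup>+z. ennreal (indicator (K \<times> K) z * (\<bar>v (fst z) - v (snd z)\<bar> powr p / gag_denom s p z)) \<partial>lborel) < \<infinity>"
      unfolding gagliardo_energy_lborel[OF uv, symmetric]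
      using u KL cc by (simp add: weak_solution_def Wsp_loc_def)
    have "set_integrable lebesgue K (\<lambda>x. f x / u x powr \<gamma>)"
      using u KL cc unfolding weak_solution_def L1_loc_def by blast
    then have "integrable lebesgue (\<lambda>x. indicator K x *\<^sub>R (f x / u x powr \<gamma>))" by (simp add: set_integrable_def)
    from has_bochner_integral_integrable[OF this]
    have "has_bochner_integral lborel (\<lambda>x. indicator K x * F x) (LINT x|lebesgue. indicator K x *\<^sub>R (f x / u x powr \<gamma>))"
    proof (rule has_bochner_integral_lebesgue_lborel)
      show "AE x in lborel. indicator K x *\<^sub>R (f x / u x powr \<gamma>) = indicator K x * F x"
        using uv fg K(2) by (auto elim!: eventually_elim2 simp: F_def indicator_def)
    qed measurable
    then show "integrable lborel (\<lambda>x. indicator K x * F x)" by (rule integrable.intros)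
  qed (auto intro: vm)
  have test: "weak_eq s p F v \<phi>" if \<phi>: "test_function \<Omega> \<phi>" for \<phi>
  proof -
    have [measurable]: "\<phi> \<in> borel_measurable borel"
      using \<phi> by (intro smooth_borel_measurable) (simp add: test_function_def)
    have "has_bochner_integral lebesgue
          (\<lambda>z. \<bar>u (fst z) - u (snd z)\<bar> powr (p - 2) * (u (fst z) - u (snd z))
                 * (\<phi> (fst z) - \<phi> (snd z)) / norm (fst z - snd z) powr (real DIM('a) + s * p))
          (LINT x:\<Omega>|lebesgue. f x / u x powr \<gamma> * \<phi> x)"
      using u \<phi> by (simp add: weak_solution_def)
    then have "has_bochner_integral lborel (plap_integrand s p v \<phi>) (LINT x:\<Omega>|lebesgue. f x / u x powr \<gamma> * \<phi> x)"
    proof (rule has_bochner_integral_lebesgue_lborel)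
      show "plap_integrand s p v \<phi> \<in> borel_measurable borel" using p by (intro borel_measurable_plap_integrand) auto
      show "AE z in lborel. \<bar>u (fst z) - u (snd z)\<bar> powr (p - 2) * (u (fst z) - u (snd z))
                 * (\<phi> (fst z) - \<phi> (snd z)) / norm (fst z - snd z) powr (real DIM('a) + s * p) = plap_integrand s p v \<phi> z"
        using AE_lborel_fst_snd[OF uv] by eventually_elim (simp add: plap_integrand_def plap_def gag_denom_def)
    qed
    moreover have "(LINT x:\<Omega>|lebesgue. f x / u x powr \<gamma> * \<phi> x) = (LINT x|lborel. F x * \<phi> x)"
      unfolding set_lebesgue_integral_def
      using uv fg by (intro integral_lebesgue_lborel) (auto elim!: eventually_elim2 simp: F_def indicator_def)
    ultimately show ?thesis by (simp add: weak_eq_def)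
  qed
  have "weak_sol s p \<Omega> F v"
    unfolding weak_sol_def
    using reg vpos v0 weak_eq_extend[OF p s \<Omega> reg test] by (metis less_imp_le order_refl)
  moreover have "Wsp_norm_p s p (\<lambda>x. max (v x - \<epsilon>) 0) < \<infinity>" if "0 < \<epsilon>" for \<epsilon>
  proof (rule Wsp_norm_p_finite)
    show "Wsp s p (\<lambda>x. max (u x - \<epsilon>) 0)" using zd that by (simp add: zero_dirichlet_def Wsp0_def)
    show "AE x in lborel. max (u x - \<epsilon>) 0 = max (v x - \<epsilon>) 0" using uv by eventually_elim simp
  qed
  moreover have "0 \<le> g x" for x by (simp add: g_def)
  ultimately show ?thesis
    using uv fg vpos unfolding F_def [abs_def] by (intro exI[of _ v] exI[of _ g] conjI allI ballI impI)
qed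

section \<open>Reflections and their action on solutions\<close>

lemma reflect_involution:
  assumes "norm \<nu> = 1"
  shows "reflect \<nu> l (reflect \<nu> l x) = x"
proof -
  have "\<nu> \<bullet> \<nu> = 1" using assms by (simp add: dot_square_norm)
  then show ?thesis by (simp add: reflect_def inner_add_left algebra_simps flip: scaleR_add_left)
qed

lemma reflect_add: "reflect \<nu> l (x + h) = reflect \<nu> l x + reflect \<nu> 0 h"
  by (simp add: reflect_def inner_add_left algebra_simps flip: scaleR_add_left)

lemma norm_reflect:
  assumes "norm \<nu> = 1"
  shows "norm (reflect \<nu> 0 x) = norm x"
proof -
  have "\<nu> \<bullet> \<nu> = 1" using assms by (simp add: dot_square_norm)
  then have "reflect \<nu> 0 x \<bullet> reflect \<nu> 0 x = x \<bullet> x"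
    by (simp add: reflect_def inner_add_left inner_add_right inner_commute algebra_simps)
  then show ?thesis by (simp add: norm_eq_sqrt_inner)
qed

lemma reflect_diff: "reflect \<nu> l x - reflect \<nu> l y = reflect \<nu> 0 (x - y)"
  using reflect_add[of \<nu> l y "x - y"] by simp

lemma continuous_reflect: "continuous_on UNIV (reflect \<nu> l)"
  unfolding reflect_def by (intro continuous_intros)

lemma borel_measurable_reflect [measurable]: "reflect \<nu> l \<in> borel_measurable borel"
  by (rule borel_measurable_continuous_onI[OF continuous_reflect])

lemma distr_reflect:
  assumes "norm \<nu> = 1"
  shows "distr lborel borel (reflect \<nu> l) = lborel"
proof (rule lborel_distr_isometry[where L = "reflect \<nu> 0"])
  show "surj (reflect \<nu> 0)" using reflect_involution[OF assms, of 0] by (rule surjI)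
qed (auto simp: reflect_add norm_reflect[OF assms])

definition reflect2 :: "'a::euclidean_space \<Rightarrow> real \<Rightarrow> 'a \<times> 'a \<Rightarrow> 'a \<times> 'a" where
  "reflect2 \<nu> l z = (reflect \<nu> l (fst z), reflect \<nu> l (snd z))"

lemma borel_measurable_reflect2 [measurable]: "reflect2 \<nu> l \<in> borel_measurable borel"
  unfolding reflect2_def
  by (intro borel_measurable_continuous_onI continuous_intros continuous_on_compose2[OF continuous_reflect]) auto

lemma distr_reflect2:
  assumes "norm \<nu> = 1"
  shows "distr lborel borel (reflect2 \<nu> l) = lborel"
proof (rule lborel_distr_isometry[where L = "reflect2 \<nu> 0"])
  show "surj (reflect2 \<nu> 0)"
    by (rule surjI[where f = "reflect2 \<nu> 0"]) (simp add: reflect2_def reflect_involution[OF assms])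
  show "norm (reflect2 \<nu> 0 z) = norm z" for z
    by (cases z) (simp add: reflect2_def norm_Pair norm_reflect[OF assms])
qed (simp add: reflect2_def reflect_add)

lemma gag_denom_reflect2:
  assumes "norm \<nu> = 1"
  shows "gag_denom s p (reflect2 \<nu> l z) = gag_denom s p z"
  by (simp add: gag_denom_def reflect2_def reflect_diff norm_reflect[OF assms])

lemma nn_integral_invariant:
  assumes "distr lborel borel T = lborel" "T \<in> borel_measurable borel" "f \<in> borel_measurable borel"
  shows "(\<integral>\<^sup>+z. f (T z) \<partial>lborel) = (\<integral>\<^sup>+z. f z \<partial>lborel)"
  using nn_integral_distr[of T lborel borel f] assms by simp

lemma has_bochner_integral_invariant:
  fixes f :: "'a::euclidean_space \<Rightarrow> real"
  assumes "distr lborel borel T = lborel" and T: "T \<in> borel_measurable borel" and f: "has_bochner_integral lborel f r"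
  shows "has_bochner_integral lborel (\<lambda>z. f (T z)) r"
proof -
  have fm: "f \<in> borel_measurable borel" using borel_measurable_has_bochner_integral[OF f] by simp
  show ?thesis
    using f integrable_distr_eq[of T lborel borel f] integral_distr[of T lborel borel f] fm T assms(1)
    by (simp add: has_bochner_integral_iff)
qed

lemma AE_reflect:
  assumes "norm \<nu> = 1" "AE x in lborel. P x"
  shows "AE x in lborel. P (reflect \<nu> l x)"
proof (rule AE_distrD[of "reflect \<nu> l" lborel borel P])
  show "AE x in distr lborel borel (reflect \<nu> l). P x"
    unfolding distr_reflect[OF assms(1)] by (rule assms(2))
qed simp

lemma gag_energy_reflect:
  fixes w :: "'a::euclidean_space \<Rightarrow> real"
  assumes \<nu>: "norm \<nu> = 1" and [measurable]: "w \<in> borel_measurable borel"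
  shows "gag_energy s p (\<lambda>x. w (reflect \<nu> l x)) = gag_energy s p w"
proof -
  let ?f = "\<lambda>z. ennreal (\<bar>w (fst z) - w (snd z)\<bar> powr p / gag_denom s p z)"
  have "(\<integral>\<^sup>+z. ?f (reflect2 \<nu> l z) \<partial>lborel) = (\<integral>\<^sup>+z. ?f z \<partial>lborel)"
    by (rule nn_integral_invariant[OF distr_reflect2[OF \<nu>]]) auto
  then show ?thesis by (simp add: gag_energy_def gag_denom_reflect2[OF \<nu>]) (simp add: reflect2_def)
qed

lemma Wsp_norm_p_reflect:
  fixes w :: "'a::euclidean_space \<Rightarrow> real"
  assumes \<nu>: "norm \<nu> = 1" and [measurable]: "w \<in> borel_measurable borel"
  shows "Wsp_norm_p s p (\<lambda>x. w (reflect \<nu> l x)) = Wsp_norm_p s p w"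
  unfolding Wsp_norm_p_def gag_energy_reflect[OF assms]
  by (subst nn_integral_invariant[OF distr_reflect[OF \<nu>], where f = "\<lambda>x. ennreal (\<bar>w x\<bar> powr p)"]) auto

text \<open>Reflecting both variables preserves the measure and the kernel on pairs, so testing the
  reflected solution with \<phi> is the same as testing the original one with the reflected \<phi>,
  which is again admissible because \<Omega> is symmetric.\<close>

lemma weak_sol_reflect:
  fixes u F :: "'a::euclidean_space \<Rightarrow> real"
  assumes p: "1 < p" and \<nu>: "norm \<nu> = 1" and sym: "symmetric_set \<nu> l \<Omega>" and u: "weak_sol s p \<Omega> F u"
  shows "weak_sol s p \<Omega> (\<lambda>x. F (reflect \<nu> l x)) (\<lambda>x. u (reflect \<nu> l x))"
proof -
  let ?R = "reflect \<nu> l"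
  note inv = reflect_involution[OF \<nu>]
  have R\<Omega>: "?R x \<in> \<Omega> \<longleftrightarrow> x \<in> \<Omega>" for x
    using sym inv unfolding symmetric_set_def by (metis imageE imageI)
  have [measurable]: "u \<in> borel_measurable borel" "F \<in> borel_measurable borel"
    and reg: "locally_regular s p \<Omega> F u"
    using u by (auto simp: weak_sol_def locally_regular_def)
  have Rcomp: "compact (?R ` K)" "?R ` K \<subseteq> \<Omega>" if "compact K" "K \<subseteq> \<Omega>" for K
    using that R\<Omega> by (auto intro!: compact_continuous_image continuous_on_subset[OF continuous_reflect])
  have Rim: "?R x \<in> ?R ` K \<longleftrightarrow> x \<in> K" for x K using inv by (metis imageE imageI)
  have "locally_regular s p \<Omega> (\<lambda>x. F (?R x)) (\<lambda>x. u (?R x))"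
    unfolding locally_regular_def
  proof (intro conjI allI impI)
    show "(\<integral>\<^sup>+x. ennreal (\<bar>u (?R x)\<bar> powr (p - 1)) \<partial>lborel) < \<infinity>"
      using reg by (subst nn_integral_invariant[OF distr_reflect[OF \<nu>], where f = "\<lambda>x. ennreal (\<bar>u x\<bar> powr (p - 1))"])
        (auto simp: locally_regular_def)
    fix K :: "'a set" assume K: "compact K" "K \<subseteq> \<Omega>"
    note RK = Rcomp[OF K]
    have [measurable]: "?R ` K \<in> sets borel" using RK(1) by (rule borel_compact)
    let ?f = "\<lambda>z. ennreal (indicator (?R ` K) (fst z) * indicator (?R ` K) (snd z) * (\<bar>u (fst z) - u (snd z)\<bar> powr p / gag_denom s p z))"
    have ind: "indicator (A \<times> A) z = (indicator A (fst z) * indicator A (snd z) :: real)" for A and z :: "'a \<times> 'a"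
      by (cases z) (auto simp: indicator_def)
    have "(\<integral>\<^sup>+z. ?f (reflect2 \<nu> l z) \<partial>lborel) = (\<integral>\<^sup>+z. ?f z \<partial>lborel)"
      by (rule nn_integral_invariant[OF distr_reflect2[OF \<nu>]]) auto
    also have "\<dots> < \<infinity>"
      using reg RK unfolding locally_regular_def ind by blast
    finally show "(\<integral>\<^sup>+z. ennreal (indicator (K \<times> K) z * (\<bar>u (?R (fst z)) - u (?R (snd z))\<bar> powr p / gag_denom s p z)) \<partial>lborel) < \<infinity>"
      by (simp add: ind gag_denom_reflect2[OF \<nu>]) (simp add: reflect2_def indicator_def Rim)
    have "integrable lborel (\<lambda>x. indicator (?R ` K) x * F x)"
      using reg RK unfolding locally_regular_def by blast
    from has_bochner_integral_invariant[OF distr_reflect[OF \<nu>] borel_measurable_reflect has_bochner_integral_integrable[OF this]]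
    have "integrable lborel (\<lambda>x. indicator (?R ` K) (?R x) * F (?R x))" by (rule integrable.intros)
    then show "integrable lborel (\<lambda>x. indicator K x * F (?R x))" by (simp add: indicator_def Rim)
  qed auto
  moreover have "weak_eq s p (\<lambda>x. F (?R x)) (\<lambda>x. u (?R x)) \<phi>" if \<phi>: "admissible s p \<Omega> \<phi>" for \<phi>
  proof -
    have [measurable]: "\<phi> \<in> borel_measurable borel" using \<phi> by (simp add: admissible_def)
    let ?\<psi> = "\<lambda>x. \<phi> (?R x)"
    have "admissible s p \<Omega> ?\<psi>"
      unfolding admissible_def
    proof (intro conjI)
      show "\<exists>M. \<forall>x. \<bar>?\<psi> x\<bar> \<le> M" using \<phi> unfolding admissible_def by blast
      show "gag_energy s p ?\<psi> < \<infinity>" using \<phi> by (subst gag_energy_reflect[OF \<nu>]) (auto simp: admissible_def)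
      obtain K where K: "compact K" "K \<subseteq> \<Omega>" "\<And>x. x \<notin> K \<Longrightarrow> \<phi> x = 0" using \<phi> unfolding admissible_def by blast
      have "?\<psi> x = 0" if "x \<notin> ?R ` K" for x
        using that K(3)[of "?R x"] Rim[of "?R x" K] inv by metis
      then show "\<exists>K. compact K \<and> K \<subseteq> \<Omega> \<and> (\<forall>x. x \<notin> K \<longrightarrow> ?\<psi> x = 0)"
        using Rcomp[OF K(1,2)] by blast
    qed measurable
    then have we: "weak_eq s p F u ?\<psi>" using u by (simp add: weak_sol_def)
    have "has_bochner_integral lborel (\<lambda>z. plap_integrand s p u ?\<psi> (reflect2 \<nu> l z)) (LINT x|lborel. F x * ?\<psi> x)"
      by (rule has_bochner_integral_invariant[OF distr_reflect2[OF \<nu>] borel_measurable_reflect2 we[unfolded weak_eq_def]])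
    moreover have "plap_integrand s p u ?\<psi> (reflect2 \<nu> l z) = plap_integrand s p (\<lambda>x. u (?R x)) \<phi> z" for z
      by (simp add: plap_integrand_def gag_denom_reflect2[OF \<nu>]) (simp add: reflect2_def inv)
    moreover have "(LINT x|lborel. F x * ?\<psi> x) = (LINT x|lborel. F (?R x) * \<phi> x)"
    proof -
      have "(LINT x|lborel. F x * ?\<psi> x) = (LINT x|distr lborel borel ?R. F x * ?\<psi> x)"
        by (simp add: distr_reflect[OF \<nu>])
      also have "\<dots> = (LINT x|lborel. F (?R x) * ?\<psi> (?R x))" by (rule integral_distr) auto
      finally show ?thesis by (simp add: inv)
    qed
    ultimately show ?thesis by (simp add: weak_eq_def)
  qed
  ultimately show ?thesis
    using u R\<Omega> by (simp add: weak_sol_def)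
qed

subsection \<open>Symmetry\<close>

text \<open>
  Averages over balls of a function invariant under all linear reflections are exactly radial,
  because any two points of equal norm are exchanged by a reflection; and they converge to
  the function almost everywhere along a sequence of radii.
\<close>

lemma reflection_invariant_radial:
  fixes w :: "'a::euclidean_space \<Rightarrow> real"
  assumes w: "integrable lborel w" and inv: "\<And>\<nu>. norm \<nu> = 1 \<Longrightarrow> AE x in lborel. w (reflect \<nu> 0 x) = w x"
  shows "\<exists>h. AE x in lborel. w x = h (norm x)"
proof -
  have [measurable]: "w \<in> borel_measurable borel" using w by auto
  define V where "V r = measure lborel (ball (0::'a) r)" for r
  have V: "0 < V r" if "0 < r" for r
    using that content_ball_gt_0_iff[of "0::'a" r] by (simp add: V_def)
  have Ve: "emeasure lborel (ball (0::'a) r) = ennreal (V r)" for r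
    unfolding V_def using emeasure_lborel_ball_finite[of "0::'a" r] by (intro emeasure_eq_ennreal_measure) auto
  have [measurable]: "ball (0::'a) r \<in> sets borel" for r by simp
  have joint: "case_prod f \<in> borel_measurable (lborel \<Otimes>\<^sub>M lborel)"
    if "(\<lambda>z. f (fst z) (snd z)) \<in> borel_measurable (borel :: ('a \<times> 'a) measure)"
    for f :: "'a \<Rightarrow> 'a \<Rightarrow> 'b::topological_space"
    unfolding lborel_prod using that by (simp add: case_prod_unfold)
  define m where "m r x = (LINT t|lborel. indicator (ball 0 r) t * w (x + t)) / V r" for r x
  have int: "integrable lborel (\<lambda>t. indicator (ball 0 r) t * w (x + t))" for r x
  proof -
    have "integrable lborel (\<lambda>t. w (t + x) * indicator (ball 0 r) t)"
      by (rule integrable_mult_bounded[OF integrable_lborel_translation[OF w], where M = 1]) (auto simp: indicator_def)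
    then show ?thesis by (simp add: mult.commute add.commute)
  qed
  \<comment> \<open>The null set on which w violates the symmetry depends on \<nu>, and there are
    uncountably many \<nu>. Integrals ignore null sets, so the averages are invariant at every
    single point.\<close>
  have msym: "m r (reflect \<nu> 0 x) = m r x" if \<nu>: "norm \<nu> = 1" for \<nu> r x
  proof -
    let ?R = "reflect \<nu> 0"
    have "(LINT t|lborel. indicator (ball 0 r) t * w (?R x + t)) = (LINT t|distr lborel borel ?R. indicator (ball 0 r) t * w (?R x + t))"
      by (simp add: distr_reflect[OF \<nu>])
    also have "\<dots> = (LINT t|lborel. indicator (ball 0 r) (?R t) * w (?R x + ?R t))"
    proof (rule integral_distr)
      show "(\<lambda>t. indicator (ball 0 r) t * w (?R x + t)) \<in> borel_measurable borel"
        by (intro borel_measurable_times borel_measurable_indicator) simp_all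
    qed simp
    also have "\<dots> = (LINT t|lborel. indicator (ball 0 r) t * w (x + t))"
    proof (rule integral_cong_AE)
      have "AE t in lborel. w (?R t) = w t" by (rule inv[OF \<nu>])
      then have "AE t in distr lborel borel ((+) x). w (?R t) = w t" unfolding lborel_distr_plus .
      then have "AE t in lborel. w (?R (x + t)) = w (x + t)"
        by (rule AE_distrD[of "(+) x" lborel borel, rotated]) simp
      then show "AE t in lborel. indicator (ball 0 r) (?R t) * w (?R x + ?R t) = indicator (ball 0 r) t * w (x + t)"
        by eventually_elim (simp add: reflect_add[of \<nu> 0] norm_reflect[OF \<nu>] indicator_def)
      have [measurable]: "ball (0::'a) r \<in> sets borel" by simp
      show "(\<lambda>t. indicator (ball 0 r) (?R t) * w (?R x + ?R t)) \<in> borel_measurable lborel"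
        "(\<lambda>t. indicator (ball 0 r) t * w (x + t)) \<in> borel_measurable lborel" by measurable
    qed
    finally show ?thesis by (simp add: m_def)
  qed
  have mrad: "m r x = m r y" if eq: "norm x = norm y" for r and x y :: 'a
  proof (cases "x = y")
    case False
    \<comment> \<open>The normal of the hyperplane bisecting x and y; this hyperplane passes through
      0 because the norms agree.\<close>
    define \<nu> where "\<nu> = (x - y) /\<^sub>R norm (x - y)"
    have n: "norm (x - y) \<noteq> 0" using False by simp
    have \<nu>: "norm \<nu> = 1" using n by (simp add: \<nu>_def)
    have "x \<bullet> x = y \<bullet> y" using eq by (simp add: norm_eq_sqrt_inner)
    then have "2 * (x \<bullet> (x - y)) = (x - y) \<bullet> (x - y)"
      by (simp add: inner_diff_left inner_diff_right inner_commute)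
    also have "\<dots> = norm (x - y) * norm (x - y)" by (simp add: power2_norm_eq_inner[symmetric] power2_eq_square)
    finally have "2 * (x \<bullet> (x - y)) / (norm (x - y) * norm (x - y)) = 1" using n by simp
    then have "2 * (x \<bullet> \<nu>) / norm (x - y) = 1" by (simp add: \<nu>_def divide_inverse mult_ac)
    then have c: "2 * (x \<bullet> \<nu>) = norm (x - y)" using n by (simp add: field_simps)
    have "reflect \<nu> 0 x = x - (2 * (x \<bullet> \<nu>)) *\<^sub>R \<nu>" by (simp add: reflect_def)
    also have "\<dots> = y" unfolding c using n by (simp add: \<nu>_def)
    finally show ?thesis using msym[OF \<nu>, of r x] by simp
  qed simp
  \<comment> \<open>By Tonelli's theorem, the L^1 distance between w and its average over radius d
    is at most the mean of the L^1 distances between w and its translates by vectors shorter than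
    d.\<close>
  have conv: "\<exists>r>0. (\<integral>\<^sup>+x. ennreal (\<bar>m r x - w x\<bar> powr 1) \<partial>lborel) \<le> ennreal e" if e: "0 < e" for e
  proof -
    obtain d where d: "d > 0" "\<And>h. norm h < d \<Longrightarrow> (\<integral>\<^sup>+x. ennreal \<bar>w (x + h) - w x\<bar> \<partial>lborel) \<le> ennreal e"
      using integrable_L1_translation_continuous[OF w] e unfolding L1_translation_continuous_def by blast
    have le: "ennreal \<bar>m d x - w x\<bar> \<le> ennreal (1 / V d) * (\<integral>\<^sup>+t. indicator (ball 0 d) t * ennreal \<bar>w (x + t) - w x\<bar> \<partial>lborel)" for x
    proof -
      have i1: "integrable lborel (\<lambda>t. indicator (ball (0::'a) d) t * w x)"
        using emeasure_lborel_ball_finite[of "0::'a" d] by (intro integrable_mult_left) (simp add: integrable_indicator_iff)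
      have "(LINT t|lborel. indicator (ball (0::'a) d) t * w x) = V d * w x"
        by (simp add: V_def)
      then have "m d x - w x = ((LINT t|lborel. indicator (ball 0 d) t * w (x + t)) - (LINT t|lborel. indicator (ball (0::'a) d) t * w x)) / V d"
        using V[OF d(1)] by (simp add: m_def field_simps)
      also have "\<dots> = (LINT t|lborel. indicator (ball 0 d) t * (w (x + t) - w x)) / V d"
        using int i1 by (simp add: right_diff_distrib)
      finally have "\<bar>m d x - w x\<bar> = (1 / V d) * \<bar>LINT t|lborel. indicator (ball 0 d) t * (w (x + t) - w x)\<bar>"
        using V[OF d(1)] by (simp add: abs_divide)
      also have "\<dots> \<le> (1 / V d) * (LINT t|lborel. \<bar>indicator (ball 0 d) t * (w (x + t) - w x)\<bar>)"
        using V[OF d(1)] by (intro mult_left_mono integral_abs_bound) auto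
      finally have "ennreal \<bar>m d x - w x\<bar> \<le> ennreal ((1 / V d) * (LINT t|lborel. \<bar>indicator (ball 0 d) t * (w (x + t) - w x)\<bar>))"
        by (rule ennreal_leI)
      also have "\<dots> = ennreal (1 / V d) * ennreal (LINT t|lborel. \<bar>indicator (ball 0 d) t * (w (x + t) - w x)\<bar>)"
        using V[OF d(1)] by (intro ennreal_mult') simp
      also have "ennreal (LINT t|lborel. \<bar>indicator (ball 0 d) t * (w (x + t) - w x)\<bar>) = (\<integral>\<^sup>+t. ennreal \<bar>indicator (ball 0 d) t * (w (x + t) - w x)\<bar> \<partial>lborel)"
        using int i1 by (intro nn_integral_eq_integral[symmetric]) (auto simp: right_diff_distrib)
      also have "\<dots> = (\<integral>\<^sup>+t. indicator (ball 0 d) t * ennreal \<bar>w (x + t) - w x\<bar> \<partial>lborel)"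
        by (intro nn_integral_cong) (simp add: indicator_def)
      finally show ?thesis .
    qed
    have j: "case_prod (\<lambda>x t. indicator (ball (0::'a) d) t * ennreal \<bar>w (x + t) - w x\<bar>) \<in> borel_measurable (lborel \<Otimes>\<^sub>M lborel)"
      by (rule joint) measurable
    have "(\<integral>\<^sup>+x. ennreal \<bar>m d x - w x\<bar> \<partial>lborel) \<le> (\<integral>\<^sup>+x. ennreal (1 / V d) * (\<integral>\<^sup>+t. indicator (ball 0 d) t * ennreal \<bar>w (x + t) - w x\<bar> \<partial>lborel) \<partial>lborel)"
      by (intro nn_integral_mono le)
    also have "\<dots> = ennreal (1 / V d) * (\<integral>\<^sup>+x. \<integral>\<^sup>+t. indicator (ball 0 d) t * ennreal \<bar>w (x + t) - w x\<bar> \<partial>lborel \<partial>lborel)"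
      by (rule nn_integral_cmult, rule lborel.borel_measurable_nn_integral, rule j)
    also have "(\<integral>\<^sup>+x. \<integral>\<^sup>+t. indicator (ball 0 d) t * ennreal \<bar>w (x + t) - w x\<bar> \<partial>lborel \<partial>lborel)
       = (\<integral>\<^sup>+t. \<integral>\<^sup>+x. indicator (ball 0 d) t * ennreal \<bar>w (x + t) - w x\<bar> \<partial>lborel \<partial>lborel)"
      by (rule lborel_pair.Fubini'[symmetric], rule j)
    also have "\<dots> \<le> (\<integral>\<^sup>+t. ennreal e * indicator (ball (0::'a) d) t \<partial>lborel)"
    proof (intro nn_integral_mono)
      fix t
      have "(\<integral>\<^sup>+x. indicator (ball 0 d) t * ennreal \<bar>w (x + t) - w x\<bar> \<partial>lborel) = indicator (ball 0 d) t * (\<integral>\<^sup>+x. ennreal \<bar>w (x + t) - w x\<bar> \<partial>lborel)"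
        by (rule nn_integral_cmult) measurable
      also have "\<dots> \<le> ennreal e * indicator (ball (0::'a) d) t"
        using d(2)[of t] by (auto simp: indicator_def)
      finally show "(\<integral>\<^sup>+x. indicator (ball 0 d) t * ennreal \<bar>w (x + t) - w x\<bar> \<partial>lborel) \<le> ennreal e * indicator (ball (0::'a) d) t" .
    qed
    also have "\<dots> = ennreal e * ennreal (V d)"
      by (subst nn_integral_cmult_indicator) (auto simp: Ve)
    finally have "(\<integral>\<^sup>+x. ennreal \<bar>m d x - w x\<bar> \<partial>lborel) \<le> ennreal (1 / V d) * (ennreal e * ennreal (V d))"
      by (simp add: mult_left_mono)
    also have "\<dots> = ennreal e"
      using V[OF d(1)] e by (simp flip: ennreal_mult' ennreal_mult'')
    finally show ?thesis using d(1) by (intro exI[of _ d]) simp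
  qed
  have "\<forall>n::nat. \<exists>r>0. (\<integral>\<^sup>+x. ennreal (\<bar>m r x - w x\<bar> powr 1) \<partial>lborel) \<le> ennreal ((1 / 2) ^ n)"
    by (intro allI conv) simp
  then obtain r where r: "\<And>n::nat. (\<integral>\<^sup>+x. ennreal (\<bar>m (r n) x - w x\<bar> powr 1) \<partial>lborel) \<le> ennreal ((1 / 2) ^ n)"
    by metis
  have [measurable]: "m q \<in> borel_measurable borel" for q
  proof -
    have "case_prod (\<lambda>x t. indicator (ball (0::'a) q) t * w (x + t)) \<in> borel_measurable (lborel \<Otimes>\<^sub>M lborel)"
      by (rule joint) measurable
    then have "(\<lambda>x. LINT t|lborel. indicator (ball 0 q) t * w (x + t)) \<in> borel_measurable lborel"
      by (rule lborel.borel_measurable_lebesgue_integral)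
    then show ?thesis unfolding m_def by simp
  qed
  have ae: "AE x in lborel. (\<lambda>n. m (r n) x - w x) \<longlonglongrightarrow> 0"
    by (rule Lp_fast_convergence_AE[OF zero_less_one _ r]) measurable
  obtain e :: 'a where e: "norm e = 1" using nonempty_Basis norm_Basis by blast
  \<comment> \<open>The radial profile is read off along the ray through the fixed unit vector e,
    where the averages take the same value as at x.\<close>
  have "AE x in lborel. w x = lim (\<lambda>n. m (r n) (norm x *\<^sub>R e))"
    using ae
  proof eventually_elim
    case (elim x)
    have "(\<lambda>n. m (r n) x) \<longlonglongrightarrow> w x" using elim by (simp add: LIM_zero_iff)
    moreover have "m q x = m q (norm x *\<^sub>R e)" for q by (rule mrad) (simp add: e)
    ultimately show ?case by (simp add: limI)
  qed
  then show ?thesis by (intro exI[of _ "\<lambda>\<rho>. lim (\<lambda>n. m (r n) (\<rho> *\<^sub>R e))"])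
qed

lemma ball_annulus_reflect:
  assumes "is_ball_or_annulus \<Omega>" and \<nu>: "norm \<nu> = 1"
  shows "symmetric_set \<nu> 0 \<Omega>"
proof -
  have "reflect \<nu> 0 x \<in> \<Omega> \<longleftrightarrow> x \<in> \<Omega>" for x
    using assms(1) unfolding is_ball_or_annulus_def by (auto simp: norm_reflect[OF \<nu>])
  then show ?thesis
    unfolding symmetric_set_def using reflect_involution[OF \<nu>, of 0] by (auto simp: image_iff) metis
qed

text \<open>Comparison applied twice with exchanged roles. At a point of \<Omega> both right-hand
  sides have the same numerator by the symmetry of g, so the larger of the two solutions has the
  smaller right-hand side; outside \<Omega> both vanish.\<close>

lemma weak_sol_reflection_symmetric:
  fixes v g :: "'a::euclidean_space \<Rightarrow> real"
  assumes p: "1 < p" and s: "0 < s" "s < 1" and \<Omega>: "smooth_bounded_domain \<Omega>" and \<gamma>: "0 < \<gamma>"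
    and v: "weak_sol s p \<Omega> (\<lambda>x. indicator \<Omega> x * (g x / v x powr \<gamma>)) v"
    and pos: "\<And>x. x \<in> \<Omega> \<Longrightarrow> 0 < v x" and g: "\<And>x. 0 \<le> g x"
    and trunc: "\<And>\<epsilon>. 0 < \<epsilon> \<Longrightarrow> Wsp_norm_p s p (\<lambda>x. max (v x - \<epsilon>) 0) < \<infinity>"
    and \<nu>: "norm \<nu> = 1" and sym: "symmetric_set \<nu> l \<Omega>"
    and gsym: "AE x in lborel. x \<in> \<Omega> \<longrightarrow> g (reflect \<nu> l x) = g x"
  shows "AE x in lborel. v (reflect \<nu> l x) = v x"
proof -
  let ?R = "reflect \<nu> l"
  let ?F = "\<lambda>x. indicator \<Omega> x * (g x / v x powr \<gamma>)"
  have vm[measurable]: "v \<in> borel_measurable borel" using v by (simp add: weak_sol_def locally_regular_def)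
  have v0: "\<And>x. 0 \<le> v x" "\<And>x. x \<notin> \<Omega> \<Longrightarrow> v x = 0" using v by (auto simp: weak_sol_def)
  have R\<Omega>: "?R x \<in> \<Omega> \<longleftrightarrow> x \<in> \<Omega>" for x
    using sym reflect_involution[OF \<nu>] unfolding symmetric_set_def by (metis imageE imageI)
  have w: "weak_sol s p \<Omega> (\<lambda>x. ?F (?R x)) (\<lambda>x. v (?R x))"
    by (rule weak_sol_reflect[OF p \<nu> sym v])
  have F0: "0 \<le> ?F x" for x using g by (simp add: indicator_def)
  have mono: "a / c powr \<gamma> \<le> a / b powr \<gamma>" if "0 < b" "b < c" "0 \<le> a" for a b c :: real
    using that \<gamma> by (intro divide_left_mono powr_mono2) auto
  have 1: "AE x in lborel. v x \<le> v (?R x)"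
  proof (rule weak_sol_comparison[OF p s \<Omega> v w trunc])
    show "AE x in lborel. v (?R x) < v x \<longrightarrow> ?F x \<le> ?F (?R x)"
      using gsym
    proof eventually_elim
      case (elim x)
      show ?case
        using elim mono[of "v (?R x)" "v x" "g x"] g[of x] pos[of "?R x"] v0 R\<Omega>[of x]
        by (cases "x \<in> \<Omega>") (auto simp: indicator_def)
    qed
  qed (assumption, rule F0)
  have 2: "AE x in lborel. v (?R x) \<le> v x"
  proof (rule weak_sol_comparison[OF p s \<Omega> w v])
    show "Wsp_norm_p s p (\<lambda>x. max (v (?R x) - \<epsilon>) 0) < \<infinity>" if "0 < \<epsilon>" for \<epsilon>
      using trunc[OF that] Wsp_norm_p_reflect[OF \<nu>, of "\<lambda>x. max (v x - \<epsilon>) 0"] by simp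
    show "AE x in lborel. v x < v (?R x) \<longrightarrow> ?F (?R x) \<le> ?F x"
      using gsym
    proof eventually_elim
      case (elim x)
      show ?case
        using elim mono[of "v x" "v (?R x)" "g x"] g[of x] pos[of x] v0 R\<Omega>[of x]
        by (cases "x \<in> \<Omega>") (auto simp: indicator_def)
    qed
  qed (rule F0)
  from 1 2 show ?thesis by eventually_elim simp
qed

theorem theorem1p7:
  fixes \<Omega> :: "'a::euclidean_space set"
    and f u :: "'a \<Rightarrow> real"
    and p s \<gamma> :: real
  assumes "1 < p"
    and "0 < s" and "s < 1"
    and "smooth_bounded_domain \<Omega>"
    and "real DIM('a) > s * p"
    and "\<gamma> > 0"
    and "set_integrable lebesgue \<Omega> f"
    and "AE x in lebesgue. x \<in> \<Omega> \<longrightarrow> f x \<ge> 0"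
    and "weak_solution s p \<gamma> \<Omega> f u"
    and "zero_dirichlet s p \<Omega> u"
  shows "(\<forall>\<nu> l. norm \<nu> = 1 \<longrightarrow> symmetric_set \<nu> l \<Omega> \<longrightarrow> symmetric_fun_on \<nu> l \<Omega> f
            \<longrightarrow> symmetric_fun_on \<nu> l UNIV u)
       \<and> (is_ball_or_annulus \<Omega> \<longrightarrow> radial_fun_on \<Omega> f \<longrightarrow> radial_fun_on UNIV u)"
proof -
  have op: "open \<Omega>" and bd: "bounded \<Omega>" using assms(4) by (auto simp: smooth_bounded_domain_def)
  have [measurable]: "\<Omega> \<in> sets borel" using op by simp
  obtain v g where uv: "AE x in lborel. u x = v x" and fg: "AE x in lborel. x \<in> \<Omega> \<longrightarrow> f x = g x"
    and g: "\<forall>x. 0 \<le> g x" and pos: "\<forall>x\<in>\<Omega>. 0 < v x"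
    and v: "weak_sol s p \<Omega> (\<lambda>x. indicator \<Omega> x * (g x / v x powr \<gamma>)) v"
    and trunc: "\<forall>\<epsilon>>0. Wsp_norm_p s p (\<lambda>x. max (v x - \<epsilon>) 0) < \<infinity>"
    using weak_solution_borel_representative[OF assms(1,2) op assms(7-10)] by blast
  have [measurable]: "v \<in> borel_measurable borel" using v by (simp add: weak_sol_def locally_regular_def)
  have v0: "\<And>x. 0 \<le> v x" "\<And>x. x \<notin> \<Omega> \<Longrightarrow> v x = 0" using v by (auto simp: weak_sol_def)
  have sym: "AE x in lborel. v (reflect \<nu> l x) = v x"
    if \<nu>: "norm \<nu> = 1" and S: "symmetric_set \<nu> l \<Omega>" and fs: "symmetric_fun_on \<nu> l \<Omega> f" for \<nu> l
  proof (rule weak_sol_reflection_symmetric[OF assms(1-4,6) v pos[rule_format] g[rule_format] trunc[rule_format] \<nu> S])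
    have R\<Omega>: "reflect \<nu> l x \<in> \<Omega> \<longleftrightarrow> x \<in> \<Omega>" for x
      using S reflect_involution[OF \<nu>] unfolding symmetric_set_def by (metis imageE imageI)
    have "AE x in lborel. x \<in> \<Omega> \<longrightarrow> f (reflect \<nu> l x) = f x"
      using fs by (simp add: symmetric_fun_on_def AE_completion_iff)
    then show "AE x in lborel. x \<in> \<Omega> \<longrightarrow> g (reflect \<nu> l x) = g x"
      using fg AE_reflect[OF \<nu> fg, of l]
    proof eventually_elim
      case (elim x)
      then show ?case using R\<Omega>[of x] by auto
    qed
  qed
  show ?thesis
  proof (intro conjI allI impI)
    fix \<nu> :: 'a and l
    assume \<nu>: "norm \<nu> = 1" and "symmetric_set \<nu> l \<Omega>" "symmetric_fun_on \<nu> l \<Omega> f"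
    from sym[OF this] uv AE_reflect[OF \<nu> uv, of l]
    have "AE x in lborel. u (reflect \<nu> l x) = u x" by eventually_elim simp
    then show "symmetric_fun_on \<nu> l UNIV u" by (simp add: symmetric_fun_on_def AE_completion)
  next
    assume ball: "is_ball_or_annulus \<Omega>" and "radial_fun_on \<Omega> f"
    then obtain h where "AE x in lebesgue. x \<in> \<Omega> \<longrightarrow> f x = h (norm x)" unfolding radial_fun_on_def by blast
    then have h: "AE x in lborel. x \<in> \<Omega> \<longrightarrow> f x = h (norm x)" by (simp add: AE_completion_iff)
    have inv: "AE x in lborel. v (reflect \<nu> 0 x) = v x" if \<nu>: "norm \<nu> = 1" for \<nu>
    proof (rule sym[OF \<nu> ball_annulus_reflect[OF ball \<nu>]])
      have R\<Omega>: "reflect \<nu> 0 x \<in> \<Omega> \<longleftrightarrow> x \<in> \<Omega>" for x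
        using ball_annulus_reflect[OF ball \<nu>] reflect_involution[OF \<nu>] unfolding symmetric_set_def by (metis imageE imageI)
      have "AE x in lborel. x \<in> \<Omega> \<longrightarrow> f (reflect \<nu> 0 x) = f x"
        using h AE_reflect[OF \<nu> h, of 0]
      proof eventually_elim
        case (elim x)
        then show ?case using R\<Omega>[of x] by (simp add: norm_reflect[OF \<nu>])
      qed
      then show "symmetric_fun_on \<nu> 0 \<Omega> f" by (simp add: symmetric_fun_on_def AE_completion)
    qed
    \<comment> \<open>A bounded injective transform of v that vanishes outside the bounded set
      \<Omega> is integrable at once, as \<open>reflection_invariant_radial\<close> requires; it is
      inverted at the end by k / (1 - k).\<close>
    define w where "w x = v x / (1 + v x)" for x
    have [measurable]: "w \<in> borel_measurable borel" unfolding w_def by measurable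
    have w1: "\<bar>w x\<bar> \<le> 1" for x using v0(1)[of x] by (simp add: w_def divide_le_eq)
    have "integrable lborel w"
      using w1 v0(2) emeasure_bounded_finite[OF bd]
      by (intro integrableI_bounded_set[where A = \<Omega> and B = 1]) (auto simp: w_def)
    moreover have "AE x in lborel. w (reflect \<nu> 0 x) = w x" if "norm \<nu> = 1" for \<nu>
      using inv[OF that] by eventually_elim (simp add: w_def)
    ultimately obtain k where "AE x in lborel. w x = k (norm x)" using reflection_invariant_radial by blast
    then have "AE x in lborel. u x = k (norm x) / (1 - k (norm x))"
      using uv
    proof eventually_elim
      case (elim x)
      have "1 + v x > 0" using v0(1)[of x] by simp
      then have "v x = w x / (1 - w x)" by (simp add: w_def field_simps)
      then show ?case using elim by simp
    qed
    then have "AE x in lebesgue. u x = k (norm x) / (1 - k (norm x))" by (rule AE_completion)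
    then show "radial_fun_on UNIV u"
      unfolding radial_fun_on_def by (intro exI[of _ "\<lambda>\<rho>. k \<rho> / (1 - k \<rho>)"]) simp
  qed
qed

end
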